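(* Let $A$ be the Legendre polynomials operator in $L^2(-1,1)$ and define $T:\mathcal{D}(T)\subset L^2(-1,1)\to L^2(-1,1)$ by $(Tf)(x)=\ell^2[f](x)$ for a.e. $x\in(-1,1)$ and $f\in\mathcal{D}(T):=\mathcal{D}(A^2)=\{f\in\mathcal{D}(A)\mid Af\in\mathcal{D}(A)\}$; that is, $T$ is the square of $A$. Then, for $f:(-1,1)\to\mathbb{C}$, the following statements are equivalent: (i) $f\in\mathcal{D}(T)$; (ii) $f,f',f'',f'''\in AC_{\mathrm{loc}}(-1,1)$ and $(1-x^2)^2f^{(4)}\in L^2(-1,1)$; (iii) $f\in\Delta_{2,\max}$ and $[f,1]_2(\pm1)=[f,x]_2(\pm1)=0$; (iv) $f\in\Delta_{2,\max}$ and $\lim_{x\to\pm1}(1-x^2)f'(x)=\lim_{x\to\pm1}\left((1-x^2)^2f''(x)\right)'=0$. Moreover, $T$ is a self-adjoint operator in $L^2(-1,1)$ having the Legendre polynomials $\{P_n\}_{n=0}^\infty$ as a complete set of eigenfunctions in $L^2(-1,1)$ and having discrete spectrum given explicitly by $$\sigma(T)=\{n^2(n+1)^2\mid n\in\mathbb{N}_0\}.$$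
   Context: $AC_{\mathrm{loc}}(-1,1)$ denotes the complex-valued functions on $(-1,1)$ that are absolutely continuous on every compact subinterval. The Legendre expression is $\ell[y](x)=-\left((1-x^2)y'(x)\right)'$, defined for a.e. $x\in(-1,1)$. The Legendre polynomials operator $A$ in $L^2(-1,1)$ is $Af=\ell[f]$ with domain $$\mathcal{D}(A)=\{f:(-1,1)\to\mathbb{C}\mid f,f'\in AC_{\mathrm{loc}}(-1,1);\ f,\ell[f]\in L^2(-1,1);\ \lim_{x\to\pm1}(1-x^2)f'(x)=0\}.$$ (Here $Af$ is an element of $L^2(-1,1)$; "$Af\in\mathcal{D}(A)$" is understood up to a.e. equality.) The formal square of the Legendre expression is $$\ell^2[y](x)=\left((1-x^2)^2y''(x)\right)''-2\left((1-x^2)y'(x)\right)' ,$$ and its maximal domain in $L^2(-1,1)$ is $$\Delta_{2,\max}=\{f:(-1,1)\to\mathbb{C}\mid f,f',f'',f'''\in AC_{\mathrm{loc}}(-1,1);\ f,\ell^2[f]\in L^2(-1,1)\}.$$ For $f,g\in\Delta_{2,\max}$ the associated sesquilinear form is $$[f,g]_2(x)=\left((1-x^2)^2f''\right)'\overline{g}-\left((1-x^2)^2\overline{g}''\right)'f-(1-x^2)^2f''\overline{g}'+(1-x^2)^2f'\overline{g}''-2(1-x^2)f'\overline{g}+2(1-x^2)f\overline{g}',$$ all functions evaluated at $x\in(-1,1)$, and $[f,g]_2(\pm1):=\lim_{x\to\pm1}[f,g]_2(x)$ (these limits exist and are finite by Green's formula). In $[f,1]_2$ and $[f,x]_2$ the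 second argument is the constant function $1$, respectively the identity function $x\mapsto x$. A limit "$x\to\pm1$" means both one-sided limits, $x\to1^-$ and $x\to-1^+$. $P_n$ is the Legendre polynomial of degree $n$, and $\mathbb{N}_0=\{0,1,2,\dots\}$. *)

theory Defs
  imports "HOL-Analysis.Analysis" "HOL-Computational_Algebra.Polynomial"
begin

section \<open>Local absolute continuity on (-1,1)\<close>

text \<open>
  A function on (-1,1) is represented by a total function on the reals; everything
  below depends only on its values in the open interval (-1,1).
\<close>

definition abs_cont_on :: "real \<Rightarrow> real \<Rightarrow> (real \<Rightarrow> complex) \<Rightarrow> bool" where
  "abs_cont_on a b f \<longleftrightarrow>
     (\<forall>\<epsilon>>0. \<exists>\<delta>>0. \<forall>(n::nat) u v.
        (\<forall>i<n. a \<le> u i \<and> u i \<le> v i \<and> v i \<le> b) \<longrightarrow>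
        disjoint_family_on (\<lambda>i. {u i<..<v i}) {..<n} \<longrightarrow>
        (\<Sum>i<n. v i - u i) < \<delta> \<longrightarrow>
        (\<Sum>i<n. norm (f (v i) - f (u i))) < \<epsilon>)"

definition AC_loc :: "(real \<Rightarrow> complex) set" where
  "AC_loc = {f. \<forall>a b. -1 < a \<longrightarrow> a \<le> b \<longrightarrow> b < 1 \<longrightarrow> abs_cont_on a b f}"

definition ddx :: "(real \<Rightarrow> complex) \<Rightarrow> real \<Rightarrow> complex" where
  "ddx f x = vector_derivative f (at x)"

text \<open>
  \<open>AC_loc_upto k\<close>: the functions whose derivatives of order 0 to k lie in \<open>AC_loc\<close>.
  Since \<^const>\<open>vector_derivative\<close> is total, existence of the first k derivatives at every
  point of (-1,1) is required explicitly.  The derivative of order k + 1 then exists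
  almost everywhere, and the value of \<^const>\<open>ddx\<close> on the exceptional null set is irrelevant.
\<close>

definition AC_loc_upto :: "nat \<Rightarrow> (real \<Rightarrow> complex) set" where
  "AC_loc_upto k = {f. (\<forall>j\<le>k. (ddx ^^ j) f \<in> AC_loc) \<and>
                       (\<forall>j<k. \<forall>x\<in>{-1<..<1}. (ddx ^^ j) f differentiable (at x))}"

section \<open>Operators in the Hilbert space of square integrable functions on (-1,1)\<close>

abbreviation leb_I :: "real measure" where
  "leb_I \<equiv> lebesgue_on {-1<..<1}"

definition L2 :: "(real \<Rightarrow> complex) set" where
  "L2 = {f. f \<in> borel_measurable leb_I \<and> integrable leb_I (\<lambda>x. (norm (f x))\<^sup>2)}"

definition ae_eq :: "(real \<Rightarrow> complex) \<Rightarrow> (real \<Rightarrow> complex) \<Rightarrow> bool" where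
  "ae_eq f g \<longleftrightarrow> (AE x in leb_I. f x = g x)"

definition l2_inner :: "(real \<Rightarrow> complex) \<Rightarrow> (real \<Rightarrow> complex) \<Rightarrow> complex" where
  "l2_inner f g = (LINT x|leb_I. f x * cnj (g x))"

definition l2_norm :: "(real \<Rightarrow> complex) \<Rightarrow> real" where
  "l2_norm f = sqrt (LINT x|leb_I. (norm (f x))\<^sup>2)"

text \<open>
  Elements of the Hilbert space are classes of functions modulo \<^const>\<open>ae_eq\<close>.  A (possibly
  unbounded) operator is given by its graph, written as a relation between representatives
  that is saturated under \<^const>\<open>ae_eq\<close> in both arguments.
\<close>

type_synonym l2_rel = "((real \<Rightarrow> complex) \<times> (real \<Rightarrow> complex)) set"

definition op_graph ::
  "(real \<Rightarrow> complex) set \<Rightarrow> ((real \<Rightarrow> complex) \<Rightarrow> real \<Rightarrow> complex) \<Rightarrow> l2_rel" where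
  "op_graph S F = {(u, v). \<exists>f\<in>S. ae_eq u f \<and> ae_eq v (F f)}"

definition l2_operator :: "l2_rel \<Rightarrow> bool" where
  "l2_operator T \<longleftrightarrow>
     T \<subseteq> L2 \<times> L2 \<and>
     (\<forall>u v u' v'. (u, v) \<in> T \<longrightarrow> ae_eq u u' \<longrightarrow> ae_eq v v' \<longrightarrow> (u', v') \<in> T) \<and>
     (\<forall>u v v'. (u, v) \<in> T \<longrightarrow> (u, v') \<in> T \<longrightarrow> ae_eq v v') \<and>
     (\<lambda>x. 0, \<lambda>x. 0) \<in> T \<and>
     (\<forall>u v u' v'. (u, v) \<in> T \<longrightarrow> (u', v') \<in> T \<longrightarrow>
        (\<lambda>x. u x + u' x, \<lambda>x. v x + v' x) \<in> T) \<and>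
     (\<forall>c u v. (u, v) \<in> T \<longrightarrow> (\<lambda>x. c * u x, \<lambda>x. c * v x) \<in> T)"

definition densely_defined :: "l2_rel \<Rightarrow> bool" where
  "densely_defined T \<longleftrightarrow>
     (\<forall>f\<in>L2. \<forall>\<epsilon>>0. \<exists>u\<in>Domain T. l2_norm (\<lambda>x. f x - u x) < \<epsilon>)"

definition adjoint_rel :: "l2_rel \<Rightarrow> l2_rel" where
  "adjoint_rel T =
     {(g, h). g \<in> L2 \<and> h \<in> L2 \<and> (\<forall>(u, v)\<in>T. l2_inner v g = l2_inner u h)}"

definition self_adjoint :: "l2_rel \<Rightarrow> bool" where
  "self_adjoint T \<longleftrightarrow> l2_operator T \<and> densely_defined T \<and> adjoint_rel T = T"

text \<open>The resolvent set: \<open>T - z\<close> is a bijection from the domain of \<open>T\<close> onto the whole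
  Hilbert space, with bounded inverse.\<close>

definition resolvent_set :: "l2_rel \<Rightarrow> complex set" where
  "resolvent_set T = {z.
     (\<forall>(u, v)\<in>T. ae_eq (\<lambda>x. v x - z * u x) (\<lambda>x. 0) \<longrightarrow> ae_eq u (\<lambda>x. 0)) \<and>
     (\<forall>h\<in>L2. \<exists>(u, v)\<in>T. ae_eq (\<lambda>x. v x - z * u x) h) \<and>
     (\<exists>C. \<forall>(u, v)\<in>T. l2_norm u \<le> C * l2_norm (\<lambda>x. v x - z * u x))}"

definition spectrum :: "l2_rel \<Rightarrow> complex set" where
  "spectrum T = - resolvent_set T"

definition eigenfunction :: "l2_rel \<Rightarrow> complex \<Rightarrow> (real \<Rightarrow> complex) \<Rightarrow> bool" where
  "eigenfunction T z u \<longleftrightarrow> \<not> ae_eq u (\<lambda>x. 0) \<and> (u, \<lambda>x. z * u x) \<in> T"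

text \<open>Discrete spectrum: every spectral point is an isolated point of the spectrum and an
  eigenvalue of finite multiplicity.\<close>

definition has_discrete_spectrum :: "l2_rel \<Rightarrow> bool" where
  "has_discrete_spectrum T \<longleftrightarrow>
     (\<forall>z\<in>spectrum T.
        z isolated_in spectrum T \<and>
        (\<exists>u. eigenfunction T z u) \<and>
        (\<exists>(m::nat) b. \<forall>u. eigenfunction T z u \<longrightarrow>
           (\<exists>c. ae_eq u (\<lambda>x. \<Sum>i<m. c i * b i x))))"

text \<open>Completeness of a sequence: its finite linear combinations are dense.\<close>

definition l2_complete :: "(nat \<Rightarrow> real \<Rightarrow> complex) \<Rightarrow> bool" where
  "l2_complete e \<longleftrightarrow> range e \<subseteq> L2 \<and>
     (\<forall>f\<in>L2. \<forall>\<epsilon>>0. \<exists>(N::nat) c. l2_norm (\<lambda>x. f x - (\<Sum>n<N. c n * e n x)) < \<epsilon>)"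

section \<open>The Legendre expression, its formal square, and the associated operators\<close>

definition leg_w :: "real \<Rightarrow> complex" where
  "leg_w x = of_real (1 - x\<^sup>2)"

definition legendre_expr :: "(real \<Rightarrow> complex) \<Rightarrow> real \<Rightarrow> complex" where
  "legendre_expr y x = - ddx (\<lambda>t. leg_w t * ddx y t) x"

definition legendre_sq_expr :: "(real \<Rightarrow> complex) \<Rightarrow> real \<Rightarrow> complex" where
  "legendre_sq_expr y x =
     (ddx ^^ 2) (\<lambda>t. (leg_w t)\<^sup>2 * (ddx ^^ 2) y t) x - 2 * ddx (\<lambda>t. leg_w t * ddx y t) x"

definition lim0_at_ends :: "(real \<Rightarrow> complex) \<Rightarrow> bool" where
  "lim0_at_ends h \<longleftrightarrow> (h \<longlongrightarrow> 0) (at_left 1) \<and> (h \<longlongrightarrow> 0) (at_right (-1))"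

definition dom_A :: "(real \<Rightarrow> complex) set" where
  "dom_A = {f. f \<in> AC_loc_upto 1 \<and> f \<in> L2 \<and> legendre_expr f \<in> L2 \<and>
               lim0_at_ends (\<lambda>x. leg_w x * ddx f x)}"

definition op_A :: l2_rel where
  "op_A = op_graph dom_A legendre_expr"

definition dom_T :: "(real \<Rightarrow> complex) set" where
  "dom_T = {f \<in> dom_A. \<exists>g\<in>dom_A. ae_eq (legendre_expr f) g}"

definition op_T :: l2_rel where
  "op_T = op_graph dom_T legendre_sq_expr"

definition Delta2_max :: "(real \<Rightarrow> complex) set" where
  "Delta2_max = {f. f \<in> AC_loc_upto 3 \<and> f \<in> L2 \<and> legendre_sq_expr f \<in> L2}"

definition bracket2 :: "(real \<Rightarrow> complex) \<Rightarrow> (real \<Rightarrow> complex) \<Rightarrow> real \<Rightarrow> complex" where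
  "bracket2 f g x =
       ddx (\<lambda>t. (leg_w t)\<^sup>2 * (ddx ^^ 2) f t) x * cnj (g x)
     - ddx (\<lambda>t. (leg_w t)\<^sup>2 * cnj ((ddx ^^ 2) g t)) x * f x
     - (leg_w x)\<^sup>2 * (ddx ^^ 2) f x * cnj (ddx g x)
     + (leg_w x)\<^sup>2 * ddx f x * cnj ((ddx ^^ 2) g x)
     - 2 * leg_w x * ddx f x * cnj (g x)
     + 2 * leg_w x * f x * cnj (ddx g x)"

text \<open>Legendre polynomials, by Rodrigues' formula.\<close>

definition legendre_poly :: "nat \<Rightarrow> real poly" where
  "legendre_poly n = smult (1 / (2 ^ n * fact n)) ((pderiv ^^ n) ([:-1, 0, 1:] ^ n))"

definition legendre_P :: "nat \<Rightarrow> real \<Rightarrow> complex" where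
  "legendre_P n x = of_real (poly (legendre_poly n) x)"

end

theory Submission
  imports Defs
begin

text \<open>
  Write \<open>p = 1 - x\<^sup>2\<close> and \<open>g = \<ell>[f] = - (p f')'\<close>.  Then \<open>\<ell>\<^sup>2[f] = \<ell>[g]\<close> almost
  everywhere, so \<open>f\<close> lies in the domain of \<open>T\<close> iff \<open>f, g, \<ell>[g]\<close> are square integrable
  and \<open>p f'\<close>, \<open>p g'\<close> vanish at both ends.  The other boundary conditions are compared with
  these through \<open>[f,1]\<^sub>2 = - p g'\<close> and \<open>(p\<^sup>2 f'')' = 2 p f' - p g'\<close>.  All integrability questions
  are settled by two Hardy inequalities: if \<open>p\<^sup>j\<^sup>+\<^sup>1 F'\<close> is square integrable, so is
  \<open>p\<^sup>j F\<close>; if \<open>F\<close> vanishes at the ends and \<open>F' / p\<^sup>j\<close> is square integrable, so is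
  \<open>F / p\<^sup>j\<^sup>+\<^sup>1\<close>.  Both follow from the Schur test.

  For the spectral part, \<open>\<ell>[w] = h\<close> is solved explicitly by integrating twice whenever \<open>h\<close>
  has mean 0.  Together with the completeness of the Legendre polynomials this gives:
  \<open>(g, h)\<close> is in the graph of \<open>T\<close> iff the Legendre coefficients satisfy
  \<open>h\<^sub>n = n\<^sup>2 (n + 1)\<^sup>2 g\<^sub>n\<close> for all \<open>n\<close>.  Self-adjointness and the spectrum can be read off
  from this; the series for the resolvent converges uniformly, because Hardy's inequality bounds
  the supremum of \<open>P\<^sub>n\<close> by \<open>4 (1 + n (n + 1))\<close> times its norm, so no completeness of the
  space of square integrable functions is needed.
\<close>

subsection \<open>Absolutely continuous functions\<close>

text \<open>Absolute continuity is given in its epsilon-delta form, so the fundamental theorem of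
  calculus for it comes first. Jordan's decomposition reduces it to increasing functions, whose
  Stieltjes measures have densities by Radon-Nikodym, and Lebesgue's differentiation theorem
  identifies the density with the pointwise derivative. The delicate implication is from the domain
  of T to (ii): p^2 f'''' is only one of the terms of l^2[f], and the others have to be estimated
  separately. The second Hardy inequality is therefore applied not to a derivative of f but to p^2
  f'', whose boundary values and derivative are both known through f' and g. In the opposite
  direction no boundary condition is given at all. The vanishing at the ends is then forced by
  integrability: a positive power of p times a function tends to 0 as soon as that power times its
  derivative is integrable. T is never inverted as a fourth order operator. The only differential
  equation solved is l[w] = h, and its eigenvalue 0 costs one free constant, the mean of w.\<close>

definition uniformly_ac :: "(real \<Rightarrow> 'a::real_normed_vector) \<Rightarrow> bool" where
  "uniformly_ac F \<longleftrightarrow>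
     (\<forall>\<epsilon>>0. \<exists>\<delta>>0. \<forall>(n::nat) u v.
        (\<forall>i<n. u i \<le> v i) \<longrightarrow>
        disjoint_family_on (\<lambda>i. {u i<..<v i}) {..<n} \<longrightarrow>
        (\<Sum>i<n. v i - u i) < \<delta> \<longrightarrow>
        (\<Sum>i<n. norm (F (v i) - F (u i))) < \<epsilon>)"

text \<open>Index sets other than \<open>{..<n}\<close> are needed below: pairs for a family of
  families, and the cells of a covering.\<close>

lemma uniformly_acE:
  fixes F :: "real \<Rightarrow> 'a::real_normed_vector"
  assumes "uniformly_ac F" "\<epsilon> > 0"
  obtains \<delta> where "\<delta> > 0"
    "\<forall>(I::'i set) u v. finite I \<longrightarrow> (\<forall>i\<in>I. u i \<le> v i) \<longrightarrow>
        disjoint_family_on (\<lambda>i. {u i<..<v i}) I \<longrightarrow> (\<Sum>i\<in>I. v i - u i) < \<delta> \<longrightarrow>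
        (\<Sum>i\<in>I. norm (F (v i) - F (u i))) < \<epsilon>"
proof -
  obtain \<delta> where \<delta>: "\<delta> > 0" and D: "\<forall>(n::nat) u v. (\<forall>i<n. u i \<le> v i) \<longrightarrow>
        disjoint_family_on (\<lambda>i. {u i<..<v i}) {..<n} \<longrightarrow> (\<Sum>i<n. v i - u i) < \<delta> \<longrightarrow>
        (\<Sum>i<n. norm (F (v i) - F (u i))) < \<epsilon>"
    using assms unfolding uniformly_ac_def by blast
  show thesis
  proof (rule that[OF \<delta>], intro allI impI)
    fix I :: "'i set" and u v :: "'i \<Rightarrow> real"
    assume I: "finite I" and uv: "\<forall>i\<in>I. u i \<le> v i"
      and dis: "disjoint_family_on (\<lambda>i. {u i<..<v i}) I" and sm: "(\<Sum>i\<in>I. v i - u i) < \<delta>"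
    obtain h where h: "bij_betw h {..<card I} I"
      using ex_bij_betw_nat_finite[OF I] by (auto simp: atLeast0LessThan)
    have "(\<Sum>i<card I. norm (F (v (h i)) - F (u (h i)))) < \<epsilon>"
    proof (rule D[rule_format])
      show "\<And>i. i<card I \<Longrightarrow> u (h i) \<le> v (h i)"
        using uv h by (auto simp: bij_betw_def)
      show "disjoint_family_on (\<lambda>i. {u (h i)<..<v (h i)}) {..<card I}"
        unfolding disjoint_family_on_def
      proof (intro ballI impI)
        fix i j assume ij: "i \<in> {..<card I}" "j \<in> {..<card I}" "i \<noteq> j"
        then have "h i \<noteq> h j" "h i \<in> I" "h j \<in> I"
          using h by (auto simp: bij_betw_def dest: inj_onD)
        then show "{u (h i)<..<v (h i)} \<inter> {u (h j)<..<v (h j)} = {}"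
          using dis by (rule_tac disjoint_family_onD)
      qed
      show "(\<Sum>i<card I. v (h i) - u (h i)) < \<delta>"
        using sm sum.reindex_bij_betw[OF h, of "\<lambda>i. v i - u i"] by simp
    qed
    then show "(\<Sum>i\<in>I. norm (F (v i) - F (u i))) < \<epsilon>"
      using sum.reindex_bij_betw[OF h, of "\<lambda>i. norm (F (v i) - F (u i))"] by simp
  qed
qed

text \<open>Truncating the endpoints shrinks each open interval into itself, possibly to the empty
  set.\<close>

lemma disjoint_family_on_clamp:
  fixes a b :: real
  assumes "disjoint_family_on (\<lambda>i. {u i<..<v i}) I"
  shows "disjoint_family_on (\<lambda>i. {max a (min b (u i))<..<max a (min b (v i))}) I"
    and "disjoint_family_on (\<lambda>i. {max a (u i)<..<max a (v i)}) I"
    and "disjoint_family_on (\<lambda>i. {min b (u i)<..<min b (v i)}) I"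
proof -
  have sub: "{max a (min b (u i))<..<max a (min b (v i))} \<subseteq> {u i<..<v i}"
    "{max a (u i)<..<max a (v i)} \<subseteq> {u i<..<v i}"
    "{min b (u i)<..<min b (v i)} \<subseteq> {u i<..<v i}" for i
    by (intro subsetI; unfold greaterThanLessThan_iff; linarith)+
  note * = assms[unfolded disjoint_family_on_def]
  show "disjoint_family_on (\<lambda>i. {max a (min b (u i))<..<max a (min b (v i))}) I"
    unfolding disjoint_family_on_def using * sub(1) by blast
  show "disjoint_family_on (\<lambda>i. {max a (u i)<..<max a (v i)}) I"
    unfolding disjoint_family_on_def using * sub(2) by blast
  show "disjoint_family_on (\<lambda>i. {min b (u i)<..<min b (v i)}) I"
    unfolding disjoint_family_on_def using * sub(3) by blast
qed

lemma clamp_diff_le: "u \<le> v \<Longrightarrow> max a (min b v) - max a (min b u) \<le> v - (u::real)"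
  by linarith

text \<open>Composition with the clamp extends the function by constants beyond [a,b]. The clamp is
  monotone and shortens intervals, so the same delta serves, and afterwards no side condition on the
  position of the intervals is left.\<close>

lemma abs_cont_on_imp_uniformly_ac:
  assumes "abs_cont_on a b f" "a \<le> b"
  shows "uniformly_ac (\<lambda>t. f (max a (min b t)))"
  unfolding uniformly_ac_def
proof (intro allI impI)
  fix \<epsilon> :: real assume "\<epsilon> > 0"
  then obtain \<delta> where \<delta>: "\<delta> > 0" and D: "\<forall>(n::nat) u v.
        (\<forall>i<n. a \<le> u i \<and> u i \<le> v i \<and> v i \<le> b) \<longrightarrow>
        disjoint_family_on (\<lambda>i. {u i<..<v i}) {..<n} \<longrightarrow> (\<Sum>i<n. v i - u i) < \<delta> \<longrightarrow>
        (\<Sum>i<n. norm (f (v i) - f (u i))) < \<epsilon>"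
    using assms unfolding abs_cont_on_def by blast
  show "\<exists>\<delta>>0. \<forall>(n::nat) u v. (\<forall>i<n. u i \<le> v i) \<longrightarrow>
        disjoint_family_on (\<lambda>i. {u i<..<v i}) {..<n} \<longrightarrow> (\<Sum>i<n. v i - u i) < \<delta> \<longrightarrow>
        (\<Sum>i<n. norm (f (max a (min b (v i))) - f (max a (min b (u i))))) < \<epsilon>"
  proof (intro exI[of _ \<delta>] conjI allI impI \<delta>)
    fix n :: nat and u v :: "nat \<Rightarrow> real"
    assume uv: "\<forall>i<n. u i \<le> v i" and dis: "disjoint_family_on (\<lambda>i. {u i<..<v i}) {..<n}"
      and sm: "(\<Sum>i<n. v i - u i) < \<delta>"
    show "(\<Sum>i<n. norm (f (max a (min b (v i))) - f (max a (min b (u i))))) < \<epsilon>"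
    proof (rule D[THEN spec, THEN spec, THEN spec, THEN mp, THEN mp, THEN mp])
      show "\<forall>i<n. a \<le> max a (min b (u i)) \<and> max a (min b (u i)) \<le> max a (min b (v i)) \<and>
              max a (min b (v i)) \<le> b"
        using uv \<open>a \<le> b\<close> by (auto simp: max_def min_def)
      show "disjoint_family_on (\<lambda>i. {max a (min b (u i))<..<max a (min b (v i))}) {..<n}"
        by (rule disjoint_family_on_clamp(1)[OF dis])
      have "(\<Sum>i<n. max a (min b (v i)) - max a (min b (u i))) \<le> (\<Sum>i<n. v i - u i)"
        using uv by (intro sum_mono clamp_diff_le) auto
      with sm show "(\<Sum>i<n. max a (min b (v i)) - max a (min b (u i))) < \<delta>"
        by linarith
    qed
  qed
qed

text \<open>Lengths are read as Lebesgue measures of disjoint sets; with open intervals, neighbours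
  may share an endpoint.\<close>

lemma sum_disjoint_intervals_le:
  fixes u v :: "'i \<Rightarrow> real"
  assumes "finite I" "disjoint_family_on (\<lambda>i. {u i<..<v i}) I"
    and uv: "\<And>i. i \<in> I \<Longrightarrow> c \<le> u i \<and> u i \<le> v i \<and> v i \<le> d" and "c \<le> d"
  shows "(\<Sum>i\<in>I. v i - u i) \<le> d - c"
proof -
  have "(\<Sum>i\<in>I. v i - u i) = (\<Sum>i\<in>I. measure lborel {u i<..<v i})"
    using uv by (intro sum.cong) auto
  also have "\<dots> = measure lborel (\<Union>i\<in>I. {u i<..<v i})"
    using assms by (intro measure_finite_Union[symmetric]) auto
  also have "\<dots> \<le> measure lborel {c..d}"
    using uv by (intro measure_mono_fmeasurable UN_least sets.finite_UN \<open>finite I\<close> fmeasurable_cbox[of c d, simplified])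
      fastforce+
  finally show ?thesis using \<open>c \<le> d\<close> by simp
qed

lemma uniformly_ac_continuous:
  fixes F :: "real \<Rightarrow> 'a::real_normed_vector"
  assumes "uniformly_ac F"
  shows "continuous_on UNIV F"
  unfolding continuous_on_iff
proof (intro ballI allI impI)
  fix x e :: real assume "e > 0"
  obtain \<delta> where "\<delta> > 0" and D: "\<forall>(I::unit set) u v. finite I \<longrightarrow> (\<forall>i\<in>I. u i \<le> v i) \<longrightarrow>
        disjoint_family_on (\<lambda>i. {u i<..<v i}) I \<longrightarrow> (\<Sum>i\<in>I. v i - u i) < \<delta> \<longrightarrow>
        (\<Sum>i\<in>I. norm (F (v i) - F (u i))) < e"
    by (rule uniformly_acE[OF assms \<open>e > 0\<close>])
  have "dist (F y) (F x) < e" if "dist y x < \<delta>" for y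
    using D[rule_format, of "{()}" "\<lambda>_. x" "\<lambda>_. y"] D[rule_format, of "{()}" "\<lambda>_. y" "\<lambda>_. x"] that
    by (cases "x \<le> y") (auto simp: dist_norm disjoint_family_on_def norm_minus_commute)
  then show "\<exists>d>0. \<forall>x'\<in>UNIV. dist x' x < d \<longrightarrow> dist (F x') (F x) < e"
    using \<open>\<delta> > 0\<close> by blast
qed

text \<open>Cut [a,b] into N cells shorter than the delta that belongs to 1. Each cell contributes
  at most 1 to any sum, and nothing is added outside [a,b].\<close>

lemma uniformly_ac_bounded_variation:
  fixes F :: "real \<Rightarrow> 'a::real_normed_vector"
  assumes ac: "uniformly_ac F" and "a < b"
    and le: "\<And>t. t \<le> a \<Longrightarrow> F t = F a" and ge: "\<And>t. t \<ge> b \<Longrightarrow> F t = F b"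
  obtains B where "\<forall>(n::nat) u v. (\<forall>i<n. u i \<le> v i) \<longrightarrow>
     disjoint_family_on (\<lambda>i. {u i<..<v i}) {..<n} \<longrightarrow> (\<Sum>i<n. norm (F (v i) - F (u i))) \<le> B"
proof -
  obtain \<delta> where "\<delta> > 0" and D: "\<forall>(I::nat set) u v. finite I \<longrightarrow> (\<forall>i\<in>I. u i \<le> v i) \<longrightarrow>
        disjoint_family_on (\<lambda>i. {u i<..<v i}) I \<longrightarrow> (\<Sum>i\<in>I. v i - u i) < \<delta> \<longrightarrow>
        (\<Sum>i\<in>I. norm (F (v i) - F (u i))) < 1"
    by (rule uniformly_acE[OF ac zero_less_one])
  obtain N :: nat where N: "(b - a) / \<delta> < N"
    using reals_Archimedean2 by blast
  have "0 < (b - a) / \<delta>" using \<open>\<delta> > 0\<close> \<open>a < b\<close> by simp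
  with N have "N > 0" by (smt (verit) of_nat_0_less_iff)
  define c where "c k = a + real k * ((b - a) / N)" for k
  have cN: "c N = b" "c 0 = a" using \<open>N > 0\<close> by (auto simp: c_def)
  have cSuc: "c (Suc k) - c k = (b - a) / N" for k by (simp add: c_def algebra_simps add_divide_distrib diff_divide_distrib)
  have step: "(b - a) / N < \<delta>" "0 < (b - a) / N"
    using N \<open>\<delta> > 0\<close> \<open>N > 0\<close> \<open>a < b\<close> by (auto simp: field_simps)
  have cle: "c k \<le> c (Suc k)" for k using cSuc[of k] step by linarith
  have ca: "a \<le> c k" for k
    using mult_nonneg_nonneg[OF of_nat_0_le_iff less_imp_le[OF step(2)], of k] unfolding c_def by linarith
  \<comment> \<open>Truncation to the k-th cell. By telescoping, the increment of \<open>F\<close>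
    over any interval is the sum of the increments over its truncations, whatever the position of
    the interval relative to the grid.\<close>
  define l where "l k t = max (c k) (min (c (Suc k)) t)" for k t
  have tele: "(\<Sum>k<m. F (l k t) - F (c k)) = F (min t (c m)) - F a" for m t
  proof (induction m)
    case 0
    show ?case using le[of "min t a"] by (simp add: cN)
  next
    case (Suc m)
    have "F (l m t) - F (c m) + F (min t (c m)) = F (min t (c (Suc m)))"
      using cle[of m] by (auto simp: l_def max_def min_def)
    note eq = this
    have "(\<Sum>k<Suc m. F (l k t) - F (c k)) = (F (min t (c m)) - F a) + (F (l m t) - F (c m))"
      by (simp add: Suc)
    also have "\<dots> = (F (l m t) - F (c m) + F (min t (c m))) - F a" by (simp add: algebra_simps)
    finally show ?case unfolding eq .
  qed
  have Feq: "F t = F (min t b)" for t using ge[of t] by (auto simp: min_def)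
  show thesis
  proof (rule that[of "real N"], intro allI impI)
    fix n :: nat and u v :: "nat \<Rightarrow> real"
    assume uv: "\<forall>i<n. u i \<le> v i" and dis: "disjoint_family_on (\<lambda>i. {u i<..<v i}) {..<n}"
    have "(\<Sum>i<n. norm (F (v i) - F (u i))) = (\<Sum>i<n. norm (\<Sum>k<N. F (l k (v i)) - F (l k (u i))))"
    proof (intro sum.cong refl arg_cong[where f=norm])
      fix i
      have "(\<Sum>k<N. F (l k (v i)) - F (l k (u i)))
          = (\<Sum>k<N. (F (l k (v i)) - F (c k)) - (F (l k (u i)) - F (c k)))"
        by simp
      also have "\<dots> = F (v i) - F (u i)"
        unfolding sum_subtractf[of "\<lambda>k. F (l k (v i)) - F (c k)"] tele cN(1) Feq[symmetric] by simp
      finally show "F (v i) - F (u i) = (\<Sum>k<N. F (l k (v i)) - F (l k (u i)))" by simp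
    qed
    also have "\<dots> \<le> (\<Sum>i<n. \<Sum>k<N. norm (F (l k (v i)) - F (l k (u i))))"
      by (intro sum_mono norm_sum)
    also have "\<dots> = (\<Sum>k<N. \<Sum>i<n. norm (F (l k (v i)) - F (l k (u i))))"
      by (rule sum.swap)
    also have "\<dots> \<le> (\<Sum>k<N. 1)"
    proof (intro sum_mono less_imp_le[OF D[rule_format]])
      fix k
      have d: "disjoint_family_on (\<lambda>i. {l k (u i)<..<l k (v i)}) {..<n}"
        unfolding l_def by (rule disjoint_family_on_clamp(1)[OF dis])
      show "disjoint_family_on (\<lambda>i. {l k (u i)<..<l k (v i)}) {..<n}" by (rule d)
      show le: "l k (u i) \<le> l k (v i)" if "i \<in> {..<n}" for i
        using uv that by (auto simp: l_def max_def min_def)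
      have "(\<Sum>i<n. l k (v i) - l k (u i)) \<le> c (Suc k) - c k"
        using d le cle[of k] by (intro sum_disjoint_intervals_le) (auto simp: l_def)
      then show "(\<Sum>i<n. l k (v i) - l k (u i)) < \<delta>" using cSuc step by simp
    qed auto
    finally show "(\<Sum>i<n. norm (F (v i) - F (u i))) \<le> real N" by simp
  qed
qed

section \<open>Positive variation and the Jordan decomposition\<close>

definition pos_sums :: "(real \<Rightarrow> real) \<Rightarrow> real \<Rightarrow> real set" where
  "pos_sums F x = {\<Sum>i<n. F (v i) - F (u i) | (n::nat) u v.
     (\<forall>i<n. u i \<le> v i \<and> v i \<le> x) \<and> disjoint_family_on (\<lambda>i. {u i<..<v i}) {..<n}}"

text \<open>Intervals may be omitted from a family, so only increases count: this is the positive
  part of Jordan's decomposition, taken over the whole half-line up to x.\<close>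

definition pos_variation :: "(real \<Rightarrow> real) \<Rightarrow> real \<Rightarrow> real" where
  "pos_variation F x = Sup (pos_sums F x)"

lemma pos_sumsI:
  fixes n :: nat
  shows "\<lbrakk>\<And>i. i < n \<Longrightarrow> u i \<le> v i \<and> v i \<le> x; disjoint_family_on (\<lambda>i. {u i<..<v i}) {..<n}\<rbrakk>
    \<Longrightarrow> (\<Sum>i<n. F (v i) - F (u i)) \<in> pos_sums F x"
  unfolding pos_sums_def by blast

text \<open>Constancy outside [a,b] makes the variation over the whole line finite; clamped
  functions have this form.\<close>

locale ac_bounded =
  fixes F :: "real \<Rightarrow> real" and a b :: real
  assumes ac: "uniformly_ac F" and ab: "a < b"
    and le: "\<And>t. t \<le> a \<Longrightarrow> F t = F a" and ge: "\<And>t. t \<ge> b \<Longrightarrow> F t = F b"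
begin

lemma bdd: "bdd_above (pos_sums F x)"
proof -
  obtain B where B: "\<forall>(n::nat) u v. (\<forall>i<n. u i \<le> v i) \<longrightarrow>
     disjoint_family_on (\<lambda>i. {u i<..<v i}) {..<n} \<longrightarrow> (\<Sum>i<n. norm (F (v i) - F (u i))) \<le> B"
    by (rule uniformly_ac_bounded_variation[OF ac ab le ge])
  show ?thesis
  proof (rule bdd_aboveI[of _ B])
    fix s assume "s \<in> pos_sums F x"
    then obtain n :: nat and u v where s: "s = (\<Sum>i<n. F (v i) - F (u i))"
      and uv: "\<forall>i<n. u i \<le> v i \<and> v i \<le> x" "disjoint_family_on (\<lambda>i. {u i<..<v i}) {..<n}"
      unfolding pos_sums_def by blast
    have "s \<le> (\<Sum>i<n. norm (F (v i) - F (u i)))" unfolding s by (intro sum_mono) auto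
    also have "\<dots> \<le> B" using uv by (intro B[rule_format]) auto
    finally show "s \<le> B" .
  qed
qed

lemma ne: "pos_sums F x \<noteq> {}"
  using pos_sumsI[of 0 undefined undefined x F] by (auto simp: disjoint_family_on_def)

lemma upper: "s \<in> pos_sums F x \<Longrightarrow> s \<le> pos_variation F x"
  unfolding pos_variation_def by (rule cSup_upper[OF _ bdd])

lemma pos_variation_mono: "x \<le> y \<Longrightarrow> pos_variation F x \<le> pos_variation F y"
  unfolding pos_variation_def
proof (intro cSup_subset_mono ne bdd subsetI)
  fix s assume "x \<le> y" "s \<in> pos_sums F x"
  then obtain n :: nat and u v where s: "s = (\<Sum>i<n. F (v i) - F (u i))"
    and uv: "\<forall>i<n. u i \<le> v i \<and> v i \<le> x" "disjoint_family_on (\<lambda>i. {u i<..<v i}) {..<n}"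
    unfolding pos_sums_def by blast
  show "s \<in> pos_sums F y"
    unfolding s using uv \<open>x \<le> y\<close> by (intro pos_sumsI) force+
qed

text \<open>The interval from x to y can be appended to any family on the left of x. Hence
  \<open>pos_variation F\<close> minus \<open>F\<close> is increasing as well, which is the other
  half of the decomposition.\<close>

lemma pos_variation_ge:
  assumes "x \<le> y"
  shows "pos_variation F x + (F y - F x) \<le> pos_variation F y"
proof -
  have "s \<le> pos_variation F y - (F y - F x)" if "s \<in> pos_sums F x" for s
  proof -
    from that obtain n :: nat and u v where s: "s = (\<Sum>i<n. F (v i) - F (u i))"
      and uv: "\<forall>i<n. u i \<le> v i \<and> v i \<le> x" and dis: "disjoint_family_on (\<lambda>i. {u i<..<v i}) {..<n}"
      unfolding pos_sums_def by blast
    define u' where "u' i = (if i = n then x else u i)" for i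
    define v' where "v' i = (if i = n then y else v i)" for i
    have "(\<Sum>i<Suc n. F (v' i) - F (u' i)) \<in> pos_sums F y"
    proof (rule pos_sumsI)
      show "u' i \<le> v' i \<and> v' i \<le> y" if "i < Suc n" for i
        using that uv assms by (force simp: u'_def v'_def less_Suc_eq)
      show "disjoint_family_on (\<lambda>i. {u' i<..<v' i}) {..<Suc n}"
        unfolding disjoint_family_on_def
      proof (intro ballI impI)
        fix i j assume ij: "i \<in> {..<Suc n}" "j \<in> {..<Suc n}" "i \<noteq> j"
        consider "i < n" "j < n" | "i = n" "j < n" | "i < n" "j = n"
          using ij by (fastforce simp: less_Suc_eq)
        then show "{u' i<..<v' i} \<inter> {u' j<..<v' j} = {}"
        proof cases
          case 1
          then show ?thesis using dis ij by (auto simp: u'_def v'_def disjoint_family_on_def)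
        next
          case 2
          then have "v j \<le> x" using uv by auto
          with 2 show ?thesis by (auto simp: u'_def v'_def)
        next
          case 3
          then have "v i \<le> x" using uv by auto
          with 3 show ?thesis by (auto simp: u'_def v'_def)
        qed
      qed
    qed
    moreover have "(\<Sum>i<Suc n. F (v' i) - F (u' i)) = s + (F y - F x)"
      by (simp add: u'_def v'_def s)
    ultimately show ?thesis using upper by fastforce
  qed
  then have "pos_variation F x \<le> pos_variation F y - (F y - F x)"
    unfolding pos_variation_def[of F x] by (intro cSup_least ne)
  then show ?thesis by simp
qed

text \<open>For each given interval from x i to y i take a family that nearly attains the variation
  at y i and cut it at x i. The parts beyond the respective x i together form one disjoint family
  inside the given intervals, and the absolute continuity of F applies to it.\<close>

lemma pos_variation_ac: "uniformly_ac (pos_variation F)"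
  unfolding uniformly_ac_def
proof (intro allI impI)
  fix \<epsilon> :: real assume "\<epsilon> > 0"
  then have "\<epsilon>/2 > 0" by simp
  obtain \<delta> where "\<delta> > 0" and D: "\<forall>(I::(nat\<times>nat) set) u v. finite I \<longrightarrow> (\<forall>i\<in>I. u i \<le> v i) \<longrightarrow>
        disjoint_family_on (\<lambda>i. {u i<..<v i}) I \<longrightarrow> (\<Sum>i\<in>I. v i - u i) < \<delta> \<longrightarrow>
        (\<Sum>i\<in>I. norm (F (v i) - F (u i))) < \<epsilon>/2"
    by (rule uniformly_acE[OF ac \<open>\<epsilon>/2 > 0\<close>])
  show "\<exists>\<delta>>0. \<forall>(n::nat) u v. (\<forall>i<n. u i \<le> v i) \<longrightarrow>
        disjoint_family_on (\<lambda>i. {u i<..<v i}) {..<n} \<longrightarrow> (\<Sum>i<n. v i - u i) < \<delta> \<longrightarrow>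
        (\<Sum>i<n. norm (pos_variation F (v i) - pos_variation F (u i))) < \<epsilon>"
  proof (intro exI[of _ \<delta>] conjI allI impI \<open>\<delta> > 0\<close>)
    fix n :: nat and x y :: "nat \<Rightarrow> real"
    assume xy: "\<forall>i<n. x i \<le> y i" and dis: "disjoint_family_on (\<lambda>i. {x i<..<y i}) {..<n}"
      and sm: "(\<Sum>i<n. y i - x i) < \<delta>"
    \<comment> \<open>Each of the n families may miss its supremum by this much, so that the n
      errors stay below \<epsilon>/2 in total.\<close>
    define \<eta> where "\<eta> = \<epsilon> / (2 * (real n + 1))"
    have "\<eta> > 0" "real n * \<eta> < \<epsilon> / 2" using \<open>\<epsilon> > 0\<close> by (auto simp: \<eta>_def field_simps)
    define Q where "Q i q \<longleftrightarrow> (\<forall>j<fst q. fst (snd q) j \<le> snd (snd q) j \<and> snd (snd q) j \<le> y i) \<and>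
          disjoint_family_on (\<lambda>j. {fst (snd q) j<..<snd (snd q) j}) {..<fst q} \<and>
          pos_variation F (y i) - \<eta> \<le> (\<Sum>j<fst q. F (snd (snd q) j) - F (fst (snd q) j))"
      for i and q :: "nat \<times> (nat \<Rightarrow> real) \<times> (nat \<Rightarrow> real)"
    have "\<exists>q. Q i q" for i
    proof -
      obtain s where "s \<in> pos_sums F (y i)" "pos_variation F (y i) - \<eta> < s"
        using less_cSup_iff[OF ne bdd, of "pos_variation F (y i) - \<eta>" "y i"] \<open>\<eta> > 0\<close>
        unfolding pos_variation_def by auto
      moreover from this(1) obtain m :: nat and u v where "s = (\<Sum>j<m. F (v j) - F (u j))"
        "\<forall>j<m. u j \<le> v j \<and> v j \<le> y i" "disjoint_family_on (\<lambda>j. {u j<..<v j}) {..<m}"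
        unfolding pos_sums_def by blast
      ultimately show ?thesis
        unfolding Q_def by (intro exI[of _ "(m, u, v)"]) simp_all
    qed
    then obtain q where q: "\<And>i. Q i (q i)"
      using choice[of Q] by blast
    define m u v where "m i = fst (q i)" and "u i = fst (snd (q i))" and "v i = snd (snd (q i))" for i
    have uv: "u i j \<le> v i j \<and> v i j \<le> y i" if "j < m i" for i j
      using q[of i] that by (simp add: Q_def m_def u_def v_def)
    have duv: "disjoint_family_on (\<lambda>j. {u i j<..<v i j}) {..<m i}" for i
      using q[of i] by (simp add: Q_def m_def u_def v_def)
    have suv: "pos_variation F (y i) - \<eta> \<le> (\<Sum>j<m i. F (v i j) - F (u i j))" for i
      using q[of i] by (simp add: Q_def m_def u_def v_def)
    define U where "U = (\<lambda>(i,j). max (x i) (u i j))"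
    define V where "V = (\<lambda>(i,j). max (x i) (v i j))"
    let ?I = "Sigma {..<n} (\<lambda>i. {..<m i})"
    have part: "pos_variation F (y i) - pos_variation F (x i) - \<eta> \<le> (\<Sum>j<m i. F (V (i,j)) - F (U (i,j)))"
      if "i < n" for i
    proof -
      \<comment> \<open>The parts up to x i are an admissible family for x i, so they account for at
        most the variation there; the rest carries the increase.\<close>
      have "(\<Sum>j<m i. F (min (x i) (v i j)) - F (min (x i) (u i j))) \<le> pos_variation F (x i)"
        by (intro upper pos_sumsI disjoint_family_on_clamp(3) duv conjI min.mono) (use uv in auto)
      moreover have "(\<Sum>j<m i. F (v i j) - F (u i j))
        = (\<Sum>j<m i. F (min (x i) (v i j)) - F (min (x i) (u i j))) + (\<Sum>j<m i. F (V (i,j)) - F (U (i,j)))"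
        unfolding sum.distrib[symmetric] by (intro sum.cong refl) (auto simp: U_def V_def max_def min_def)
      ultimately show ?thesis using suv[of i] by linarith
    qed
    have UV: "x i \<le> U (i,j) \<and> U (i,j) \<le> V (i,j) \<and> V (i,j) \<le> y i" if "i < n" "j < m i" for i j
      using that uv[of j i] xy by (auto simp: U_def V_def max_def)
    have dUV: "disjoint_family_on (\<lambda>j. {U (i,j)<..<V (i,j)}) {..<m i}" for i
      unfolding U_def V_def by (simp add: disjoint_family_on_clamp(2)[OF duv])
    have "(\<Sum>i<n. pos_variation F (y i) - pos_variation F (x i) - \<eta>) \<le> (\<Sum>i<n. \<Sum>j<m i. F (V (i,j)) - F (U (i,j)))"
      by (intro sum_mono part) auto
    also have "\<dots> = (\<Sum>p\<in>?I. F (V p) - F (U p))"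
      by (subst sum.Sigma) auto
    also have "\<dots> \<le> (\<Sum>p\<in>?I. norm (F (V p) - F (U p)))"
      by (intro sum_mono) auto
    also have "\<dots> < \<epsilon>/2"
    proof (rule D[rule_format])
      show "finite ?I" by auto
      show "U p \<le> V p" if "p \<in> ?I" for p using that UV by auto
      show "disjoint_family_on (\<lambda>p. {U p<..<V p}) ?I"
        unfolding disjoint_family_on_def
      proof (intro ballI impI)
        fix p q assume pq: "p \<in> ?I" "q \<in> ?I" "p \<noteq> q"
        obtain i j where p: "p = (i,j)" by (cases p)
        obtain i' j' where q: "q = (i',j')" by (cases q)
        show "{U p<..<V p} \<inter> {U q<..<V q} = {}"
        proof (cases "i = i'")
          case True
          then show ?thesis using pq dUV[of i] by (auto simp: p q disjoint_family_on_def)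
        next
          case False
          then have "{x i<..<y i} \<inter> {x i'<..<y i'} = {}"
            using pq dis by (auto simp: p q disjoint_family_on_def)
          moreover have "{U p<..<V p} \<subseteq> {x i<..<y i}" "{U q<..<V q} \<subseteq> {x i'<..<y i'}"
            using UV[of i j] UV[of i' j'] pq by (auto simp: p q)
          ultimately show ?thesis by blast
        qed
      qed
      have "(\<Sum>p\<in>?I. V p - U p) = (\<Sum>i<n. \<Sum>j<m i. V (i,j) - U (i,j))"
        by (subst sum.Sigma) auto
      also have "\<dots> \<le> (\<Sum>i<n. y i - x i)"
        using UV dUV xy by (intro sum_mono sum_disjoint_intervals_le) auto
      finally show "(\<Sum>p\<in>?I. V p - U p) < \<delta>" using sm by simp
    qed
    finally have "(\<Sum>i<n. pos_variation F (y i) - pos_variation F (x i)) - real n * \<eta> < \<epsilon>/2"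
      by (simp add: sum_subtractf)
    moreover have "(\<Sum>i<n. norm (pos_variation F (y i) - pos_variation F (x i)))
       = (\<Sum>i<n. pos_variation F (y i) - pos_variation F (x i))"
      using xy pos_variation_mono by (intro sum.cong) auto
    ultimately show "(\<Sum>i<n. norm (pos_variation F (y i) - pos_variation F (x i))) < \<epsilon>"
      using \<open>real n * \<eta> < \<epsilon> / 2\<close> by linarith
  qed
qed

end

lemma uniformly_ac_diff:
  fixes F G :: "real \<Rightarrow> 'a::real_normed_vector"
  assumes "uniformly_ac F" "uniformly_ac G"
  shows "uniformly_ac (\<lambda>x. F x - G x)"
  unfolding uniformly_ac_def
proof (intro allI impI)
  fix \<epsilon> :: real assume "\<epsilon> > 0"
  then have e2: "\<epsilon>/2 > 0" by simp
  obtain \<delta>1 where 1: "\<delta>1 > 0" "\<forall>(I::nat set) u v. finite I \<longrightarrow> (\<forall>i\<in>I. u i \<le> v i) \<longrightarrow>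
        disjoint_family_on (\<lambda>i. {u i<..<v i}) I \<longrightarrow> (\<Sum>i\<in>I. v i - u i) < \<delta>1 \<longrightarrow>
        (\<Sum>i\<in>I. norm (F (v i) - F (u i))) < \<epsilon>/2"
    by (rule uniformly_acE[OF assms(1) e2])
  obtain \<delta>2 where 2: "\<delta>2 > 0" "\<forall>(I::nat set) u v. finite I \<longrightarrow> (\<forall>i\<in>I. u i \<le> v i) \<longrightarrow>
        disjoint_family_on (\<lambda>i. {u i<..<v i}) I \<longrightarrow> (\<Sum>i\<in>I. v i - u i) < \<delta>2 \<longrightarrow>
        (\<Sum>i\<in>I. norm (G (v i) - G (u i))) < \<epsilon>/2"
    by (rule uniformly_acE[OF assms(2) e2])
  show "\<exists>\<delta>>0. \<forall>(n::nat) u v. (\<forall>i<n. u i \<le> v i) \<longrightarrow>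
        disjoint_family_on (\<lambda>i. {u i<..<v i}) {..<n} \<longrightarrow> (\<Sum>i<n. v i - u i) < \<delta> \<longrightarrow>
        (\<Sum>i<n. norm (F (v i) - G (v i) - (F (u i) - G (u i)))) < \<epsilon>"
  proof (intro exI[of _ "min \<delta>1 \<delta>2"] conjI allI impI)
    fix n :: nat and u v :: "nat \<Rightarrow> real"
    assume uv: "\<forall>i<n. u i \<le> v i" "disjoint_family_on (\<lambda>i. {u i<..<v i}) {..<n}"
      "(\<Sum>i<n. v i - u i) < min \<delta>1 \<delta>2"
    have "(\<Sum>i<n. norm (F (v i) - G (v i) - (F (u i) - G (u i))))
       \<le> (\<Sum>i<n. norm (F (v i) - F (u i)) + norm (G (v i) - G (u i)))"
      by (intro sum_mono order_trans[OF eq_refl norm_triangle_ineq4] arg_cong[where f=norm]) (simp add: algebra_simps)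
    also have "\<dots> < \<epsilon>/2 + \<epsilon>/2"
      unfolding sum.distrib using uv by (intro add_strict_mono 1(2)[rule_format] 2(2)[rule_format]) auto
    finally show "(\<Sum>i<n. norm (F (v i) - G (v i) - (F (u i) - G (u i)))) < \<epsilon>" by simp
  qed (use 1 2 in auto)
qed

section \<open>Stieltjes measures and their densities\<close>

lemma finite_family_from_nat_into:
  assumes "countable D" "D \<noteq> {}"
  shows "D = (\<Union>n. from_nat_into D ` {..<n::nat})"
proof -
  have "(\<Union>n. from_nat_into D ` {..<n}) = from_nat_into D ` UNIV" by (auto intro: lessI)
  then show ?thesis using range_from_nat_into[OF assms(2,1)] by simp
qed

text \<open>A Lebesgue null set has an open neighbourhood U of measure below delta. Cover it inside
  U by countably many non-overlapping compact intervals: every finite subfamily has total length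
  below delta, hence small Stieltjes measure, and continuity from below extends the bound to the
  whole covering.\<close>

lemma interval_measure_absolutely_continuous:
  fixes P :: "real \<Rightarrow> real"
  assumes ac: "uniformly_ac P" and mono: "\<And>x y. x \<le> y \<Longrightarrow> P x \<le> P y"
  shows "absolutely_continuous lborel (interval_measure P)"
proof -
  let ?M = "interval_measure P"
  have cont: "continuous_on UNIV P" using uniformly_ac_continuous[OF ac] .
  have Icc: "emeasure ?M {c..d} = ennreal (P d - P c)" if "c \<le> d" for c d
    using emeasure_interval_measure_Icc[OF that mono cont] by simp
  \<comment> \<open>The covering lemma works in a bounded box, so the null set is treated
    piecewise.\<close>
  have main: "emeasure ?M (N \<inter> {-r..r}) = 0" if N: "N \<in> null_sets lborel" and "r > 0" for N r
  proof -
    let ?S = "N \<inter> {-r..r}"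
    have "emeasure ?M ?S \<le> ennreal e" if "e > 0" for e
    proof (cases "?S = {}")
      case True
      then show ?thesis by simp
    next
      case False
      obtain \<delta> where "\<delta> > 0" and \<delta>: "\<forall>(I::real set set) u v. finite I \<longrightarrow> (\<forall>i\<in>I. u i \<le> v i) \<longrightarrow>
        disjoint_family_on (\<lambda>i. {u i<..<v i}) I \<longrightarrow> (\<Sum>i\<in>I. v i - u i) < \<delta> \<longrightarrow>
        (\<Sum>i\<in>I. norm (P (v i) - P (u i))) < e"
        by (rule uniformly_acE[OF ac \<open>e > 0\<close>])
      have Nb: "N \<in> sets borel" "emeasure lborel N = 0" using N by auto
      obtain U where U: "open U" "N \<subseteq> U" "emeasure lborel (U - N) < \<delta>"
        by (rule outer_regular_lborel[OF Nb(1) \<open>\<delta> > 0\<close>])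
      have "emeasure lborel U = emeasure lborel (N \<union> (U - N))" using U(2) by (simp add: Un_absorb1)
      also have "\<dots> \<le> emeasure lborel N + emeasure lborel (U - N)"
        using Nb U(1) by (intro emeasure_subadditive) auto
      finally have lU: "emeasure lborel U < \<delta>" using U(3) Nb(2) by simp
      \<comment> \<open>With this gauge every cell tagged by a point of the null set is contained in
        U.\<close>
      define g where "g x = (if x \<in> U then U else UNIV)" for x
      have "gauge g" using U(1) by (auto simp: gauge_def g_def)
      have SS: "?S \<subseteq> cbox (-r) r" "box (-r) r \<noteq> {}" using \<open>r > 0\<close> by auto
      have "\<exists>D. countable D \<and> (\<forall>K\<in>D. interior K \<noteq> {} \<and> (\<exists>c d. K = cbox c d)) \<and>
        pairwise (\<lambda>A B. interior A \<inter> interior B = {}) D \<and> (\<forall>K\<in>D. \<exists>x \<in> ?S \<inter> K. K \<subseteq> g x) \<and> ?S \<subseteq> \<Union>D"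
      proof (rule covering_lemma[OF SS \<open>gauge g\<close>])
        fix D
        assume a1: "countable D" and a3: "\<And>K. K \<in> D \<Longrightarrow> interior K \<noteq> {} \<and> (\<exists>c d. K = cbox c d)"
          and a4: "pairwise (\<lambda>A B. interior A \<inter> interior B = {}) D"
          and a5: "\<And>K. K \<in> D \<Longrightarrow> \<exists>x \<in> ?S \<inter> K. K \<subseteq> g x" and a7: "?S \<subseteq> \<Union>D"
        show ?thesis
          using a3 a5 by (intro exI[of _ D] conjI[OF a1] conjI[OF _ conjI[OF a4 conjI[OF _ a7]]] ballI) simp_all
      qed
      then obtain D where D: "countable D"
        and Dint: "\<And>K. K \<in> D \<Longrightarrow> interior K \<noteq> {} \<and> (\<exists>c d. K = cbox c d)"
        and Dis: "pairwise (\<lambda>A B. interior A \<inter> interior B = {}) D"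
        and Dg: "\<And>K. K \<in> D \<Longrightarrow> \<exists>x \<in> ?S \<inter> K. K \<subseteq> g x" and cov: "?S \<subseteq> \<Union>D"
        by (elim exE conjE) (rule that; simp)
      have DU: "K \<subseteq> U" if "K \<in> D" for K
      proof -
        obtain x where x: "x \<in> ?S \<inter> K" "K \<subseteq> g x" using Dg[OF \<open>K \<in> D\<close>] by blast
        then have "g x = U" using U(2) by (auto simp: g_def)
        with x(2) show ?thesis by simp
      qed
      have cd: "Inf K \<le> Sup K" "K = {Inf K..Sup K}" "interior K = {Inf K<..<Sup K}" if "K \<in> D" for K
      proof -
        obtain c d where K: "K = {c..d}" using Dint[OF \<open>K \<in> D\<close>] by auto
        have "c \<le> d" using Dint[OF \<open>K \<in> D\<close>] K by (cases "c \<le> d") auto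
        then have "Inf K = c" "Sup K = d" unfolding K by simp_all
        with K \<open>c \<le> d\<close> show "Inf K \<le> Sup K" "K = {Inf K..Sup K}" "interior K = {Inf K<..<Sup K}"
          by (simp_all add: interior_atLeastAtMost_real)
      qed
      have cs: "K \<in> sets ?M" if "K \<in> D" for K
        by (subst cd(2)[OF that]) simp
      \<comment> \<open>Absolute continuity speaks of finite families only; the countable covering
        is reached below through increasing finite subfamilies.\<close>
      have fin: "emeasure ?M (\<Union>I) \<le> ennreal e" if I: "finite I" "I \<subseteq> D" for I
      proof -
        have "emeasure ?M (\<Union>I) \<le> (\<Sum>K\<in>I. emeasure ?M K)"
          using emeasure_subadditive_finite[OF I(1), of "\<lambda>K. K" ?M] cs I(2) by (simp add: image_subset_iff subset_iff)
        also have "\<dots> = (\<Sum>K\<in>I. ennreal (P (Sup K) - P (Inf K)))"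
        proof (rule sum.cong)
          fix K assume "K \<in> I"
          then have "K \<in> D" using I(2) by blast
          then show "emeasure ?M K = ennreal (P (Sup K) - P (Inf K))"
            using Icc[OF cd(1)] cd(2) by simp
        qed simp
        also have "\<dots> = ennreal (\<Sum>K\<in>I. P (Sup K) - P (Inf K))"
        proof (rule sum_ennreal)
          fix K assume "K \<in> I"
          then have "K \<in> D" using I(2) by blast
          then show "0 \<le> P (Sup K) - P (Inf K)" using mono[OF cd(1)] by simp
        qed
        finally have A: "emeasure ?M (\<Union>I) \<le> ennreal (\<Sum>K\<in>I. P (Sup K) - P (Inf K))" .
        have "(\<Sum>K\<in>I. P (Sup K) - P (Inf K)) \<le> (\<Sum>K\<in>I. norm (P (Sup K) - P (Inf K)))"
          by (intro sum_mono) simp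
        also have "\<dots> < e"
        proof (rule \<delta>[rule_format])
          show "finite I" by fact
          show IS: "Inf K \<le> Sup K" if "K \<in> I" for K
            using cd(1)[of K] I(2) that by blast
          have intK: "interior K = {Inf K<..<Sup K}" if "K \<in> I" for K
            using cd(3)[of K] I(2) that by blast
          show dj: "disjoint_family_on (\<lambda>K. {Inf K<..<Sup K}) I"
            unfolding disjoint_family_on_def
          proof (intro ballI impI)
            fix A B assume AB: "A \<in> I" "B \<in> I" "A \<noteq> B"
            then have "interior A \<inter> interior B = {}"
              using Dis I(2) unfolding pairwise_def by blast
            then show "{Inf A<..<Sup A} \<inter> {Inf B<..<Sup B} = {}" using intK AB by simp
          qed
          have "ennreal (\<Sum>K\<in>I. Sup K - Inf K) = (\<Sum>K\<in>I. emeasure lborel {Inf K<..<Sup K})"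
            using IS by (subst sum_ennreal[symmetric]) (auto intro!: sum.cong)
          also have "\<dots> = emeasure lborel (\<Union>K\<in>I. {Inf K<..<Sup K})"
            using dj I(1) by (intro sum_emeasure) auto
          also have "\<dots> \<le> emeasure lborel U"
          proof (rule emeasure_mono)
            show "(\<Union>K\<in>I. {Inf K<..<Sup K}) \<subseteq> U"
              using intK DU I(2) interior_subset by blast
          qed (use U(1) in auto)
          also have "\<dots> < \<delta>" by fact
          finally show "(\<Sum>K\<in>I. Sup K - Inf K) < \<delta>"
            using \<open>\<delta> > 0\<close> by (simp add: ennreal_less_iff sum_nonneg IS)
        qed
        finally have "(\<Sum>K\<in>I. P (Sup K) - P (Inf K)) \<le> e" by (rule less_imp_le)
        then show ?thesis using order_trans[OF A ennreal_leI] by blast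
      qed
      have "D \<noteq> {}" using cov False by auto
      define I where "I n = from_nat_into D ` {..<n::nat}" for n
      have IU: "D = (\<Union>n. I n)"
        unfolding I_def by (rule finite_family_from_nat_into[OF D \<open>D \<noteq> {}\<close>])
      have ID: "I n \<subseteq> D" "finite (I n)" for n
        using IU unfolding I_def by auto
      have Imono: "incseq (\<lambda>n. \<Union>(I n))"
        unfolding incseq_def I_def by (auto intro!: Union_mono image_mono)
      have Isets: "\<Union>(I n) \<in> sets ?M" for n
        using ID cs by (intro sets.finite_Union subsetI) blast+
      have "emeasure ?M ?S \<le> emeasure ?M (\<Union>n. \<Union>(I n))"
      proof (rule emeasure_mono)
        show "?S \<subseteq> (\<Union>n. \<Union>(I n))" using cov IU by blast
      qed (use Isets in auto)
      also have "\<dots> = (SUP n. emeasure ?M (\<Union>(I n)))"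
        using Isets Imono by (intro SUP_emeasure_incseq[symmetric]) auto
      also have "\<dots> \<le> ennreal e"
        using fin ID by (intro SUP_least) auto
      finally show ?thesis .
    qed
    note small = this
    have "emeasure ?M ?S \<le> 0"
      by (rule ennreal_le_epsilon, simp only: add_0, rule small)
    then show ?thesis by simp
  qed
  show ?thesis
    unfolding absolutely_continuous_def
  proof
    fix N :: "real set" assume N: "N \<in> null_sets lborel"
    have "(\<Union>n::nat. N \<inter> {- real (Suc n)..real (Suc n)}) \<in> null_sets ?M"
    proof (intro null_sets_UN null_setsI)
      fix n
      show "emeasure ?M (N \<inter> {- real (Suc n)..real (Suc n)}) = 0" by (rule main[OF N]) simp
      show "N \<inter> {- real (Suc n)..real (Suc n)} \<in> sets ?M" using N by auto
    qed
    moreover have "(\<Union>n::nat. N \<inter> {- real (Suc n)..real (Suc n)}) = N"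
    proof -
      have "x \<in> (\<Union>n::nat. N \<inter> {- real (Suc n)..real (Suc n)})" if "x \<in> N" for x
      proof -
        obtain n :: nat where "\<bar>x\<bar> < real n" using reals_Archimedean2 by blast
        then show ?thesis using that by (auto intro!: exI[of _ n])
      qed
      then show ?thesis by blast
    qed
    ultimately show "N \<in> null_sets ?M" by simp
  qed
qed

text \<open>The Radon-Nikodym derivative of the Stieltjes measure with respect to Lebesgue measure
  serves as density.\<close>

lemma increasing_ac_density:
  fixes P :: "real \<Rightarrow> real"
  assumes ac: "uniformly_ac P" and mono: "\<And>x y. x \<le> y \<Longrightarrow> P x \<le> P y"
  shows "\<exists>g :: real \<Rightarrow> real. (\<forall>t. 0 \<le> g t) \<and> (\<forall>x y. x \<le> y \<longrightarrow> (g has_integral (P y - P x)) {x..y})"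
proof -
  let ?M = "interval_measure P"
  have cont: "continuous_on UNIV P" using uniformly_ac_continuous[OF ac] .
  obtain f where f: "f \<in> borel_measurable lborel" "density lborel f = ?M"
    using sigma_finite_measure.Radon_Nikodym[OF lborel.sigma_finite_measure_axioms interval_measure_absolutely_continuous[OF ac mono]] by auto
  show ?thesis
  proof (intro exI[of _ "\<lambda>t. enn2real (f t)"] conjI allI impI)
    fix x y :: real assume "x \<le> y"
    have e: "(\<integral>\<^sup>+t. f t * indicator {x..y} t \<partial>lborel) = ennreal (P y - P x)"
      using emeasure_density[OF f(1), of "{x..y}"] emeasure_interval_measure_Icc[OF \<open>x \<le> y\<close> mono cont]
      by (simp add: f(2))
    \<comment> \<open>The increment of P is finite, so the density is finite almost everywhere on
      the interval and \<open>enn2real\<close> changes it on a null set only.\<close>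
    have "AE t in lborel. f t * indicator {x..y} t \<noteq> \<infinity>"
      using f(1) e by (intro nn_integral_PInf_AE) auto
    then have "(\<integral>\<^sup>+t. ennreal (indicator {x..y} t * enn2real (f t)) \<partial>lborel)
        = (\<integral>\<^sup>+t. f t * indicator {x..y} t \<partial>lborel)"
      by (intro nn_integral_cong_AE) (auto elim!: eventually_mono simp: indicator_def top.not_eq_extremum)
    with e have "(\<integral>\<^sup>+t. ennreal (indicator {x..y} t * enn2real (f t)) \<partial>lborel) = ennreal (P y - P x)"
      by simp
    moreover have "(\<lambda>t. indicator {x..y} t * enn2real (f t)) \<in> borel_measurable borel"
      using f(1) by simp
    ultimately have "((\<lambda>t. indicator {x..y} t * enn2real (f t)) has_integral (P y - P x)) UNIV"
      using mono[OF \<open>x \<le> y\<close>] by (intro nn_integral_has_integral) auto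
    moreover have "(\<lambda>t. indicator {x..y} t * enn2real (f t)) = (\<lambda>t. if t \<in> {x..y} then enn2real (f t) else 0)"
      by (auto simp: indicator_def)
    ultimately show "((\<lambda>t. enn2real (f t)) has_integral (P y - P x)) {x..y}"
      by (simp only: has_integral_restrict_UNIV)
  qed auto
qed

text \<open>F is the positive variation minus the difference of the positive variation and F, both
  increasing and absolutely continuous. Their densities are nonnegative, which makes the gauge
  integrals absolute.\<close>

lemma (in ac_bounded) ac_density_real:
  "\<exists>g. \<forall>x y. x \<le> y \<longrightarrow> g absolutely_integrable_on {x..y} \<and> (g has_integral (F y - F x)) {x..y}"
proof -
  let ?P = "pos_variation F"
  obtain g1 where "(\<forall>t. 0 \<le> g1 t) \<and> (\<forall>x y. x \<le> y \<longrightarrow> (g1 has_integral (?P y - ?P x)) {x..y})"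
    using increasing_ac_density[OF pos_variation_ac pos_variation_mono] by blast
  then have g1: "\<And>t. 0 \<le> g1 t" "\<And>x y. x \<le> y \<Longrightarrow> (g1 has_integral (?P y - ?P x)) {x..y}"
    by auto
  have m2: "?P x - F x \<le> ?P y - F y" if "x \<le> y" for x y
    using pos_variation_ge[OF that] by linarith
  obtain g2 where "(\<forall>t. 0 \<le> g2 t) \<and>
      (\<forall>x y. x \<le> y \<longrightarrow> (g2 has_integral ((?P y - F y) - (?P x - F x))) {x..y})"
    using increasing_ac_density[OF uniformly_ac_diff[OF pos_variation_ac ac] m2] by blast
  then have g2: "\<And>t. 0 \<le> g2 t"
    "\<And>x y. x \<le> y \<Longrightarrow> (g2 has_integral ((?P y - F y) - (?P x - F x))) {x..y}"
    by auto
  show ?thesis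
  proof (intro exI[of _ "\<lambda>t. g1 t - g2 t"] conjI allI impI)
    fix x y :: real assume "x \<le> y"
    show "((\<lambda>t. g1 t - g2 t) has_integral (F y - F x)) {x..y}"
      using has_integral_diff[OF g1(2)[OF \<open>x \<le> y\<close>] g2(2)[OF \<open>x \<le> y\<close>]] by (simp add: algebra_simps)
    show "(\<lambda>t. g1 t - g2 t) absolutely_integrable_on {x..y}"
      using g1(1) g2(1) has_integral_integrable[OF g1(2)[OF \<open>x \<le> y\<close>]] has_integral_integrable[OF g2(2)[OF \<open>x \<le> y\<close>]]
      by (intro set_integral_diff nonnegative_absolutely_integrable_1)
  qed
qed

lemma uniformly_ac_contraction:
  fixes F :: "real \<Rightarrow> complex" and h :: "complex \<Rightarrow> real"
  assumes "uniformly_ac F" and h: "\<And>z w. norm (h z - h w) \<le> norm (z - w)"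
  shows "uniformly_ac (\<lambda>t. h (F t))"
  unfolding uniformly_ac_def
proof (intro allI impI)
  fix \<epsilon> :: real assume "\<epsilon> > 0"
  obtain \<delta> where "\<delta> > 0" and \<delta>: "\<forall>(I::nat set) u v. finite I \<longrightarrow> (\<forall>i\<in>I. u i \<le> v i) \<longrightarrow>
        disjoint_family_on (\<lambda>i. {u i<..<v i}) I \<longrightarrow> (\<Sum>i\<in>I. v i - u i) < \<delta> \<longrightarrow>
        (\<Sum>i\<in>I. norm (F (v i) - F (u i))) < \<epsilon>"
    by (rule uniformly_acE[OF assms(1) \<open>\<epsilon> > 0\<close>])
  show "\<exists>\<delta>>0. \<forall>(n::nat) u v. (\<forall>i<n. u i \<le> v i) \<longrightarrow>
        disjoint_family_on (\<lambda>i. {u i<..<v i}) {..<n} \<longrightarrow> (\<Sum>i<n. v i - u i) < \<delta> \<longrightarrow>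
        (\<Sum>i<n. norm (h (F (v i)) - h (F (u i)))) < \<epsilon>"
  proof (intro exI[of _ \<delta>] conjI allI impI \<open>\<delta> > 0\<close>)
    fix n :: nat and u v :: "nat \<Rightarrow> real"
    assume "\<forall>i<n. u i \<le> v i" "disjoint_family_on (\<lambda>i. {u i<..<v i}) {..<n}" "(\<Sum>i<n. v i - u i) < \<delta>"
    then have "(\<Sum>i<n. norm (F (v i) - F (u i))) < \<epsilon>" by (intro \<delta>[rule_format]) auto
    moreover have "(\<Sum>i<n. norm (h (F (v i)) - h (F (u i)))) \<le> (\<Sum>i<n. norm (F (v i) - F (u i)))"
      by (intro sum_mono h)
    ultimately show "(\<Sum>i<n. norm (h (F (v i)) - h (F (u i)))) < \<epsilon>" by linarith
  qed
qed

text \<open>The clamped function is constant outside [a,b]. Taking real and imaginary parts is a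
  contraction, so the real case applies to each.\<close>

lemma abs_cont_on_density:
  assumes f: "abs_cont_on a b f" and "a < b"
  shows "\<exists>g. g absolutely_integrable_on {a..b} \<and>
    (\<forall>x y. a \<le> x \<longrightarrow> x \<le> y \<longrightarrow> y \<le> b \<longrightarrow> (g has_integral (f y - f x)) {x..y})"
proof -
  define F where "F t = f (max a (min b t))" for t
  have F: "uniformly_ac F"
    unfolding F_def by (rule abs_cont_on_imp_uniformly_ac[OF f]) (use \<open>a < b\<close> in simp)
  have RI: "uniformly_ac (\<lambda>t. Re (F t))" "uniformly_ac (\<lambda>t. Im (F t))"
    using abs_Re_le_cmod[of "_ - _"] abs_Im_le_cmod[of "_ - _"]
    by (auto intro!: uniformly_ac_contraction[OF F])
  have FF: "F t = F a" if "t \<le> a" for t using that \<open>a < b\<close> by (simp add: F_def)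
  have FG: "F t = F b" if "b \<le> t" for t using that \<open>a < b\<close> by (simp add: F_def)
  have A: "ac_bounded (\<lambda>t. Re (F t)) a b"
    by (rule ac_bounded.intro[OF RI(1) \<open>a < b\<close>]; (drule FF | drule FG); simp)
  have B: "ac_bounded (\<lambda>t. Im (F t)) a b"
    by (rule ac_bounded.intro[OF RI(2) \<open>a < b\<close>]; (drule FF | drule FG); simp)
  obtain g1 where g1: "\<And>x y. x \<le> y \<Longrightarrow> g1 absolutely_integrable_on {x..y} \<and> (g1 has_integral (Re (F y) - Re (F x))) {x..y}"
    using ac_bounded.ac_density_real[OF A] by auto
  obtain g2 where g2: "\<And>x y. x \<le> y \<Longrightarrow> g2 absolutely_integrable_on {x..y} \<and> (g2 has_integral (Im (F y) - Im (F x))) {x..y}"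
    using ac_bounded.ac_density_real[OF B] by auto
  define g where "g t = complex_of_real (g1 t) + \<i> * complex_of_real (g2 t)" for t
  have blr: "bounded_linear (complex_of_real :: real \<Rightarrow> complex)" by (rule bounded_linear_of_real)
  have bli: "bounded_linear (\<lambda>t::real. \<i> * complex_of_real t)"
    by (intro bounded_linear_const_mult bounded_linear_of_real)
  show ?thesis
  proof (intro exI[of _ g] conjI allI impI)
    show "g absolutely_integrable_on {a..b}"
      unfolding g_def using g1[of a b] g2[of a b] \<open>a < b\<close>
        absolutely_integrable_linear[OF _ blr] absolutely_integrable_linear[OF _ bli]
      by (intro set_integral_add) (auto simp: o_def)
    fix x y assume xy: "a \<le> x" "x \<le> y" "y \<le> b"
    have 1: "((\<lambda>t. complex_of_real (g1 t)) has_integral complex_of_real (Re (F y) - Re (F x))) {x..y}"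
      using has_integral_linear[OF conjunct2[OF g1[OF xy(2)]] blr] unfolding o_def .
    have 2: "((\<lambda>t. \<i> * complex_of_real (g2 t)) has_integral \<i> * complex_of_real (Im (F y) - Im (F x))) {x..y}"
      using has_integral_linear[OF conjunct2[OF g2[OF xy(2)]] bli] unfolding o_def .
    have "complex_of_real (Re (F y) - Re (F x)) + \<i> * complex_of_real (Im (F y) - Im (F x)) = F y - F x"
      by (simp add: complex_eq_iff)
    moreover have "F x = f x" "F y = f y" using xy by (auto simp: F_def)
    ultimately show "(g has_integral (f y - f x)) {x..y}"
      using has_integral_add[OF 1 2] unfolding g_def by simp
  qed
qed

section \<open>Lebesgue differentiation and indefinite integrals\<close>

lemma right_derivative_indefinite_integral:
  fixes G :: "real \<Rightarrow> 'b::euclidean_space"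
  assumes "\<And>a b. G integrable_on {a..b}"
  shows "\<exists>N. negligible N \<and> (\<forall>x e. x \<notin> N \<longrightarrow> 0 < e \<longrightarrow> (\<exists>d>0. \<forall>h. 0 < h \<and> h < d \<longrightarrow>
        norm (integral {x..x + h} G - h *\<^sub>R G x) \<le> e * h))"
proof -
  show ?thesis
  proof (rule integrable_ccontinuous_explicit[where f=G])
    show "G integrable_on cbox a b" for a b using assms by simp
    fix N assume N: "negligible N" and NP: "\<And>x e. \<lbrakk>x \<notin> N; 0 < e\<rbrakk> \<Longrightarrow>
      \<exists>d>0. \<forall>h. 0 < h \<and> h < d \<longrightarrow>
        norm (integral (cbox x (x + h *\<^sub>R One)) G /\<^sub>R h ^ DIM(real) - G x) < e"
    show ?thesis
    proof (intro exI[of _ N] conjI allI impI N)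
    fix x e :: real assume "x \<notin> N" "0 < e"
    then obtain d where "d > 0" and d: "\<And>h. \<lbrakk>0 < h; h < d\<rbrakk> \<Longrightarrow>
        norm (integral {x..x + h} G /\<^sub>R h - G x) < e"
      using NP[of x e] by auto
    have "norm (integral {x..x + h} G - h *\<^sub>R G x) \<le> e * h" if "0 < h" "h < d" for h
    proof -
      have "norm (integral {x..x + h} G - h *\<^sub>R G x) = norm (h *\<^sub>R (integral {x..x + h} G /\<^sub>R h - G x))"
        using \<open>0 < h\<close> by (simp add: scaleR_diff_right)
      also have "\<dots> = h * norm (integral {x..x + h} G /\<^sub>R h - G x)"
        using \<open>0 < h\<close> by simp
      also have "\<dots> \<le> e * h" using d[OF that] \<open>0 < h\<close> by (simp add: mult.commute)
      finally show ?thesis .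
    qed
    then show "\<exists>d>0. \<forall>h. 0 < h \<and> h < d \<longrightarrow> norm (integral {x..x + h} G - h *\<^sub>R G x) \<le> e * h"
      using \<open>d > 0\<close> by blast
  qed
  qed
qed

text \<open>The differentiation theorem above is one-sided. Left difference quotients are obtained
  from the reflected function, and its exceptional set is reflected back.\<close>

lemma indefinite_integral_has_vector_derivative_ae:
  fixes g F :: "real \<Rightarrow> 'b::euclidean_space"
  assumes F: "\<And>x y. \<lbrakk>a \<le> x; x \<le> y; y \<le> b\<rbrakk> \<Longrightarrow> (g has_integral (F y - F x)) {x..y}" and "a < b"
  shows "\<exists>N. negligible N \<and> (\<forall>x\<in>{a<..<b} - N. (F has_vector_derivative g x) (at x))"
proof -
  \<comment> \<open>Extension by zero makes the integrals over all intervals available, as the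
    one-sided theorem requires.\<close>
  define G where "G t = (if t \<in> {a..b} then g t else 0)" for t
  have "g integrable_on {a..b}" using has_integral_integrable[OF F[of a b]] \<open>a < b\<close> by simp
  then have "G integrable_on UNIV"
    unfolding G_def by (simp only: integrable_restrict_UNIV)
  then have Gi: "G integrable_on {c..d}" for c d
    using integrable_on_subcbox[where f=G and S=UNIV] by simp
  then have Gi': "(\<lambda>t. G (-t)) integrable_on {c..d}" for c d
    using Henstock_Kurzweil_Integration.integrable_reflect_real[where f=G and a="-d" and b="-c"] by simp
  obtain N1 where N1: "negligible N1 \<and> (\<forall>x e. x \<notin> N1 \<longrightarrow> 0 < e \<longrightarrow> (\<exists>d>0. \<forall>h. 0 < h \<and> h < d \<longrightarrow>
        norm (integral {x..x + h} G - h *\<^sub>R G x) \<le> e * h))"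
    using right_derivative_indefinite_integral[OF Gi] by blast
  obtain N2 where N2: "negligible N2 \<and> (\<forall>x e. x \<notin> N2 \<longrightarrow> 0 < e \<longrightarrow> (\<exists>d>0. \<forall>h. 0 < h \<and> h < d \<longrightarrow>
        norm (integral {x..x + h} (\<lambda>t. G (-t)) - h *\<^sub>R G (-x)) \<le> e * h))"
    using right_derivative_indefinite_integral[OF Gi'] by blast
  have IG: "integral {x..y} G = F y - F x" if "a \<le> x" "x \<le> y" "y \<le> b" for x y
  proof -
    have "integral {x..y} G = integral {x..y} g"
      using that by (intro integral_cong) (auto simp: G_def)
    then show ?thesis using F[OF that] by (simp add: integral_unique)
  qed
  show ?thesis
  proof (intro exI[of _ "N1 \<union> uminus ` N2"] conjI ballI)
    have "negligible (uminus ` N2)"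
      by (rule negligible_differentiable_image_negligible[OF _ conjunct1[OF N2]])
         (auto simp: differentiable_on_def)
    then show "negligible (N1 \<union> uminus ` N2)" using N1 by simp
    fix x assume x: "x \<in> {a<..<b} - (N1 \<union> uminus ` N2)"
    then have x2: "- x \<notin> N2" "x \<notin> N1" by (auto simp: image_iff)
    have Gx: "G x = g x" using x by (auto simp: G_def)
    show "(F has_vector_derivative g x) (at x)"
      unfolding has_vector_derivative_def has_derivative_at_alt
    proof (intro conjI allI impI bounded_linear_scaleR_left)
      fix e :: real assume "e > 0"
      obtain d1 where d1: "d1 > 0" "\<And>h. \<lbrakk>0 < h; h < d1\<rbrakk> \<Longrightarrow>
          norm (integral {x..x + h} G - h *\<^sub>R G x) \<le> e * h"
        using N1 x2 \<open>e > 0\<close> by blast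
      obtain d2 where d2: "d2 > 0" "\<And>h. \<lbrakk>0 < h; h < d2\<rbrakk> \<Longrightarrow>
          norm (integral {-x..-x + h} (\<lambda>t. G (-t)) - h *\<^sub>R G x) \<le> e * h"
        using conjunct2[OF N2, rule_format, OF x2(1) \<open>e > 0\<close>] unfolding minus_minus by blast
      define d where "d = min (min d1 d2) (min (x - a) (b - x))"
      have "d > 0" using d1 d2 x by (auto simp: d_def)
      moreover have "norm (F y - F x - (y - x) *\<^sub>R g x) \<le> e * norm (y - x)" if "norm (y - x) < d" for y
      proof (cases y x rule: linorder_cases)
        case less
        have y: "a \<le> y" "x \<le> b" "x - y < d2" using that less x by (auto simp: d_def)
        have "integral {-x..-x + (x - y)} (\<lambda>t. G (-t)) = integral {y..x} G"
          using Henstock_Kurzweil_Integration.integral_reflect_real[where f=G and a=y and b=x] by simp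
        also have "\<dots> = F x - F y" using IG[of y x] y less by simp
        finally have "norm (F x - F y - (x - y) *\<^sub>R g x) \<le> e * (x - y)"
          using d2(2)[of "x - y"] y less Gx by simp
        moreover have "F y - F x - (y - x) *\<^sub>R g x = - (F x - F y - (x - y) *\<^sub>R g x)"
          by (simp add: algebra_simps)
        ultimately show ?thesis using less by (simp only: norm_minus_cancel) simp
      next
        case equal
        then show ?thesis by simp
      next
        case greater
        have y: "a \<le> x" "y \<le> b" "y - x < d1" using that greater x by (auto simp: d_def)
        have "integral {x..x + (y - x)} G = F y - F x" using IG[of x y] y greater by simp
        then show ?thesis
          using d1(2)[of "y - x"] y greater Gx by simp
      qed
      ultimately show "\<exists>d>0. \<forall>y. norm (y - x) < d \<longrightarrow>
          norm (F y - F x - (y - x) *\<^sub>R g x) \<le> e * norm (y - x)" by blast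
    qed
  qed
qed

text \<open>Cut |g| at height k: the excess has a small integral over all of [a,b] by dominated
  convergence, and the bounded rest contributes at most k times the total length.\<close>

lemma indefinite_integral_abs_cont_on:
  fixes g F :: "real \<Rightarrow> complex"
  assumes g: "g absolutely_integrable_on {a..b}"
    and F: "\<And>x y. \<lbrakk>a \<le> x; x \<le> y; y \<le> b\<rbrakk> \<Longrightarrow> (g has_integral (F y - F x)) {x..y}"
  shows "abs_cont_on a b F"
  unfolding abs_cont_on_def
proof (intro allI impI)
  fix \<epsilon> :: real assume "\<epsilon> > 0"
  define hk where "hk k x = max (norm (g x) - real k) 0" for k :: nat and x
  have ng: "(\<lambda>x. norm (g x)) absolutely_integrable_on {a..b}"
    using g by (rule absolutely_integrable_norm[unfolded o_def])
  have cst: "(\<lambda>x. c::real) absolutely_integrable_on {a..b}" for c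
    by (intro absolutely_integrable_continuous_real continuous_on_const)
  have hka: "hk k absolutely_integrable_on {a..b}" for k
    unfolding hk_def by (intro absolutely_integrable_max_1 set_integral_diff ng cst)
  then have hki: "hk k integrable_on {a..b}" for k
    using absolutely_integrable_on_def by blast
  have "(\<lambda>k. integral {a..b} (hk k)) \<longlonglongrightarrow> integral {a..b} (\<lambda>x. 0)"
  proof (rule dominated_convergence(2)[where h="\<lambda>x. norm (g x)"])
    show "(\<lambda>x. norm (g x)) integrable_on {a..b}" using ng absolutely_integrable_on_def by blast
    show "norm (hk k x) \<le> norm (g x)" if "x \<in> {a..b}" for k x by (auto simp: hk_def)
    show "(\<lambda>k. hk k x) \<longlonglongrightarrow> 0" if "x \<in> {a..b}" for x
    proof -
      obtain n :: nat where "norm (g x) < real n" using reals_Archimedean2 by blast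
      then have "eventually (\<lambda>k. hk k x = 0) sequentially"
        by (intro eventually_sequentiallyI[of n]) (auto simp: hk_def)
      then show ?thesis by (simp add: tendsto_eventually)
    qed
  qed (rule hki)
  then have "eventually (\<lambda>k. integral {a..b} (hk k) < \<epsilon> / 2) sequentially"
    using \<open>\<epsilon> > 0\<close> by (intro order_tendstoD(2)) auto
  then obtain k where k: "integral {a..b} (hk k) < \<epsilon> / 2"
    using eventually_happens'[OF sequentially_bot] by blast
  define \<delta> where "\<delta> = \<epsilon> / (2 * (real k + 1))"
  have "\<delta> > 0" "real k * \<delta> \<le> \<epsilon> / 2" using \<open>\<epsilon> > 0\<close> by (auto simp: \<delta>_def field_simps)
  show "\<exists>\<delta>>0. \<forall>(n::nat) u v. (\<forall>i<n. a \<le> u i \<and> u i \<le> v i \<and> v i \<le> b) \<longrightarrow>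
        disjoint_family_on (\<lambda>i. {u i<..<v i}) {..<n} \<longrightarrow> (\<Sum>i<n. v i - u i) < \<delta> \<longrightarrow>
        (\<Sum>i<n. norm (F (v i) - F (u i))) < \<epsilon>"
  proof (intro exI[of _ \<delta>] conjI allI impI \<open>\<delta> > 0\<close>)
    fix n :: nat and u v :: "nat \<Rightarrow> real"
    assume uv: "\<forall>i<n. a \<le> u i \<and> u i \<le> v i \<and> v i \<le> b"
      and dis: "disjoint_family_on (\<lambda>i. {u i<..<v i}) {..<n}" and sm: "(\<Sum>i<n. v i - u i) < \<delta>"
    have hks: "hk k integrable_on {u i..v i}" if "i < n" for i
      by (rule integrable_subinterval_real[OF hki]) (use uv that in auto)
    have "norm (F (v i) - F (u i)) \<le> integral {u i..v i} (hk k) + real k * (v i - u i)" if "i < n" for i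
    proof -
      have i: "a \<le> u i" "u i \<le> v i" "v i \<le> b" using uv that by auto
      have 1: "((\<lambda>x. hk k x + real k) has_integral (integral {u i..v i} (hk k) + real k * (v i - u i))) {u i..v i}"
        using has_integral_add[OF integrable_integral[OF hks[OF that]] has_integral_const_real[of "real k" "u i" "v i"]] i
        by (simp add: mult.commute)
      have "norm (integral {u i..v i} g) \<le> integral {u i..v i} (\<lambda>x. hk k x + real k)"
        using F[OF i] 1 by (intro integral_norm_bound_integral) (auto simp: hk_def)
      then show ?thesis using integral_unique[OF F[OF i]] integral_unique[OF 1] by simp
    qed
    then have "(\<Sum>i<n. norm (F (v i) - F (u i))) \<le> (\<Sum>i<n. integral {u i..v i} (hk k) + real k * (v i - u i))"
      by (intro sum_mono) auto
    also have "\<dots> = (\<Sum>i<n. integral {u i..v i} (hk k)) + real k * (\<Sum>i<n. v i - u i)"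
      by (simp add: sum.distrib sum_distrib_left)
    also have "(\<Sum>i<n. integral {u i..v i} (hk k)) \<le> integral {a..b} (hk k)"
    proof -
      have H: "(hk k has_integral (\<Sum>i<n. integral {u i..v i} (hk k))) (\<Union>i<n. {u i<..<v i})"
      proof (rule has_integral_UN)
        show "(hk k has_integral integral {u i..v i} (hk k)) {u i<..<v i}" if "i \<in> {..<n}" for i
          using hks[of i] that by (simp add: has_integral_Icc_iff_Ioo integrable_integral flip: has_integral_Icc_iff_Ioo)
        show "pairwise (\<lambda>i i'. negligible ({u i<..<v i} \<inter> {u i'<..<v i'})) {..<n}"
          using dis by (auto simp: pairwise_def disjoint_family_on_def)
      qed simp
      then have "(\<Sum>i<n. integral {u i..v i} (hk k)) = integral (\<Union>i<n. {u i<..<v i}) (hk k)"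
        by (simp add: integral_unique)
      also have "\<dots> \<le> integral {a..b} (hk k)"
      proof (intro integral_subset_le hki)
        show "(\<Union>i<n. {u i<..<v i}) \<subseteq> {a..b}"
        proof (intro UN_least subsetI)
          fix i x assume "i \<in> {..<n}" "x \<in> {u i<..<v i}"
          then show "x \<in> {a..b}" using uv by (auto dest!: spec[of _ i])
        qed
        show "hk k integrable_on (\<Union>i<n. {u i<..<v i})" using H by (rule has_integral_integrable)
      qed (simp add: hk_def)
      finally show ?thesis .
    qed
    also have "real k * (\<Sum>i<n. v i - u i) \<le> real k * \<delta>"
      using sm by (intro mult_left_mono) auto
    finally show "(\<Sum>i<n. norm (F (v i) - F (u i))) < \<epsilon>"
      using k \<open>real k * \<delta> \<le> \<epsilon> / 2\<close> by linarith
  qed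
qed

section \<open>Local absolute continuity and the fundamental theorem of calculus on (-1,1)\<close>

abbreviation I1 :: "real set" where "I1 \<equiv> {-1<..<1}"

lemma I1_sets [simp]: "I1 \<in> sets lebesgue" "I1 \<inter> space lebesgue \<in> sets lebesgue"
  by auto

lemma AE_leb_I_iff: "(AE x in leb_I. Q x) \<longleftrightarrow> (\<exists>N. negligible N \<and> (\<forall>x\<in>I1 - N. Q x))"
proof -
  have "(AE x in leb_I. Q x) \<longleftrightarrow> (AE x in lebesgue. x \<in> I1 \<longrightarrow> Q x)"
    by (rule AE_restrict_space_iff) simp
  also have "\<dots> \<longleftrightarrow> (\<exists>N. negligible N \<and> {x. \<not> (x \<in> I1 \<longrightarrow> Q x)} \<subseteq> N)"
    by (rule eventually_ae_filter_negligible)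
  also have "\<dots> \<longleftrightarrow> (\<exists>N. negligible N \<and> (\<forall>x\<in>I1 - N. Q x))"
    by (intro ex_cong1 conj_cong refl) auto
  finally show ?thesis .
qed

text \<open>The symmetric intervals at distance 1/(n+2) from the ends exhaust (-1,1); the 2 keeps
  all of them nondegenerate, including n = 0.\<close>

lemma ex_compact_subinterval:
  assumes "-1 < (a::real)" "b < 1"
  shows "\<exists>n::nat. -1 + 1 / (real n + 2) < a \<and> b < 1 - 1 / (real n + 2)"
proof -
  define m where "m = min (a + 1) (1 - b)"
  have p: "m > 0" using assms by (auto simp: m_def)
  obtain n :: nat where n: "1 / m < real n" using reals_Archimedean2 by blast
  then have "1 / m < real n + 2" by linarith
  then have "1 / (real n + 2) < m" using p by (simp add: field_simps)
  then show ?thesis by (intro exI[of _ n]) (auto simp: m_def)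
qed

lemma inverse_add_2_bounds: "0 < 1 / (real n + 2)" "1 / (real n + 2) \<le> 1 / 2"
  by (auto simp: field_simps)

text \<open>Countably many compact subintervals exhaust (-1,1), and their null sets are
  united.\<close>

lemma AE_leb_I_local:
  assumes "\<And>a b. \<lbrakk>-1 < a; a < b; b < 1\<rbrakk> \<Longrightarrow> \<exists>N. negligible N \<and> (\<forall>x\<in>{a<..<b} - N. Q x)"
  shows "AE x in leb_I. Q x"
proof -
  define a b where "a n = -1 + 1 / (real n + 2)" and "b n = 1 - 1 / (real n + 2)" for n
  have "\<exists>N. negligible N \<and> (\<forall>x\<in>{a n<..<b n} - N. Q x)" for n
  proof (cases "a n < b n")
    case True
    then show ?thesis using assms[of "a n" "b n"] inverse_add_2_bounds[of n] by (auto simp: a_def b_def)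
  qed (auto intro!: exI[of _ "{}"])
  then have "\<forall>n. \<exists>N. negligible N \<and> (\<forall>x\<in>{a n<..<b n} - N. Q x)" by blast
  from choice[OF this] obtain N where "\<forall>n. negligible (N n) \<and> (\<forall>x\<in>{a n<..<b n} - N n. Q x)" ..
  then have N: "\<And>n. negligible (N n)" "\<And>n. \<forall>x\<in>{a n<..<b n} - N n. Q x" by auto
  show ?thesis
    unfolding AE_leb_I_iff
  proof (intro exI[of _ "\<Union>(range N)"] conjI ballI)
    show "negligible (\<Union>(range N))" using N(1) by (intro negligible_countable_Union) auto
    fix x assume x: "x \<in> I1 - \<Union>(range N)"
    then obtain n where "a n < x" "x < b n"
      using ex_compact_subinterval[of x x] by (auto simp: a_def b_def)
    then show "Q x" using N(2)[of n] x by auto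
  qed
qed

lemma ddx_eqI: "(f has_vector_derivative D) (at x) \<Longrightarrow> ddx f x = D"
  unfolding ddx_def by (rule vector_derivative_at)

lemma has_ddx: "(f has_vector_derivative D) (at x) \<Longrightarrow> (f has_vector_derivative ddx f x) (at x)"
  by (simp add: ddx_eqI)

lemma AC_loc_abs_cont_on: "\<lbrakk>f \<in> AC_loc; -1 < a; a \<le> b; b < 1\<rbrakk> \<Longrightarrow> abs_cont_on a b f"
  unfolding AC_loc_def by blast

lemma AC_loc_has_derivative:
  assumes "f \<in> AC_loc"
  shows "AE x in leb_I. (f has_vector_derivative ddx f x) (at x)"
proof (rule AE_leb_I_local)
  fix a b :: real assume ab: "-1 < a" "a < b" "b < 1"
  obtain g where g: "g absolutely_integrable_on {a..b}"
    "\<forall>x y. a \<le> x \<longrightarrow> x \<le> y \<longrightarrow> y \<le> b \<longrightarrow> (g has_integral (f y - f x)) {x..y}"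
    using abs_cont_on_density[OF AC_loc_abs_cont_on[OF assms ab(1) less_imp_le[OF ab(2)] ab(3)] ab(2)] by blast
  have "\<exists>N. negligible N \<and> (\<forall>x\<in>{a<..<b} - N. (f has_vector_derivative g x) (at x))"
    by (rule indefinite_integral_has_vector_derivative_ae[OF _ ab(2)]) (simp add: g(2))
  then obtain N where "negligible N" "\<forall>x\<in>{a<..<b} - N. (f has_vector_derivative g x) (at x)"
    by (elim exE conjE) (rule that; assumption)
  note N = this
  have "(f has_vector_derivative ddx f x) (at x)" if "x \<in> {a<..<b} - N" for x
    by (rule has_ddx, rule bspec[OF N(2) that])
  with N(1) show "\<exists>N. negligible N \<and> (\<forall>x\<in>{a<..<b} - N. (f has_vector_derivative ddx f x) (at x))"
    by blast
qed

text \<open>The density is taken on a strictly larger interval: it equals the two-sided derivative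
  almost everywhere on all of [a,b], and the degenerate case a = b is covered too.\<close>

lemma AC_loc_FTC:
  assumes "f \<in> AC_loc" "-1 < a" "a \<le> b" "b < 1"
  shows "ddx f absolutely_integrable_on {a..b}" "(ddx f has_integral (f b - f a)) {a..b}"
proof -
  obtain n where n: "-1 + 1 / (real n + 2) < a \<and> b < 1 - 1 / (real n + 2)"
    using ex_compact_subinterval[OF assms(2,4)] by blast
  define c d where "c = -1 + 1 / (real n + 2)" and "d = 1 - 1 / (real n + 2)"
  have cd: "-1 < c" "c < a" "b < d" "d < 1" "c < d" using assms(3) n by (auto simp: c_def d_def)
  obtain g where g: "g absolutely_integrable_on {c..d}"
    "\<forall>x y. c \<le> x \<longrightarrow> x \<le> y \<longrightarrow> y \<le> d \<longrightarrow> (g has_integral (f y - f x)) {x..y}"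
    using abs_cont_on_density[OF AC_loc_abs_cont_on[OF assms(1) cd(1) less_imp_le[OF cd(5)] cd(4)] cd(5)] by blast
  have "\<exists>N. negligible N \<and> (\<forall>x\<in>{c<..<d} - N. (f has_vector_derivative g x) (at x))"
    by (rule indefinite_integral_has_vector_derivative_ae[OF _ cd(5)]) (simp add: g(2))
  then obtain N where N: "negligible N" "\<forall>x\<in>{c<..<d} - N. (f has_vector_derivative g x) (at x)"
    by (elim exE conjE) (rule that; assumption)
  have eq: "ddx f x = g x" if "x \<in> {a..b} - N" for x
    using N(2) cd that by (intro ddx_eqI) simp
  have "g absolutely_integrable_on {a..b}"
    by (rule set_integrable_subset[OF g(1)]) (use cd in auto)
  then show "ddx f absolutely_integrable_on {a..b}"
    by (rule absolutely_integrable_spike[OF _ N(1)]) (rule eq)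
  show "(ddx f has_integral (f b - f a)) {a..b}"
    by (rule has_integral_spike[OF N(1) eq]) (use g(2) cd assms in auto)
qed

text \<open>The converse of the fundamental theorem: membership in \<open>AC_loc\<close> is verified
  through an integral representation.\<close>

lemma AC_locI:
  assumes "\<And>a b. \<lbrakk>-1 < a; a \<le> b; b < 1\<rbrakk> \<Longrightarrow> g absolutely_integrable_on {a..b}"
    and "\<And>a b. \<lbrakk>-1 < a; a \<le> b; b < 1\<rbrakk> \<Longrightarrow> (g has_integral (f b - f a)) {a..b}"
  shows "f \<in> AC_loc" "AE x in leb_I. (f has_vector_derivative g x) (at x)"
proof -
  show "f \<in> AC_loc"
    unfolding AC_loc_def
  proof (safe)
    fix a b :: real assume ab: "-1 < a" "a \<le> b" "b < 1"
    show "abs_cont_on a b f"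
    proof (rule indefinite_integral_abs_cont_on)
      show "g absolutely_integrable_on {a..b}" by (rule assms(1)[OF ab])
      fix x y assume "a \<le> x" "x \<le> y" "y \<le> b"
      then show "(g has_integral (f y - f x)) {x..y}" using ab by (intro assms(2)) auto
    qed
  qed
  show "AE x in leb_I. (f has_vector_derivative g x) (at x)"
  proof (rule AE_leb_I_local)
    fix a b :: real assume ab: "-1 < a" "a < b" "b < 1"
    show "\<exists>N. negligible N \<and> (\<forall>x\<in>{a<..<b} - N. (f has_vector_derivative g x) (at x))"
    proof (rule indefinite_integral_has_vector_derivative_ae[OF _ ab(2)])
      fix x y assume "a \<le> x" "x \<le> y" "y \<le> b"
      then show "(g has_integral (f y - f x)) {x..y}" using ab by (intro assms(2)) auto
    qed
  qed
qed

lemma AC_loc_cong: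
  assumes "f \<in> AC_loc" "\<And>x. x \<in> I1 \<Longrightarrow> g x = f x"
  shows "g \<in> AC_loc"
proof (rule AC_locI(1)[where g="ddx f"])
  fix a b :: real assume ab: "-1 < a" "a \<le> b" "b < 1"
  show "ddx f absolutely_integrable_on {a..b}" by (rule AC_loc_FTC(1)[OF assms(1) ab])
  have "g b = f b" "g a = f a" using ab by (auto intro!: assms(2))
  then show "(ddx f has_integral (g b - g a)) {a..b}"
    using AC_loc_FTC(2)[OF assms(1) ab] by simp
qed

lemma C1_AC_loc:
  assumes d: "\<And>x. x \<in> I1 \<Longrightarrow> (f has_vector_derivative f' x) (at x)" and c: "continuous_on I1 f'"
  shows "f \<in> AC_loc"
proof (rule AC_locI(1)[where g="f'"])
  fix a b :: real assume ab: "-1 < a" "a \<le> b" "b < 1"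
  have "continuous_on {a..b} f'" by (rule continuous_on_subset[OF c]) (use ab in auto)
  then show "f' absolutely_integrable_on {a..b}" by (rule absolutely_integrable_continuous_real)
  show "(f' has_integral (f b - f a)) {a..b}"
  proof (rule fundamental_theorem_of_calculus[OF ab(2)])
    fix x assume "x \<in> {a..b}"
    then show "(f has_vector_derivative f' x) (at x within {a..b})"
      using ab by (intro has_vector_derivative_at_within[OF d]) auto
  qed
qed

lemma AC_loc_continuous_on:
  assumes "f \<in> AC_loc"
  shows "continuous_on I1 f"
proof -
  have "isCont f x" if "x \<in> I1" for x
  proof -
    have x: "-1 < x" "x < 1" using that by auto
    define a b where "a = (x - 1) / 2" and "b = (x + 1) / 2"
    have ab: "-1 < a" "a < x" "x < b" "b < 1" "a \<le> b" using x by (auto simp: a_def b_def)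
    have "uniformly_ac (\<lambda>t. f (max a (min b t)))"
      using ab by (intro abs_cont_on_imp_uniformly_ac AC_loc_abs_cont_on[OF assms]) auto
    then have "continuous_on {a<..<b} (\<lambda>t. f (max a (min b t)))"
      by (rule continuous_on_subset[OF uniformly_ac_continuous]) simp
    then have "continuous_on {a<..<b} f"
      by (rule continuous_on_eq) auto
    then show ?thesis using ab continuous_on_eq_continuous_at[of "{a<..<b}" f] by auto
  qed
  then show ?thesis by (intro continuous_at_imp_continuous_on) auto
qed

lemma uniformly_ac_mult:
  fixes F G :: "real \<Rightarrow> 'a::real_normed_algebra"
  assumes F: "uniformly_ac F" and G: "uniformly_ac G"
    and B: "B > 0" "\<And>t. norm (F t) \<le> B" "\<And>t. norm (G t) \<le> B"
  shows "uniformly_ac (\<lambda>t. F t * G t)"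
  unfolding uniformly_ac_def
proof (intro allI impI)
  fix \<epsilon> :: real assume "\<epsilon> > 0"
  then have e2: "\<epsilon> / (2 * B) > 0" using B(1) by simp
  obtain \<delta>1 where 1: "\<delta>1 > 0" "\<forall>(I::nat set) u v. finite I \<longrightarrow> (\<forall>i\<in>I. u i \<le> v i) \<longrightarrow>
        disjoint_family_on (\<lambda>i. {u i<..<v i}) I \<longrightarrow> (\<Sum>i\<in>I. v i - u i) < \<delta>1 \<longrightarrow>
        (\<Sum>i\<in>I. norm (F (v i) - F (u i))) < \<epsilon> / (2 * B)"
    by (rule uniformly_acE[OF F e2])
  obtain \<delta>2 where 2: "\<delta>2 > 0" "\<forall>(I::nat set) u v. finite I \<longrightarrow> (\<forall>i\<in>I. u i \<le> v i) \<longrightarrow>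
        disjoint_family_on (\<lambda>i. {u i<..<v i}) I \<longrightarrow> (\<Sum>i\<in>I. v i - u i) < \<delta>2 \<longrightarrow>
        (\<Sum>i\<in>I. norm (G (v i) - G (u i))) < \<epsilon> / (2 * B)"
    by (rule uniformly_acE[OF G e2])
  show "\<exists>\<delta>>0. \<forall>(n::nat) u v. (\<forall>i<n. u i \<le> v i) \<longrightarrow>
        disjoint_family_on (\<lambda>i. {u i<..<v i}) {..<n} \<longrightarrow> (\<Sum>i<n. v i - u i) < \<delta> \<longrightarrow>
        (\<Sum>i<n. norm (F (v i) * G (v i) - F (u i) * G (u i))) < \<epsilon>"
  proof (intro exI[of _ "min \<delta>1 \<delta>2"] conjI allI impI)
    fix n :: nat and u v :: "nat \<Rightarrow> real"
    assume uv: "\<forall>i<n. u i \<le> v i" "disjoint_family_on (\<lambda>i. {u i<..<v i}) {..<n}"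
      "(\<Sum>i<n. v i - u i) < min \<delta>1 \<delta>2"
    have "norm (F y * G y - F x * G x) \<le> B * norm (F y - F x) + B * norm (G y - G x)" for x y
    proof -
      have "F y * G y - F x * G x = (F y - F x) * G y + F x * (G y - G x)"
        by (simp add: algebra_simps)
      also have "norm \<dots> \<le> norm (F y - F x) * norm (G y) + norm (F x) * norm (G y - G x)"
        by (intro order_trans[OF norm_triangle_ineq] add_mono norm_mult_ineq)
      also have "\<dots> \<le> norm (F y - F x) * B + B * norm (G y - G x)"
        by (intro add_mono mult_left_mono mult_right_mono B) auto
      finally show ?thesis by (simp add: mult.commute)
    qed
    then have "(\<Sum>i<n. norm (F (v i) * G (v i) - F (u i) * G (u i)))
       \<le> (\<Sum>i<n. B * norm (F (v i) - F (u i)) + B * norm (G (v i) - G (u i)))"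
      by (intro sum_mono)
    also have "\<dots> = B * ((\<Sum>i<n. norm (F (v i) - F (u i))) + (\<Sum>i<n. norm (G (v i) - G (u i))))"
      by (simp add: sum.distrib sum_distrib_left distrib_left)
    also have "\<dots> < B * (\<epsilon> / (2 * B) + \<epsilon> / (2 * B))"
      using uv B(1) by (intro mult_strict_left_mono add_strict_mono 1(2)[rule_format] 2(2)[rule_format]) auto
    also have "\<dots> = \<epsilon>" using B(1) by (simp add: field_simps)
    finally show "(\<Sum>i<n. norm (F (v i) * G (v i) - F (u i) * G (u i))) < \<epsilon>" .
  qed (use 1 2 in auto)
qed

lemma uniformly_ac_imp_abs_cont_on:
  assumes "uniformly_ac (\<lambda>t. f (max a (min b t)))"
  shows "abs_cont_on a b f"
  unfolding abs_cont_on_def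
proof (intro allI impI)
  fix \<epsilon> :: real assume "\<epsilon> > 0"
  obtain \<delta> where \<delta>: "\<delta> > 0" "\<forall>(I::nat set) u v. finite I \<longrightarrow> (\<forall>i\<in>I. u i \<le> v i) \<longrightarrow>
        disjoint_family_on (\<lambda>i. {u i<..<v i}) I \<longrightarrow> (\<Sum>i\<in>I. v i - u i) < \<delta> \<longrightarrow>
        (\<Sum>i\<in>I. norm (f (max a (min b (v i))) - f (max a (min b (u i))))) < \<epsilon>"
    by (rule uniformly_acE[OF assms \<open>\<epsilon> > 0\<close>])
  show "\<exists>\<delta>>0. \<forall>(n::nat) u v. (\<forall>i<n. a \<le> u i \<and> u i \<le> v i \<and> v i \<le> b) \<longrightarrow>
        disjoint_family_on (\<lambda>i. {u i<..<v i}) {..<n} \<longrightarrow> (\<Sum>i<n. v i - u i) < \<delta> \<longrightarrow>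
        (\<Sum>i<n. norm (f (v i) - f (u i))) < \<epsilon>"
  proof (intro exI[of _ \<delta>] conjI allI impI \<delta>(1))
    fix n :: nat and u v :: "nat \<Rightarrow> real"
    assume uv: "\<forall>i<n. a \<le> u i \<and> u i \<le> v i \<and> v i \<le> b"
      "disjoint_family_on (\<lambda>i. {u i<..<v i}) {..<n}" "(\<Sum>i<n. v i - u i) < \<delta>"
    have "(\<Sum>i<n. norm (f (v i) - f (u i)))
        = (\<Sum>i<n. norm (f (max a (min b (v i))) - f (max a (min b (u i)))))"
    proof (rule sum.cong)
      fix i assume "i \<in> {..<n}"
      then have "a \<le> u i" "u i \<le> v i" "v i \<le> b" using uv(1) by auto
      then have "max a (min b (v i)) = v i" "max a (min b (u i)) = u i" by auto
      then show "norm (f (v i) - f (u i)) = norm (f (max a (min b (v i))) - f (max a (min b (u i))))"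
        by simp
    qed simp
    also have "\<dots> < \<epsilon>" using uv by (intro \<delta>(2)[rule_format]) auto
    finally show "(\<Sum>i<n. norm (f (v i) - f (u i))) < \<epsilon>" .
  qed
qed

text \<open>By continuity both factors are bounded on compact intervals, and bounded absolutely
  continuous functions can be multiplied.\<close>

lemma AC_loc_mult:
  assumes f: "f \<in> AC_loc" and g: "g \<in> AC_loc"
  shows "(\<lambda>x. f x * g x) \<in> AC_loc"
  unfolding AC_loc_def
proof safe
  fix a b :: real assume ab: "-1 < a" "a \<le> b" "b < 1"
  have cl: "max a (min b t) \<in> {a..b}" for t using ab by auto
  have bnd: "\<exists>B>0. \<forall>x\<in>{a..b}. norm (h x) \<le> B" if "h \<in> AC_loc" for h
  proof -
    have "continuous_on {a..b} h"
      by (rule continuous_on_subset[OF AC_loc_continuous_on[OF that]]) (use ab in auto)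
    then have "bounded (h ` {a..b})" by (intro compact_imp_bounded compact_continuous_image) auto
    then show ?thesis by (auto simp: bounded_pos)
  qed
  obtain B1 B2 where B: "B1 > 0" "\<forall>x\<in>{a..b}. norm (f x) \<le> B1" "B2 > 0" "\<forall>x\<in>{a..b}. norm (g x) \<le> B2"
    using bnd[OF f] bnd[OF g] by blast
  have "uniformly_ac (\<lambda>t. f (max a (min b t)) * g (max a (min b t)))"
  proof (rule uniformly_ac_mult)
    show "uniformly_ac (\<lambda>t. f (max a (min b t)))" "uniformly_ac (\<lambda>t. g (max a (min b t)))"
      using ab f g by (auto intro!: abs_cont_on_imp_uniformly_ac AC_loc_abs_cont_on)
    show "max B1 B2 > 0" using B by simp
    show "norm (f (max a (min b t))) \<le> max B1 B2" for t using B(2) cl[of t] by fastforce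
    show "norm (g (max a (min b t))) \<le> max B1 B2" for t using B(4) cl[of t] by fastforce
  qed
  then show "abs_cont_on a b (\<lambda>x. f x * g x)"
    by (rule uniformly_ac_imp_abs_cont_on)
qed

lemma AC_loc_add:
  assumes f: "f \<in> AC_loc" and g: "g \<in> AC_loc"
  shows "(\<lambda>x. f x + g x) \<in> AC_loc"
proof (rule AC_locI(1)[where g="\<lambda>x. ddx f x + ddx g x"])
  fix a b :: real assume ab: "-1 < a" "a \<le> b" "b < 1"
  show "(\<lambda>x. ddx f x + ddx g x) absolutely_integrable_on {a..b}"
    by (intro set_integral_add AC_loc_FTC(1)[OF f ab] AC_loc_FTC(1)[OF g ab])
  show "((\<lambda>x. ddx f x + ddx g x) has_integral (f b + g b - (f a + g a))) {a..b}"
    using has_integral_add[OF AC_loc_FTC(2)[OF f ab] AC_loc_FTC(2)[OF g ab]] by (simp add: algebra_simps)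
qed

lemma AC_loc_const [simp]: "(\<lambda>x. c) \<in> AC_loc"
  by (rule C1_AC_loc[where f'="\<lambda>x. 0"]) (auto intro!: derivative_eq_intros)

lemma AC_loc_cmult: "f \<in> AC_loc \<Longrightarrow> (\<lambda>x. c * f x) \<in> AC_loc"
  by (rule AC_loc_mult[OF AC_loc_const])

lemma AC_loc_uminus: "f \<in> AC_loc \<Longrightarrow> (\<lambda>x. - f x) \<in> AC_loc"
  using AC_loc_cmult[of f "-1"] by simp

lemma AC_loc_diff: "\<lbrakk>f \<in> AC_loc; g \<in> AC_loc\<rbrakk> \<Longrightarrow> (\<lambda>x. f x - g x) \<in> AC_loc"
  using AC_loc_add[OF _ AC_loc_uminus, of f g] by simp

text \<open>\<open>vector_derivative\<close> chooses a value among the possible derivatives. The two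
  functions have the same ones at x, so equality holds even where neither is differentiable.\<close>

lemma ddx_cong:
  assumes "x \<in> I1" "\<And>y. y \<in> I1 \<Longrightarrow> f y = g y"
  shows "ddx f x = ddx g x"
proof -
  have "(f has_vector_derivative D) (at x) \<longleftrightarrow> (g has_vector_derivative D) (at x)" for D
    using has_vector_derivative_transform_within_open[of f D x I1 g]
      has_vector_derivative_transform_within_open[of g D x I1 f] assms by auto
  then show ?thesis unfolding ddx_def vector_derivative_def by simp
qed

lemma differentiable_has_ddx: "f differentiable (at x) \<Longrightarrow> (f has_vector_derivative ddx f x) (at x)"
  unfolding ddx_def by (simp add: vector_derivative_works)

lemma borel_measurable_AC_loc: "f \<in> AC_loc \<Longrightarrow> f \<in> borel_measurable leb_I"
  by (intro continuous_imp_measurable_on_sets_lebesgue AC_loc_continuous_on) auto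

text \<open>On each interval of the exhaustion the derivative is integrable, hence measurable, and
  at every point the cut-off derivatives are eventually constant.\<close>

lemma borel_measurable_ddx:
  assumes "f \<in> AC_loc"
  shows "ddx f \<in> borel_measurable leb_I"
proof -
  define a b where "a n = -1 + 1 / (real n + 2)" and "b n = 1 - 1 / (real n + 2)" for n
  have ab: "-1 < a n" "a n \<le> b n" "b n < 1" for n
    unfolding a_def b_def using inverse_add_2_bounds[of n] by linarith+
  have m: "(\<lambda>x. indicator {a n..b n} x *\<^sub>R ddx f x) \<in> borel_measurable leb_I" for n
    using AC_loc_FTC(1)[OF assms ab] unfolding set_integrable_def
    by (intro measurable_restrict_space1) (rule borel_measurable_integrable)
  show ?thesis
  proof (rule borel_measurable_LIMSEQ_metric[OF m])
    fix x assume "x \<in> space leb_I"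
    then have x: "-1 < x" "x < 1" by auto
    obtain n where n: "a n < x" "x < b n"
      using ex_compact_subinterval[OF x] by (auto simp: a_def b_def)
    have "eventually (\<lambda>m. indicator {a m..b m} x *\<^sub>R ddx f x = ddx f x) sequentially"
    proof (rule eventually_sequentiallyI[of n])
      fix m assume "n \<le> m"
      then have "1 / (real m + 2) \<le> 1 / (real n + 2)" by (intro divide_left_mono) auto
      then have "x \<in> {a m..b m}" using n by (auto simp: a_def b_def)
      then show "indicator {a m..b m} x *\<^sub>R ddx f x = ddx f x" by simp
    qed
    then show "(\<lambda>m. indicator {a m..b m} x *\<^sub>R ddx f x) \<longlonglongrightarrow> ddx f x"
      by (rule tendsto_eventually)
  qed
qed

lemma AC_loc_increment_le:
  assumes f: "f \<in> AC_loc" and ab: "-1 < a" "a \<le> b" "b < 1"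
  shows "ennreal (norm (f b - f a)) \<le> (\<integral>\<^sup>+t. ennreal (norm (ddx f t)) * indicator {a..b} t \<partial>leb_I)"
proof -
  have i: "integrable lebesgue (\<lambda>t. indicator {a..b} t *\<^sub>R ddx f t)"
    using AC_loc_FTC(1)[OF assms] unfolding set_integrable_def .
  have "f b - f a = (LINT t:{a..b}|lebesgue. ddx f t)"
    using AC_loc_FTC[OF assms] by (metis has_integral_set_lebesgue has_integral_unique)
  then have "ennreal (norm (f b - f a)) \<le> (\<integral>\<^sup>+t. norm (indicator {a..b} t *\<^sub>R ddx f t) \<partial>lebesgue)"
    using integral_norm_bound_ennreal[OF i] unfolding set_lebesgue_integral_def by simp
  also have "\<dots> = (\<integral>\<^sup>+t. ennreal (norm (ddx f t)) * indicator {a..b} t * indicator I1 t \<partial>lebesgue)"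
    using ab by (intro nn_integral_cong) (auto simp: indicator_def)
  also have "\<dots> = (\<integral>\<^sup>+t. ennreal (norm (ddx f t)) * indicator {a..b} t \<partial>leb_I)"
    by (rule nn_integral_restrict_space[symmetric]) simp
  finally show ?thesis .
qed

text \<open>Dominated convergence along the exhaustion of (-1,1).\<close>

lemma integrable_tail_small:
  fixes k :: "real \<Rightarrow> complex"
  assumes k: "integrable leb_I k" and "e > 0"
  shows "\<exists>c. 0 < c \<and> c < 1 \<and> (\<integral>\<^sup>+t. ennreal (norm (k t)) * indicator {t. c < \<bar>t\<bar>} t \<partial>leb_I) < ennreal e"
proof -
  define c where "c n = 1 - 1 / (real n + 2)" for n
  have [measurable]: "k \<in> borel_measurable leb_I" using k by simp
  have meas: "{t. c n < \<bar>t\<bar>} \<in> sets lebesgue" for n by simp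
  have "(\<lambda>n. \<integral>\<^sup>+t. ennreal (norm (k t)) * indicator {t. c n < \<bar>t\<bar>} t \<partial>leb_I)
      \<longlonglongrightarrow> (\<integral>\<^sup>+t. 0 \<partial>leb_I)"
  proof (rule nn_integral_dominated_convergence[where w="\<lambda>t. ennreal (norm (k t))"])
    show "(\<lambda>t. ennreal (norm (k t)) * indicator {t. c n < \<bar>t\<bar>} t) \<in> borel_measurable leb_I" for n
      by (intro borel_measurable_times_ennreal measurable_restrict_space1[OF borel_measurable_indicator[OF meas]]) simp
    show "(\<integral>\<^sup>+t. ennreal (norm (k t)) \<partial>leb_I) < \<infinity>"
      using k by (simp add: integrable_iff_bounded)
    show "AE t in leb_I. (\<lambda>n. ennreal (norm (k t)) * indicator {t. c n < \<bar>t\<bar>} t) \<longlonglongrightarrow> 0"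
    proof (rule AE_I2)
      fix t assume "t \<in> space leb_I"
      then have t: "-1 < - \<bar>t\<bar>" "\<bar>t\<bar> < 1" by auto
      obtain n where n: "\<bar>t\<bar> < c n"
        using ex_compact_subinterval[OF t] by (auto simp: c_def)
      have "eventually (\<lambda>m. ennreal (norm (k t)) * indicator {t. c m < \<bar>t\<bar>} t = 0) sequentially"
      proof (rule eventually_sequentiallyI[of n])
        fix m assume "n \<le> m"
        then have "1 / (real m + 2) \<le> 1 / (real n + 2)" by (intro divide_left_mono) auto
        then have "\<not> c m < \<bar>t\<bar>" using n by (auto simp: c_def)
        then show "ennreal (norm (k t)) * indicator {t. c m < \<bar>t\<bar>} t = 0" by simp
      qed
      then show "(\<lambda>n. ennreal (norm (k t)) * indicator {t. c n < \<bar>t\<bar>} t) \<longlonglongrightarrow> 0"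
        by (rule tendsto_eventually)
    qed
  qed (auto simp: indicator_def)
  then have "eventually (\<lambda>n. (\<integral>\<^sup>+t. ennreal (norm (k t)) * indicator {t. c n < \<bar>t\<bar>} t \<partial>leb_I) < ennreal e) sequentially"
    using \<open>e > 0\<close> by (intro order_tendstoD(2)) auto
  then obtain n where "(\<integral>\<^sup>+t. ennreal (norm (k t)) * indicator {t. c n < \<bar>t\<bar>} t \<partial>leb_I) < ennreal e"
    using eventually_happens'[OF sequentially_bot] by blast
  moreover have "0 < c n" "c n < 1" using inverse_add_2_bounds[of n] by (auto simp: c_def)
  ultimately show ?thesis by blast
qed

text \<open>Integration by parts without boundary terms. The increments of W over the exhausting
  intervals tend to 0 by the limits at the ends and to the full integral by dominated
  convergence.\<close>

lemma AC_loc_integral_eq_0: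
  assumes W: "W \<in> AC_loc" and i: "integrable leb_I (ddx W)" and l: "lim0_at_ends W"
  shows "(LINT x|leb_I. ddx W x) = 0"
proof -
  define a b where "a n = -1 + 1 / (real n + 2)" and "b n = 1 - 1 / (real n + 2)" for n
  have ab: "-1 < a n" "a n \<le> b n" "b n < 1" for n
    unfolding a_def b_def using inverse_add_2_bounds[of n] by linarith+
  have z: "(\<lambda>n. 1 / (real n + 2)) \<longlonglongrightarrow> 0"
    using LIMSEQ_Suc[OF LIMSEQ_inverse_real_of_nat] by (simp add: inverse_eq_divide add.commute)
  have "a \<longlonglongrightarrow> -1 + 0" "b \<longlonglongrightarrow> 1 - 0" unfolding a_def b_def by (intro tendsto_intros z)+
  then have fa: "filterlim a (at_right (-1)) sequentially" and fb: "filterlim b (at_left 1) sequentially"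
    using inverse_add_2_bounds by (auto simp: filterlim_at a_def b_def less_eq_real_def)
  have "(\<lambda>n. W (b n) - W (a n)) \<longlonglongrightarrow> 0 - 0"
    using l unfolding lim0_at_ends_def
    by (intro tendsto_diff filterlim_compose[OF _ fa] filterlim_compose[OF _ fb]) auto
  moreover have "(\<lambda>n. W (b n) - W (a n)) \<longlonglongrightarrow> (LINT x|leb_I. ddx W x)"
  proof -
    have "W (b n) - W (a n) = (LINT x|leb_I. indicator {a n..b n} x *\<^sub>R ddx W x)" for n
    proof -
      have "W (b n) - W (a n) = (LINT t:{a n..b n}|lebesgue. ddx W t)"
        using AC_loc_FTC[OF W ab] by (metis has_integral_set_lebesgue has_integral_unique)
      also have "\<dots> = (LINT x|lebesgue. indicator I1 x *\<^sub>R (indicator {a n..b n} x *\<^sub>R ddx W x))"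
        unfolding set_lebesgue_integral_def using ab[of n]
        by (intro Bochner_Integration.integral_cong) (auto simp: indicator_def)
      also have "\<dots> = (LINT x|leb_I. indicator {a n..b n} x *\<^sub>R ddx W x)"
        by (rule integral_restrict_space[symmetric]) simp
      finally show ?thesis .
    qed
    moreover have "(\<lambda>n. LINT x|leb_I. indicator {a n..b n} x *\<^sub>R ddx W x) \<longlonglongrightarrow> (LINT x|leb_I. ddx W x)"
    proof (rule integral_dominated_convergence[where w="\<lambda>x. norm (ddx W x)"])
      show "integrable leb_I (\<lambda>x. norm (ddx W x))" using i by simp
      show "ddx W \<in> borel_measurable leb_I" using i by simp
      show "(\<lambda>x. indicator {a n..b n} x *\<^sub>R ddx W x) \<in> borel_measurable leb_I" for n
        using i by (intro borel_measurable_scaleR measurable_restrict_space1[OF borel_measurable_indicator]) auto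
      show "AE x in leb_I. norm (indicator {a n..b n} x *\<^sub>R ddx W x) \<le> norm (ddx W x)" for n
        by (auto simp: indicator_def)
      show "AE x in leb_I. (\<lambda>n. indicator {a n..b n} x *\<^sub>R ddx W x) \<longlonglongrightarrow> ddx W x"
      proof (rule AE_I2)
        fix x assume "x \<in> space leb_I"
        then have x: "-1 < x" "x < 1" by auto
        obtain n where n: "a n < x" "x < b n"
          using ex_compact_subinterval[OF x] by (auto simp: a_def b_def)
        have "eventually (\<lambda>m. indicator {a m..b m} x *\<^sub>R ddx W x = ddx W x) sequentially"
        proof (rule eventually_sequentiallyI[of n])
          fix m assume "n \<le> m"
          then have "1 / (real m + 2) \<le> 1 / (real n + 2)" by (intro divide_left_mono) auto
          then have "x \<in> {a m..b m}" using n by (auto simp: a_def b_def)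
          then show "indicator {a m..b m} x *\<^sub>R ddx W x = ddx W x" by simp
        qed
        then show "(\<lambda>m. indicator {a m..b m} x *\<^sub>R ddx W x) \<longlonglongrightarrow> ddx W x"
          by (rule tendsto_eventually)
      qed
    qed
    ultimately show ?thesis by simp
  qed
  ultimately show ?thesis using LIMSEQ_unique by fastforce
qed

subsection \<open>Square integrable functions and Hardy's inequality\<close>

text \<open>Lebesgue measure is complete, so changes on null sets preserve measurability; extension
  by zero transfers this to (-1,1).\<close>

lemma AE_leb_I_cong_measurable:
  fixes f g :: "real \<Rightarrow> complex"
  assumes f: "f \<in> borel_measurable leb_I" and ae: "AE x in leb_I. f x = g x"
  shows "g \<in> borel_measurable leb_I"
proof -
  have "(\<lambda>x. if x \<in> I1 then f x else 0) \<in> borel_measurable lebesgue"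
    using f by (simp only: borel_measurable_if[OF I1_sets(1)])
  moreover have "AE x in lebesgue. (if x \<in> I1 then f x else 0) = (if x \<in> I1 then g x else 0)"
    using ae by (subst (asm) AE_restrict_space_iff) (auto elim!: eventually_mono)
  ultimately have "(\<lambda>x. if x \<in> I1 then g x else 0) \<in> borel_measurable lebesgue"
    by (rule borel_measurable_AE)
  then show ?thesis by (simp only: borel_measurable_if[OF I1_sets(1)])
qed

interpretation leb_I: finite_measure leb_I
  by (rule finite_measure_lebesgue_on) simp

interpretation leb_I_pair: pair_sigma_finite leb_I leb_I ..

lemma measure_leb_I: "measure leb_I I1 = 2" "emeasure leb_I I1 = 2"
  by (simp_all add: measure_restrict_space emeasure_restrict_space)

lemma L2_measurable: "f \<in> L2 \<Longrightarrow> f \<in> borel_measurable leb_I"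
  by (simp add: L2_def)

lemma L2_iff:
  "f \<in> L2 \<longleftrightarrow> f \<in> borel_measurable leb_I \<and> (\<integral>\<^sup>+x. (ennreal (norm (f x)))\<^sup>2 \<partial>leb_I) < \<infinity>"
proof -
  have "(\<integral>\<^sup>+x. ennreal (norm ((norm (f x))\<^sup>2)) \<partial>leb_I) = (\<integral>\<^sup>+x. (ennreal (norm (f x)))\<^sup>2 \<partial>leb_I)"
    by (simp add: ennreal_power)
  moreover have "(\<lambda>x. (norm (f x))\<^sup>2) \<in> borel_measurable leb_I" if "f \<in> borel_measurable leb_I"
    using that by measurable
  ultimately show ?thesis
    unfolding L2_def by (auto simp: integrable_iff_bounded)
qed

lemma L2_bound:
  assumes f: "f \<in> borel_measurable leb_I" and g: "integrable leb_I g"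
    and le: "AE x in leb_I. (norm (f x))\<^sup>2 \<le> g x"
  shows "f \<in> L2"
  unfolding L2_def
proof (intro CollectI conjI f)
  show "integrable leb_I (\<lambda>x. (norm (f x))\<^sup>2)"
    by (rule Bochner_Integration.integrable_bound[OF g]) (use f le in \<open>auto elim!: eventually_mono\<close>)
qed

lemma L2_sq: "f \<in> L2 \<Longrightarrow> integrable leb_I (\<lambda>x. (norm (f x))\<^sup>2)"
  by (simp add: L2_def)

lemma norm_add_sq_le: "(norm (a + b))\<^sup>2 \<le> 2 * (norm a)\<^sup>2 + 2 * (norm (b::'a::real_normed_vector))\<^sup>2"
proof -
  have "(norm (a + b))\<^sup>2 \<le> (norm a + norm b)\<^sup>2" by (intro power_mono norm_triangle_ineq) auto
  also have "\<dots> \<le> 2 * (norm a)\<^sup>2 + 2 * (norm b)\<^sup>2"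
    using zero_le_power2[of "norm a - norm b"] by (simp add: power2_eq_square algebra_simps)
  finally show ?thesis .
qed

lemma L2_add:
  assumes "f \<in> L2" "g \<in> L2"
  shows "(\<lambda>x. f x + g x) \<in> L2"
proof (rule L2_bound[where g="\<lambda>x. 2 * (norm (f x))\<^sup>2 + 2 * (norm (g x))\<^sup>2"])
  show "(\<lambda>x. f x + g x) \<in> borel_measurable leb_I" using assms[THEN L2_measurable] by measurable
  show "integrable leb_I (\<lambda>x. 2 * (norm (f x))\<^sup>2 + 2 * (norm (g x))\<^sup>2)"
    using assms[THEN L2_sq] by simp
  show "AE x in leb_I. (norm (f x + g x))\<^sup>2 \<le> 2 * (norm (f x))\<^sup>2 + 2 * (norm (g x))\<^sup>2"
    by (simp add: norm_add_sq_le)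
qed

lemma L2_bounded_mult:
  assumes f: "f \<in> L2" and h: "h \<in> borel_measurable leb_I" and B: "\<And>x. x \<in> I1 \<Longrightarrow> norm (h x) \<le> B"
  shows "(\<lambda>x. h x * f x) \<in> L2"
proof (rule L2_bound[where g="\<lambda>x. B\<^sup>2 * (norm (f x))\<^sup>2"])
  show "(\<lambda>x. h x * f x) \<in> borel_measurable leb_I" using L2_measurable[OF f] h by measurable
  show "integrable leb_I (\<lambda>x. B\<^sup>2 * (norm (f x))\<^sup>2)" using L2_sq[OF f] by simp
  show "AE x in leb_I. (norm (h x * f x))\<^sup>2 \<le> B\<^sup>2 * (norm (f x))\<^sup>2"
  proof (rule AE_I2)
    fix x assume "x \<in> space leb_I"
    then have "norm (h x) \<le> B" using B by simp
    then show "(norm (h x * f x))\<^sup>2 \<le> B\<^sup>2 * (norm (f x))\<^sup>2"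
      unfolding norm_mult power_mult_distrib by (intro mult_right_mono power_mono) auto
  qed
qed

lemma L2_cmult: "f \<in> L2 \<Longrightarrow> (\<lambda>x. c * f x) \<in> L2"
  by (rule L2_bounded_mult[where B="norm c"]) auto

lemma L2_diff: "\<lbrakk>f \<in> L2; g \<in> L2\<rbrakk> \<Longrightarrow> (\<lambda>x. f x - g x) \<in> L2"
  using L2_add[OF _ L2_cmult[of g "-1"], of f] by simp

lemma L2_uminus: "f \<in> L2 \<Longrightarrow> (\<lambda>x. - f x) \<in> L2"
  using L2_cmult[of f "-1"] by simp

lemma L2_bounded:
  assumes "f \<in> borel_measurable leb_I" "\<And>x. x \<in> I1 \<Longrightarrow> norm (f x) \<le> B"
  shows "f \<in> L2"
proof (rule L2_bound[where g="\<lambda>x. B\<^sup>2"])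
  show "AE x in leb_I. (norm (f x))\<^sup>2 \<le> B\<^sup>2"
    using assms(2) by (intro AE_I2 power_mono) auto
qed (use assms in auto)

lemma L2_const [simp]: "(\<lambda>x. c) \<in> L2"
  by (rule L2_bounded[where B="norm c"]) auto

lemma L2_sum: "(\<And>i. i \<in> A \<Longrightarrow> f i \<in> L2) \<Longrightarrow> (\<lambda>x. \<Sum>i\<in>A. f i x) \<in> L2"
  by (induction A rule: infinite_finite_induct) (auto intro: L2_add)

lemma L2_cong_AE:
  assumes f: "f \<in> L2" and ae: "AE x in leb_I. f x = g x"
  shows "g \<in> L2"
proof (rule L2_bound[where g="\<lambda>x. (norm (f x))\<^sup>2"])
  show "g \<in> borel_measurable leb_I" by (rule AE_leb_I_cong_measurable[OF L2_measurable[OF f] ae])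
  show "integrable leb_I (\<lambda>x. (norm (f x))\<^sup>2)" by (rule L2_sq[OF f])
  show "AE x in leb_I. (norm (g x))\<^sup>2 \<le> (norm (f x))\<^sup>2"
    using ae by eventually_elim simp
qed

lemma L2_cong: "\<lbrakk>f \<in> L2; \<And>x. x \<in> I1 \<Longrightarrow> g x = f x\<rbrakk> \<Longrightarrow> g \<in> L2"
  by (rule L2_cong_AE[of f]) auto

lemma L2_cnj:
  assumes "f \<in> L2"
  shows "(\<lambda>x. cnj (f x)) \<in> L2"
proof (rule L2_bound[OF _ L2_sq[OF assms]])
  have "cnj \<in> borel_measurable borel"
    by (intro borel_measurable_continuous_onI continuous_intros)
  then show "(\<lambda>x. cnj (f x)) \<in> borel_measurable leb_I"
    using L2_measurable[OF assms] by (rule measurable_compose[rotated])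
qed simp

lemma L2_mult_integrable:
  assumes f: "f \<in> L2" and g: "g \<in> L2"
  shows "integrable leb_I (\<lambda>x. f x * g x)"
proof -
  have [measurable]: "f \<in> borel_measurable leb_I" "g \<in> borel_measurable leb_I"
    using assms[THEN L2_measurable] .
  have i: "integrable leb_I (\<lambda>x. (norm (f x))\<^sup>2 + (norm (g x))\<^sup>2)"
    using assms[THEN L2_sq] by simp
  have le: "norm a * norm b \<le> (norm a)\<^sup>2 + (norm b)\<^sup>2" for a b :: complex
    using sum_squares_bound[of "norm a" "norm b"] mult_nonneg_nonneg[of "norm a" "norm b"] norm_ge_zero[of a] norm_ge_zero[of b]
    unfolding mult.assoc by linarith
  show "integrable leb_I (\<lambda>x. f x * g x)"
    by (rule Bochner_Integration.integrable_bound[OF i]; force simp: norm_mult le)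
qed

lemma L2_inner_integrable: "\<lbrakk>f \<in> L2; g \<in> L2\<rbrakk> \<Longrightarrow> integrable leb_I (\<lambda>x. f x * cnj (g x))"
  by (rule L2_mult_integrable[OF _ L2_cnj])

lemma L2_integrable: "f \<in> L2 \<Longrightarrow> integrable leb_I f"
  using L2_mult_integrable[of f "\<lambda>x. 1"] by simp

text \<open>The interval may reach -1 or 1, where an antiderivative such as
  \<open>- 2 * sqrt (1 - x)\<close> is continuous but not differentiable.\<close>

lemma nn_integral_FTC_leb_I:
  assumes "-1 \<le> a" "a \<le> b" "b \<le> 1" and c: "continuous_on {a..b} F"
    and d: "\<And>t. t \<in> {a<..<b} \<Longrightarrow> (F has_real_derivative g t) (at t)"
    and g: "\<And>t. t \<in> {a..b} \<Longrightarrow> 0 \<le> g t"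
  shows "(\<integral>\<^sup>+t. ennreal (g t) * indicator {a..b} t \<partial>leb_I) \<le> ennreal (F b - F a)"
proof -
  have "(g has_integral (F b - F a)) {a..b}"
    by (rule fundamental_theorem_of_calculus_interior[OF assms(2) c])
       (use d in \<open>simp add: has_real_derivative_iff_has_vector_derivative\<close>)
  then have "(\<integral>\<^sup>+t. ennreal (g t) * indicator {a..b} t \<partial>lborel) = ennreal (F b - F a)"
    by (rule nn_integral_has_integral_lebesgue'[rotated]) (rule g)
  then have "(\<integral>\<^sup>+t. ennreal (g t) * indicator {a..b} t \<partial>lebesgue) = ennreal (F b - F a)"
    by (simp add: nn_integral_completion)
  moreover have "(\<integral>\<^sup>+t. ennreal (g t) * indicator {a..b} t \<partial>leb_I)
      \<le> (\<integral>\<^sup>+t. ennreal (g t) * indicator {a..b} t \<partial>lebesgue)"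
    by (subst nn_integral_restrict_space) (auto intro!: nn_integral_mono simp: indicator_def)
  ultimately show ?thesis by simp
qed

text \<open>Cauchy--Schwarz with \<open>k m = (k \<phi>)\<^sup>1\<^sup>/\<^sup>2 (k m\<^sup>2 / \<phi>)\<^sup>1\<^sup>/\<^sup>2\<close>, followed by Tonelli.\<close>

lemma schur_test:
  fixes k :: "real \<Rightarrow> real \<Rightarrow> real" and \<phi> m :: "real \<Rightarrow> real"
  assumes k: "case_prod k \<in> borel_measurable (leb_I \<Otimes>\<^sub>M leb_I)" "\<And>x t. 0 \<le> k x t"
    and \<phi>: "\<phi> \<in> borel_measurable leb_I" "\<And>t. t \<in> I1 \<Longrightarrow> 0 < \<phi> t"
    and m: "m \<in> borel_measurable leb_I" "\<And>t. 0 \<le> m t"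
    and 1: "\<And>x. x \<in> I1 \<Longrightarrow> (\<integral>\<^sup>+t. ennreal (k x t * \<phi> t) \<partial>leb_I) \<le> ennreal (\<alpha> * \<phi> x)"
    and 2: "\<And>t. t \<in> I1 \<Longrightarrow> (\<integral>\<^sup>+x. ennreal (k x t * \<phi> x) \<partial>leb_I) \<le> ennreal (\<beta> * \<phi> t)"
    and ab: "0 \<le> \<alpha>" "0 \<le> \<beta>"
  shows "(\<integral>\<^sup>+x. (\<integral>\<^sup>+t. ennreal (k x t * m t) \<partial>leb_I)\<^sup>2 \<partial>leb_I)
      \<le> ennreal (\<alpha> * \<beta>) * (\<integral>\<^sup>+t. (ennreal (m t))\<^sup>2 \<partial>leb_I)"
proof -
  have f[measurable]: "\<phi> \<in> borel_measurable leb_I" "m \<in> borel_measurable leb_I" by fact+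
  have kp[measurable]: "case_prod k \<in> borel_measurable (leb_I \<Otimes>\<^sub>M leb_I)" by fact
  have kx: "k x \<in> borel_measurable leb_I" if "x \<in> I1" for x
    using measurable_Pair2[OF k(1), of x] that by simp
  have kt: "(\<lambda>x. k x t) \<in> borel_measurable leb_I" if "t \<in> I1" for t
    using measurable_Pair1[OF k(1), of t] that by simp
  have "(\<integral>\<^sup>+t. ennreal (k x t * m t) \<partial>leb_I)\<^sup>2
      \<le> (\<integral>\<^sup>+t. ennreal (\<alpha> * \<phi> x * (k x t / \<phi> t * (m t)\<^sup>2)) \<partial>leb_I)" if x: "x \<in> I1" for x
  proof -
    note [measurable] = kx[OF x]
    have "(\<integral>\<^sup>+t. ennreal (k x t * m t) \<partial>leb_I)
        = (\<integral>\<^sup>+t. ennreal (sqrt (k x t * \<phi> t)) * ennreal (sqrt (k x t / \<phi> t) * m t) \<partial>leb_I)"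
    proof (rule nn_integral_cong)
      fix t assume "t \<in> space leb_I"
      then have p: "\<phi> t > 0" using \<phi> by simp
      have "sqrt (k x t * \<phi> t) * sqrt (k x t / \<phi> t) = k x t"
        using p k(2)[of x t] by (simp add: real_sqrt_mult[symmetric])
      then have "k x t * m t = sqrt (k x t * \<phi> t) * (sqrt (k x t / \<phi> t) * m t)"
        by (simp add: mult.assoc[symmetric])
      then show "ennreal (k x t * m t) = ennreal (sqrt (k x t * \<phi> t)) * ennreal (sqrt (k x t / \<phi> t) * m t)"
        using p k(2) m(2) by (simp add: ennreal_mult[symmetric])
    qed
    then have "(\<integral>\<^sup>+t. ennreal (k x t * m t) \<partial>leb_I)\<^sup>2
        \<le> (\<integral>\<^sup>+t. (ennreal (sqrt (k x t * \<phi> t)))\<^sup>2 \<partial>leb_I) *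
           (\<integral>\<^sup>+t. (ennreal (sqrt (k x t / \<phi> t) * m t))\<^sup>2 \<partial>leb_I)"
      by (simp only:) (intro Cauchy_Schwarz_nn_integral; measurable)
    also have "(\<integral>\<^sup>+t. (ennreal (sqrt (k x t * \<phi> t)))\<^sup>2 \<partial>leb_I) = (\<integral>\<^sup>+t. ennreal (k x t * \<phi> t) \<partial>leb_I)"
      using \<phi>(2) k(2) by (intro nn_integral_cong) (auto simp: ennreal_power less_imp_le)
    also have "(\<integral>\<^sup>+t. (ennreal (sqrt (k x t / \<phi> t) * m t))\<^sup>2 \<partial>leb_I)
        = (\<integral>\<^sup>+t. ennreal (k x t / \<phi> t * (m t)\<^sup>2) \<partial>leb_I)"
      using \<phi>(2) k(2) m(2)
      by (intro nn_integral_cong) (auto simp: ennreal_power less_imp_le power_mult_distrib)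
    also have "(\<integral>\<^sup>+t. ennreal (k x t * \<phi> t) \<partial>leb_I) * (\<integral>\<^sup>+t. ennreal (k x t / \<phi> t * (m t)\<^sup>2) \<partial>leb_I)
        \<le> ennreal (\<alpha> * \<phi> x) * (\<integral>\<^sup>+t. ennreal (k x t / \<phi> t * (m t)\<^sup>2) \<partial>leb_I)"
      by (intro mult_right_mono 1 x) simp
    also have "\<dots> = (\<integral>\<^sup>+t. ennreal (\<alpha> * \<phi> x) * ennreal (k x t / \<phi> t * (m t)\<^sup>2) \<partial>leb_I)"
      by (rule nn_integral_cmult[symmetric]) measurable
    also have "\<dots> = (\<integral>\<^sup>+t. ennreal (\<alpha> * \<phi> x * (k x t / \<phi> t * (m t)\<^sup>2)) \<partial>leb_I)"
      using \<phi>(2)[OF x] ab by (intro nn_integral_cong ennreal_mult'[symmetric]) simp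
    finally show ?thesis .
  qed
  then have "(\<integral>\<^sup>+x. (\<integral>\<^sup>+t. ennreal (k x t * m t) \<partial>leb_I)\<^sup>2 \<partial>leb_I)
      \<le> (\<integral>\<^sup>+x. \<integral>\<^sup>+t. ennreal (\<alpha> * \<phi> x * (k x t / \<phi> t * (m t)\<^sup>2)) \<partial>leb_I \<partial>leb_I)"
    by (intro nn_integral_mono) simp
  also have "\<dots> = (\<integral>\<^sup>+t. \<integral>\<^sup>+x. ennreal (\<alpha> * \<phi> x * (k x t / \<phi> t * (m t)\<^sup>2)) \<partial>leb_I \<partial>leb_I)"
    by (rule leb_I_pair.Fubini'[symmetric]) measurable
  also have "\<dots> \<le> (\<integral>\<^sup>+t. ennreal (\<alpha> * \<beta>) * (ennreal (m t))\<^sup>2 \<partial>leb_I)"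
  proof (rule nn_integral_mono)
    fix t assume "t \<in> space leb_I"
    then have t: "t \<in> I1" by simp
    note [measurable] = kt[OF t]
    have p: "\<phi> t > 0" using \<phi>(2)[OF t] .
    have "(\<integral>\<^sup>+x. ennreal (\<alpha> * \<phi> x * (k x t / \<phi> t * (m t)\<^sup>2)) \<partial>leb_I)
        = (\<integral>\<^sup>+x. ennreal (\<alpha> * (m t)\<^sup>2 / \<phi> t) * ennreal (k x t * \<phi> x) \<partial>leb_I)"
      using p ab by (intro nn_integral_cong, subst ennreal_mult'[symmetric]) (simp_all add: mult_ac)
    also have "\<dots> = ennreal (\<alpha> * (m t)\<^sup>2 / \<phi> t) * (\<integral>\<^sup>+x. ennreal (k x t * \<phi> x) \<partial>leb_I)"
      by (rule nn_integral_cmult) measurable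
    also have "\<dots> \<le> ennreal (\<alpha> * (m t)\<^sup>2 / \<phi> t) * ennreal (\<beta> * \<phi> t)"
      by (intro mult_left_mono 2 t) simp
    also have "\<dots> = ennreal (\<alpha> * (m t)\<^sup>2 / \<phi> t * (\<beta> * \<phi> t))"
      using p ab by (intro ennreal_mult'[symmetric]) simp
    also have "\<alpha> * (m t)\<^sup>2 / \<phi> t * (\<beta> * \<phi> t) = \<alpha> * \<beta> * (m t)\<^sup>2" using p by simp
    also have "ennreal (\<alpha> * \<beta> * (m t)\<^sup>2) = ennreal (\<alpha> * \<beta>) * (ennreal (m t))\<^sup>2"
      using ab m(2) by (simp add: ennreal_mult' ennreal_power)
    finally show "(\<integral>\<^sup>+x. ennreal (\<alpha> * \<phi> x * (k x t / \<phi> t * (m t)\<^sup>2)) \<partial>leb_I)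
        \<le> ennreal (\<alpha> * \<beta>) * (ennreal (m t))\<^sup>2" .
  qed
  also have "\<dots> = ennreal (\<alpha> * \<beta>) * (\<integral>\<^sup>+t. (ennreal (m t))\<^sup>2 \<partial>leb_I)"
    by (rule nn_integral_cmult) measurable
  finally show ?thesis .
qed

text \<open>
  The kernel of integration outwards from 0 against the measure \<open>dt / (1 - t\<^sup>2)\<close>; its transpose
  is \<open>1 / (1 - x\<^sup>2)\<close> times the integral from \<open>x\<close> to the endpoint on its side.  The function \<open>1 / sqrt (1 - t\<^sup>2)\<close> serves as
  the Schur weight because \<open>t / sqrt (1 - t\<^sup>2)\<close> is an antiderivative of
  \<open>(1 - t\<^sup>2) powr (-3/2)\<close>.
\<close>

definition hardy_ker :: "real \<Rightarrow> real \<Rightarrow> real" where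
  "hardy_ker x t = (if \<bar>t\<bar> \<le> \<bar>x\<bar> \<and> 0 \<le> x * t \<and> \<bar>t\<bar> < 1 then 1 / (1 - t\<^sup>2) else 0)"

lemma one_minus_sq_pos: "\<bar>t\<bar> < 1 \<Longrightarrow> 0 < 1 - (t::real)\<^sup>2"
  by (simp add: abs_square_less_1)

lemma hardy_ker_nonneg: "0 \<le> hardy_ker x t"
proof (cases "\<bar>t\<bar> < 1")
  case True
  then show ?thesis using one_minus_sq_pos[OF True] by (simp add: hardy_ker_def less_imp_le)
qed (simp add: hardy_ker_def)

lemma ident_measurable_leb_I: "(\<lambda>x. x) \<in> borel_measurable leb_I"
  using id_borel_measurable_lebesgue_on[of I1] unfolding id_def .

lemma hardy_ker_measurable:
  "case_prod hardy_ker \<in> borel_measurable (leb_I \<Otimes>\<^sub>M leb_I)"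
  "case_prod (\<lambda>x t. hardy_ker t x) \<in> borel_measurable (leb_I \<Otimes>\<^sub>M leb_I)"
proof -
  have [measurable]: "fst \<in> borel_measurable (leb_I \<Otimes>\<^sub>M leb_I)" "snd \<in> borel_measurable (leb_I \<Otimes>\<^sub>M leb_I)"
    using measurable_compose[OF measurable_fst ident_measurable_leb_I]
      measurable_compose[OF measurable_snd ident_measurable_leb_I] by auto
  show "case_prod hardy_ker \<in> borel_measurable (leb_I \<Otimes>\<^sub>M leb_I)"
    "case_prod (\<lambda>x t. hardy_ker t x) \<in> borel_measurable (leb_I \<Otimes>\<^sub>M leb_I)"
    unfolding hardy_ker_def case_prod_unfold by measurable
qed

text \<open>Integrating the weight outwards to x gives |x| / sqrt (1 - x^2); since |x| < 1 the row
  constant is 1.\<close>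

lemma hardy_ker_row:
  assumes "x \<in> I1"
  shows "(\<integral>\<^sup>+t. ennreal (hardy_ker x t * (1 / sqrt (1 - t\<^sup>2))) \<partial>leb_I) \<le> ennreal (1 * (1 / sqrt (1 - x\<^sup>2)))"
proof -
  define g where "g t = 1 / (1 - t\<^sup>2) * (1 / sqrt (1 - t\<^sup>2))" for t :: real
  define F where "F t = t / sqrt (1 - t\<^sup>2)" for t :: real
  have d: "(F has_real_derivative g t) (at t)" if "\<bar>t\<bar> < 1" for t
  proof -
    have p: "1 - t\<^sup>2 > 0" using one_minus_sq_pos[OF that] .
    have "((\<lambda>t. t / sqrt (1 - t\<^sup>2)) has_real_derivative
        (sqrt (1 - t\<^sup>2) - t * (- (2 * t) * inverse (sqrt (1 - t\<^sup>2)) / 2)) / (sqrt (1 - t\<^sup>2) * sqrt (1 - t\<^sup>2))) (at t)"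
      using p by (auto intro!: derivative_eq_intros)
    also have "sqrt (1 - t\<^sup>2) - t * (- (2 * t) * inverse (sqrt (1 - t\<^sup>2)) / 2) = 1 / sqrt (1 - t\<^sup>2)"
    proof -
      have s: "sqrt (1 - t\<^sup>2) * sqrt (1 - t\<^sup>2) = 1 - t\<^sup>2" "sqrt (1 - t\<^sup>2) \<noteq> 0" using p by auto
      then show ?thesis by (simp add: field_simps power2_eq_square)
    qed
    also have "1 / sqrt (1 - t\<^sup>2) / (sqrt (1 - t\<^sup>2) * sqrt (1 - t\<^sup>2)) = g t"
      using p by (simp add: g_def)
    finally show ?thesis unfolding F_def .
  qed
  have x: "\<bar>x\<bar> < 1" using assms by auto
  \<comment> \<open>In row x the kernel is supported on the interval between 0 and x, on either side
    of 0.\<close>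
  define a b where "a = min 0 x" and "b = max 0 x"
  have ab: "-1 \<le> a" "a \<le> b" "b \<le> 1" "\<And>t. t \<in> {a..b} \<Longrightarrow> \<bar>t\<bar> < 1" using x by (auto simp: a_def b_def)
  have eq: "ennreal (hardy_ker x t * (1 / sqrt (1 - t\<^sup>2))) = ennreal (g t) * indicator {a..b} t" for t
  proof -
    have "\<bar>t\<bar> \<le> \<bar>x\<bar> \<and> 0 \<le> x * t \<and> \<bar>t\<bar> < 1 \<longleftrightarrow> t \<in> {a..b}"
      using x by (cases x "0::real" rule: linorder_cases)
        (auto simp: a_def b_def zero_le_mult_iff abs_if split: if_splits)
    then show ?thesis by (auto simp: hardy_ker_def g_def)
  qed
  have "(\<integral>\<^sup>+t. ennreal (g t) * indicator {a..b} t \<partial>leb_I) \<le> ennreal (F b - F a)"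
  proof (rule nn_integral_FTC_leb_I[OF ab(1-3)])
    show "continuous_on {a..b} F"
      using d ab(4) by (intro continuous_at_imp_continuous_on ballI DERIV_isCont) auto
    show "(F has_real_derivative g t) (at t)" if "t \<in> {a<..<b}" for t
      using that by (intro d ab(4)) auto
    show "0 \<le> g t" if "t \<in> {a..b}" for t
      using one_minus_sq_pos[OF ab(4)[OF that]] by (simp add: g_def)
  qed
  also have "F b - F a = \<bar>x\<bar> / sqrt (1 - x\<^sup>2)"
    by (auto simp: F_def a_def b_def min_def max_def)
  also have "\<dots> \<le> 1 * (1 / sqrt (1 - x\<^sup>2))"
    using x one_minus_sq_pos[OF x] by (simp add: divide_right_mono)
  finally show ?thesis unfolding eq using ennreal_leI order_trans by blast
qed

text \<open>Bound 1 - x^2 below by 1 - |x|. From |t| to an end the integral of 1 / sqrt (1 - |x|) is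
  2 sqrt (1 - |t|). Counting both sides, which avoids a distinction by the sign of t, gives 4 sqrt
  (1 - |t|) / (1 - t^2), and this is at most 4 / sqrt (1 - t^2).\<close>

lemma hardy_ker_column:
  assumes "t \<in> I1"
  shows "(\<integral>\<^sup>+x. ennreal (hardy_ker x t * (1 / sqrt (1 - x\<^sup>2))) \<partial>leb_I) \<le> ennreal (4 * (1 / sqrt (1 - t\<^sup>2)))"
proof -
  define c where "c = \<bar>t\<bar>"
  have c: "0 \<le> c" "c < 1" using assms by (auto simp: c_def)
  have pt: "1 - t\<^sup>2 > 0" using assms one_minus_sq_pos[of t] by auto
  have ct: "1 - c \<le> 1 - t\<^sup>2"
    using c mult_left_le[of c c] by (simp add: c_def power2_eq_square)
  have up: "(\<integral>\<^sup>+x. ennreal (1 / sqrt (1 - x)) * indicator {c..1} x \<partial>leb_I)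
      \<le> ennreal (- 2 * sqrt (1 - 1) - (- 2 * sqrt (1 - c)))"
  proof (rule nn_integral_FTC_leb_I)
    show "((\<lambda>x. - 2 * sqrt (1 - x)) has_real_derivative 1 / sqrt (1 - x)) (at x)" if "x \<in> {c<..<1}" for x
      using that c by (auto intro!: derivative_eq_intros simp: field_simps)
  qed (use c in \<open>auto intro!: continuous_intros\<close>)
  have lo: "(\<integral>\<^sup>+x. ennreal (1 / sqrt (1 + x)) * indicator {-1..-c} x \<partial>leb_I)
      \<le> ennreal (2 * sqrt (1 + - c) - (2 * sqrt (1 + - 1)))"
  proof (rule nn_integral_FTC_leb_I)
    show "((\<lambda>x. 2 * sqrt (1 + x)) has_real_derivative 1 / sqrt (1 + x)) (at x)" if "x \<in> {-1<..<-c}" for x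
      using that c by (auto intro!: derivative_eq_intros simp: field_simps)
  qed (use c in \<open>auto intro!: continuous_intros\<close>)
  have pw: "ennreal (hardy_ker x t * (1 / sqrt (1 - x\<^sup>2))) \<le> ennreal (1 / (1 - t\<^sup>2)) *
      (ennreal (1 / sqrt (1 - x)) * indicator {c..1} x + ennreal (1 / sqrt (1 + x)) * indicator {-1..-c} x)"
    if x: "x \<in> I1" for x
  proof (cases "c \<le> \<bar>x\<bar>")
    case False
    then show ?thesis by (simp add: hardy_ker_def c_def)
  next
    case True
    have hk: "hardy_ker x t \<le> 1 / (1 - t\<^sup>2)" using pt by (simp add: hardy_ker_def)
    have px: "1 - x\<^sup>2 > 0" using x one_minus_sq_pos[of x] by auto
    show ?thesis
    proof (cases "0 \<le> x")
      case x0: True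
      have "1 - x \<le> 1 - x\<^sup>2" using x x0 mult_left_le[of x x] by (simp add: power2_eq_square)
      then have "1 / sqrt (1 - x\<^sup>2) \<le> 1 / sqrt (1 - x)"
        using x by (intro divide_left_mono) auto
      then have "hardy_ker x t * (1 / sqrt (1 - x\<^sup>2)) \<le> 1 / (1 - t\<^sup>2) * (1 / sqrt (1 - x))"
        using hk pt px by (intro mult_mono) auto
      then have "ennreal (hardy_ker x t * (1 / sqrt (1 - x\<^sup>2))) \<le> ennreal (1 / (1 - t\<^sup>2)) * ennreal (1 / sqrt (1 - x))"
        using pt by (simp add: ennreal_mult'[symmetric] ennreal_leI)
      also have "\<dots> \<le> ennreal (1 / (1 - t\<^sup>2)) *
        (ennreal (1 / sqrt (1 - x)) * indicator {c..1} x + ennreal (1 / sqrt (1 + x)) * indicator {-1..-c} x)"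
        using True x0 x by (intro mult_left_mono) auto
      finally show ?thesis .
    next
      case x0: False
      have "1 + x \<le> 1 - x\<^sup>2" using x x0 mult_left_le[of "-x" "-x"] by (simp add: power2_eq_square)
      then have "1 / sqrt (1 - x\<^sup>2) \<le> 1 / sqrt (1 + x)"
        using x by (intro divide_left_mono) auto
      then have "hardy_ker x t * (1 / sqrt (1 - x\<^sup>2)) \<le> 1 / (1 - t\<^sup>2) * (1 / sqrt (1 + x))"
        using hk pt px by (intro mult_mono) auto
      then have "ennreal (hardy_ker x t * (1 / sqrt (1 - x\<^sup>2))) \<le> ennreal (1 / (1 - t\<^sup>2)) * ennreal (1 / sqrt (1 + x))"
        using pt by (simp add: ennreal_mult'[symmetric] ennreal_leI)
      also have "\<dots> \<le> ennreal (1 / (1 - t\<^sup>2)) *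
        (ennreal (1 / sqrt (1 - x)) * indicator {c..1} x + ennreal (1 / sqrt (1 + x)) * indicator {-1..-c} x)"
        using True x0 x by (intro mult_left_mono) auto
      finally show ?thesis .
    qed
  qed
  note [measurable] = ident_measurable_leb_I
  have ind: "indicator {a..b} \<in> borel_measurable leb_I" for a b :: real
    by (intro measurable_restrict_space1 borel_measurable_indicator) simp
  have "(\<integral>\<^sup>+x. ennreal (hardy_ker x t * (1 / sqrt (1 - x\<^sup>2))) \<partial>leb_I)
      \<le> (\<integral>\<^sup>+x. ennreal (1 / (1 - t\<^sup>2)) * (ennreal (1 / sqrt (1 - x)) * indicator {c..1} x +
          ennreal (1 / sqrt (1 + x)) * indicator {-1..-c} x) \<partial>leb_I)"
    using pw by (intro nn_integral_mono) simp
  also have "\<dots> = ennreal (1 / (1 - t\<^sup>2)) * ((\<integral>\<^sup>+x. ennreal (1 / sqrt (1 - x)) * indicator {c..1} x \<partial>leb_I) +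
      (\<integral>\<^sup>+x. ennreal (1 / sqrt (1 + x)) * indicator {-1..-c} x \<partial>leb_I))"
  proof -
    have [measurable]: "(\<lambda>x. ennreal (1 / sqrt (1 - x)) * indicator {c..1} x) \<in> borel_measurable leb_I"
      "(\<lambda>x. ennreal (1 / sqrt (1 + x)) * indicator {-1..-c} x) \<in> borel_measurable leb_I"
      by (intro borel_measurable_times_ennreal ind; measurable)+
    show ?thesis by (subst nn_integral_cmult, measurable) (subst nn_integral_add; measurable?; simp)
  qed
  also have "\<dots> \<le> ennreal (1 / (1 - t\<^sup>2)) * (ennreal (2 * sqrt (1 - c)) + ennreal (2 * sqrt (1 - c)))"
    using up lo by (intro mult_left_mono add_mono) auto
  also have "\<dots> = ennreal (1 / (1 - t\<^sup>2) * (4 * sqrt (1 - c)))"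
    using pt c by (simp add: ennreal_plus[symmetric] ennreal_mult'[symmetric] del: ennreal_plus)
  also have "\<dots> \<le> ennreal (4 * (1 / sqrt (1 - t\<^sup>2)))"
  proof (rule ennreal_leI)
    have "1 / (1 - t\<^sup>2) * (4 * sqrt (1 - c)) \<le> 1 / (1 - t\<^sup>2) * (4 * sqrt (1 - t\<^sup>2))"
      using ct pt by (intro mult_left_mono) auto
    also have "\<dots> = 4 * (1 / sqrt (1 - t\<^sup>2))"
    proof -
      define s where "s = sqrt (1 - t\<^sup>2)"
      have "s * s = 1 - t\<^sup>2" "s \<noteq> 0" using pt by (auto simp: s_def)
      then show ?thesis unfolding s_def[symmetric] by (simp add: field_simps flip: \<open>s * s = 1 - t\<^sup>2\<close>)
    qed
    finally show "1 / (1 - t\<^sup>2) * (4 * sqrt (1 - c)) \<le> 4 * (1 / sqrt (1 - t\<^sup>2))" .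
  qed
  finally show ?thesis .
qed

text \<open>Transposition exchanges the row and column estimates, so the Schur constant is the
  product of 1 and 4 for both kernels.\<close>

lemma hardy_bounds:
  fixes m :: "real \<Rightarrow> real"
  assumes m: "m \<in> borel_measurable leb_I" "\<And>t. 0 \<le> m t"
  shows "(\<integral>\<^sup>+x. (\<integral>\<^sup>+t. ennreal (hardy_ker x t * m t) \<partial>leb_I)\<^sup>2 \<partial>leb_I) \<le> 4 * (\<integral>\<^sup>+t. (ennreal (m t))\<^sup>2 \<partial>leb_I)"
    and "(\<integral>\<^sup>+x. (\<integral>\<^sup>+t. ennreal (hardy_ker t x * m t) \<partial>leb_I)\<^sup>2 \<partial>leb_I) \<le> 4 * (\<integral>\<^sup>+t. (ennreal (m t))\<^sup>2 \<partial>leb_I)"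
proof -
  note [measurable] = ident_measurable_leb_I
  have \<phi>: "(\<lambda>t. 1 / sqrt (1 - t\<^sup>2)) \<in> borel_measurable leb_I" by measurable
  have \<phi>p: "0 < 1 / sqrt (1 - t\<^sup>2)" if "t \<in> I1" for t
    using that one_minus_sq_pos[of t] by auto
  show "(\<integral>\<^sup>+x. (\<integral>\<^sup>+t. ennreal (hardy_ker x t * m t) \<partial>leb_I)\<^sup>2 \<partial>leb_I) \<le> 4 * (\<integral>\<^sup>+t. (ennreal (m t))\<^sup>2 \<partial>leb_I)"
    using schur_test[OF hardy_ker_measurable(1) hardy_ker_nonneg \<phi> \<phi>p m hardy_ker_row hardy_ker_column]
    by simp
  show "(\<integral>\<^sup>+x. (\<integral>\<^sup>+t. ennreal (hardy_ker t x * m t) \<partial>leb_I)\<^sup>2 \<partial>leb_I) \<le> 4 * (\<integral>\<^sup>+t. (ennreal (m t))\<^sup>2 \<partial>leb_I)"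
    using schur_test[OF hardy_ker_measurable(2) hardy_ker_nonneg \<phi> \<phi>p m hardy_ker_column hardy_ker_row]
    by simp
qed

section \<open>Weighted estimates for absolutely continuous functions\<close>

lemma weight_pos: "x \<in> I1 \<Longrightarrow> 0 < 1 - x\<^sup>2"
  by (rule one_minus_sq_pos) auto

lemma weight_nonneg: "x \<in> I1 \<Longrightarrow> 0 \<le> 1 - x\<^sup>2"
  using weight_pos[of x] by simp

lemma norm_leg_w: "x \<in> I1 \<Longrightarrow> norm (leg_w x) = 1 - x\<^sup>2"
  unfolding leg_w_def norm_of_real by (rule abs_of_nonneg, rule weight_nonneg)

lemma leg_w_nonzero: "x \<in> I1 \<Longrightarrow> leg_w x \<noteq> 0"
  using norm_leg_w[of x] weight_pos[of x] by auto

lemma leg_w_has_derivative: "(leg_w has_vector_derivative - 2 * of_real x) (at x)"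
proof -
  have "((\<lambda>x. 1 - x\<^sup>2) has_real_derivative - 2 * x) (at x)"
    by (auto intro!: derivative_eq_intros)
  then have "((\<lambda>x. complex_of_real (1 - x\<^sup>2)) has_vector_derivative of_real (- 2 * x)) (at x)"
    by (rule has_vector_derivative_of_real)
  then show ?thesis unfolding leg_w_def[abs_def] by simp
qed

lemma of_real_has_derivative: "((\<lambda>x. complex_of_real x) has_vector_derivative 1) (at x)"
  using has_vector_derivative_of_real[OF DERIV_ident, of "at x"] by simp

lemma continuous_leg_w: "continuous_on S leg_w"
  unfolding leg_w_def[abs_def] by (intro continuous_intros)

lemma AC_loc_leg_w: "leg_w \<in> AC_loc"
  by (rule C1_AC_loc[OF leg_w_has_derivative]) (intro continuous_intros)

lemma AC_loc_of_real: "(\<lambda>x. complex_of_real x) \<in> AC_loc"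
  by (rule C1_AC_loc[OF of_real_has_derivative]) (intro continuous_intros)

lemma leg_w_measurable: "leg_w \<in> borel_measurable leb_I"
  by (rule borel_measurable_AC_loc[OF AC_loc_leg_w])

lemma of_real_measurable_leb_I: "(\<lambda>x. complex_of_real x) \<in> borel_measurable leb_I"
  by (rule borel_measurable_AC_loc[OF AC_loc_of_real])

lemma norm_leg_w_le_1: "x \<in> I1 \<Longrightarrow> norm (leg_w x) \<le> 1"
  by (simp only: norm_leg_w) simp

lemma L2_leg_w_mult: "f \<in> L2 \<Longrightarrow> (\<lambda>x. leg_w x * f x) \<in> L2"
  by (rule L2_bounded_mult[OF _ leg_w_measurable norm_leg_w_le_1])

lemma L2_of_real_mult: "f \<in> L2 \<Longrightarrow> (\<lambda>x. of_real x * f x) \<in> L2"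
  by (rule L2_bounded_mult[OF _ of_real_measurable_leb_I, where B=1]) auto

text \<open>Common core of the estimates below. There \<open>c\<close> is a power of the weight at a
  fixed point, and \<open>h\<close> dominates because the weight is monotone in the distance from
  0.\<close>

lemma AC_loc_scaled_increment_le:
  assumes f: "f \<in> AC_loc" and xy: "x \<in> I1" "y \<in> I1" and c: "0 \<le> c"
    and h: "\<And>t. \<lbrakk>t \<in> I1; min x y \<le> t; t \<le> max x y\<rbrakk> \<Longrightarrow> c * norm (ddx f t) \<le> h t"
  shows "ennreal (c * norm (f y - f x)) \<le> (\<integral>\<^sup>+t. ennreal (h t) \<partial>leb_I)"
proof -
  define a b where "a = min x y" and "b = max x y"
  have ab: "-1 < a" "a \<le> b" "b < 1" using xy by (auto simp: a_def b_def)
  have [measurable]: "ddx f \<in> borel_measurable leb_I" by (rule borel_measurable_ddx[OF f])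
  have "(\<lambda>t. ennreal (norm (ddx f t)) * indicator {a..b} t) \<in> borel_measurable leb_I"
    by (intro borel_measurable_times_ennreal measurable_restrict_space1[OF borel_measurable_indicator]) auto
  note [measurable] = this
  have "norm (f y - f x) = norm (f b - f a)"
    by (auto simp: a_def b_def min_def max_def norm_minus_commute)
  then have "ennreal (c * norm (f y - f x)) = ennreal c * ennreal (norm (f b - f a))"
    using c by (simp add: ennreal_mult')
  also have "\<dots> \<le> ennreal c * (\<integral>\<^sup>+t. ennreal (norm (ddx f t)) * indicator {a..b} t \<partial>leb_I)"
    by (intro mult_left_mono AC_loc_increment_le[OF f ab]) simp
  also have "\<dots> = (\<integral>\<^sup>+t. ennreal c * (ennreal (norm (ddx f t)) * indicator {a..b} t) \<partial>leb_I)"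
    by (rule nn_integral_cmult[symmetric]) measurable
  also have "\<dots> \<le> (\<integral>\<^sup>+t. ennreal (h t) \<partial>leb_I)"
  proof (rule nn_integral_mono)
    fix t assume "t \<in> space leb_I"
    then have t: "t \<in> I1" by simp
    show "ennreal c * (ennreal (norm (ddx f t)) * indicator {a..b} t) \<le> ennreal (h t)"
    proof (cases "t \<in> {a..b}")
      case True
      then have "c * norm (ddx f t) \<le> h t" using h[OF t] by (auto simp: a_def b_def)
      then show ?thesis using True c by (simp add: ennreal_mult'[symmetric] ennreal_leI)
    qed simp
  qed
  finally show ?thesis .
qed

lemma power_weight_mono:
  assumes "\<bar>t\<bar> \<le> \<bar>x\<bar>" "x \<in> I1"
  shows "(1 - x\<^sup>2) ^ j \<le> (1 - t\<^sup>2) ^ j"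
proof (rule power_mono)
  show "1 - x\<^sup>2 \<le> 1 - t\<^sup>2" using abs_le_square_iff[of t x] assms by simp
  show "0 \<le> 1 - x\<^sup>2" using weight_nonneg[OF assms(2)] .
qed

lemma between_zero:
  assumes "min 0 x \<le> t" "t \<le> max 0 (x::real)"
  shows "\<bar>t\<bar> \<le> \<bar>x\<bar> \<and> 0 \<le> x * t"
  using assms by (cases "0 \<le> x") (auto simp: min_def max_def mult_nonpos_nonpos)

lemma ennreal_add_sq_le: "(a + b)\<^sup>2 \<le> 2 * a\<^sup>2 + 2 * (b::ennreal)\<^sup>2"
proof (cases a; cases b)
  fix r s assume rs: "a = ennreal r" "0 \<le> r" "b = ennreal s" "0 \<le> s"
  have "(r + s)\<^sup>2 \<le> 2 * r\<^sup>2 + 2 * s\<^sup>2"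
    using zero_le_power2[of "r - s"] by (simp add: power2_eq_square algebra_simps)
  then have "ennreal ((r + s)\<^sup>2) \<le> ennreal (2 * r\<^sup>2 + 2 * s\<^sup>2)" by (rule ennreal_leI)
  moreover have "(a + b)\<^sup>2 = ennreal ((r + s)\<^sup>2)"
    using rs by (simp add: ennreal_power flip: ennreal_plus)
  moreover have "2 * a\<^sup>2 + 2 * b\<^sup>2 = ennreal (2 * r\<^sup>2 + 2 * s\<^sup>2)"
    using rs by (simp add: ennreal_power ennreal_mult' ennreal_plus)
  ultimately show ?thesis by simp
qed (auto simp: ennreal_mult_top power2_eq_square)

text \<open>On the way from 0 to x the weight is smallest at x, so p(x)^j |f(x) - f(0)| is at most
  the kernel applied to p^(j+1) |f'|. The remaining term |f(0)| is a constant.\<close>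

lemma L2_antiderivative:
  assumes f: "f \<in> AC_loc" and m: "(\<lambda>x. leg_w x ^ Suc j * ddx f x) \<in> L2"
  shows "(\<lambda>x. leg_w x ^ j * f x) \<in> L2"
proof -
  define m where "m t = norm (leg_w t ^ Suc j * ddx f t)" for t
  define R where "R x = (\<integral>\<^sup>+t. ennreal (hardy_ker x t * m t) \<partial>leb_I)" for x
  have mm[measurable]: "m \<in> borel_measurable leb_I"
    unfolding m_def using L2_measurable[OF assms(2)] by measurable
  have [measurable]: "case_prod hardy_ker \<in> borel_measurable (leb_I \<Otimes>\<^sub>M leb_I)"
    by (rule hardy_ker_measurable)
  have Rm[measurable]: "R \<in> borel_measurable leb_I" unfolding R_def by measurable
  have pw: "ennreal (norm (leg_w x ^ j * f x)) \<le> ennreal (norm (f 0)) + R x" if x: "x \<in> I1" for x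
  proof -
    have px: "0 \<le> 1 - x\<^sup>2" "1 - x\<^sup>2 \<le> 1" using weight_pos[of x] x by auto
    have "norm (leg_w x ^ j * f x) = (1 - x\<^sup>2) ^ j * norm (f x)"
      using norm_leg_w[OF x] by (simp add: norm_mult norm_power)
    also have "\<dots> \<le> (1 - x\<^sup>2) ^ j * (norm (f 0) + norm (f x - f 0))"
      using px norm_triangle_ineq[of "f 0" "f x - f 0"] by (intro mult_left_mono) auto
    also have "\<dots> \<le> norm (f 0) + (1 - x\<^sup>2) ^ j * norm (f x - f 0)"
      using px power_le_one[OF px, of j] by (simp add: distrib_left mult_left_le_one_le)
    finally have "ennreal (norm (leg_w x ^ j * f x)) \<le> ennreal (norm (f 0)) + ennreal ((1 - x\<^sup>2) ^ j * norm (f x - f 0))"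
      using px by (simp add: ennreal_leI flip: ennreal_plus)
    also have "ennreal ((1 - x\<^sup>2) ^ j * norm (f x - f 0)) \<le> R x"
      unfolding R_def
    proof (rule AC_loc_scaled_increment_le[OF f])
      fix t assume t: "t \<in> I1" "min 0 x \<le> t" "t \<le> max 0 x"
      have tx: "\<bar>t\<bar> \<le> \<bar>x\<bar> \<and> 0 \<le> x * t" using between_zero[OF t(2,3)] .
      have p: "0 < 1 - t\<^sup>2" using weight_pos[OF t(1)] .
      have "hardy_ker x t * m t = 1 / (1 - t\<^sup>2) * ((1 - t\<^sup>2) ^ Suc j * norm (ddx f t))"
        using tx t(1) norm_leg_w[OF t(1)] by (auto simp: hardy_ker_def m_def norm_mult norm_power)
      also have "\<dots> = (1 - t\<^sup>2) ^ j * norm (ddx f t)" using p by simp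
      finally show "(1 - x\<^sup>2) ^ j * norm (ddx f t) \<le> hardy_ker x t * m t"
        using power_weight_mono[of t x j] tx x by (simp add: mult_right_mono)
    qed (use x px in auto)
    finally show ?thesis by simp
  qed
  show ?thesis
    unfolding L2_iff
  proof
    show "(\<lambda>x. leg_w x ^ j * f x) \<in> borel_measurable leb_I"
      using leg_w_measurable borel_measurable_AC_loc[OF f] by measurable
    have "(\<integral>\<^sup>+x. (ennreal (norm (leg_w x ^ j * f x)))\<^sup>2 \<partial>leb_I)
        \<le> (\<integral>\<^sup>+x. 2 * (ennreal (norm (f 0)))\<^sup>2 + 2 * (R x)\<^sup>2 \<partial>leb_I)"
    proof (rule nn_integral_mono)
      fix x assume "x \<in> space leb_I"
      then have "(ennreal (norm (leg_w x ^ j * f x)))\<^sup>2 \<le> (ennreal (norm (f 0)) + R x)\<^sup>2"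
        by (intro power_mono pw) auto
      also have "\<dots> \<le> 2 * (ennreal (norm (f 0)))\<^sup>2 + 2 * (R x)\<^sup>2" by (rule ennreal_add_sq_le)
      finally show "(ennreal (norm (leg_w x ^ j * f x)))\<^sup>2 \<le> 2 * (ennreal (norm (f 0)))\<^sup>2 + 2 * (R x)\<^sup>2" .
    qed
    also have "\<dots> = (\<integral>\<^sup>+x. 2 * (ennreal (norm (f 0)))\<^sup>2 \<partial>leb_I) + 2 * (\<integral>\<^sup>+x. (R x)\<^sup>2 \<partial>leb_I)"
      by (subst nn_integral_add; measurable?) (subst nn_integral_cmult; measurable?; simp)
    also have "\<dots> \<le> (\<integral>\<^sup>+x. 2 * (ennreal (norm (f 0)))\<^sup>2 \<partial>leb_I) + 2 * (4 * (\<integral>\<^sup>+t. (ennreal (m t))\<^sup>2 \<partial>leb_I))"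
      unfolding R_def by (intro add_left_mono mult_left_mono hardy_bounds(1) mm) (auto simp: m_def)
    also have "\<dots> < \<infinity>"
      using assms(2) measure_leb_I(2) unfolding L2_iff m_def[symmetric]
      by (simp add: ennreal_mult_less_top ennreal_power)
    finally show "(\<integral>\<^sup>+x. (ennreal (norm (leg_w x ^ j * f x)))\<^sup>2 \<partial>leb_I) < \<infinity>" .
  qed
qed

text \<open>Integrate from x to the endpoint on its side, where f vanishes; this is the transposed
  kernel. Of the factor 1 / p(x)^(j+1), one power is the kernel and the other j are at most 1 /
  p(t)^j since |x| \<le> |t|. The numerical bound is kept for the estimate of the Legendre
  polynomials.\<close>

lemma hardy_inequality:
  assumes f: "f \<in> AC_loc" and l: "lim0_at_ends f" and m: "(\<lambda>x. ddx f x / leg_w x ^ j) \<in> L2"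
  shows "(\<lambda>x. f x / leg_w x ^ Suc j) \<in> L2"
    and "(\<integral>\<^sup>+x. (ennreal (norm (f x / leg_w x ^ Suc j)))\<^sup>2 \<partial>leb_I)
      \<le> 4 * (\<integral>\<^sup>+x. (ennreal (norm (ddx f x / leg_w x ^ j)))\<^sup>2 \<partial>leb_I)"
proof -
  define m where "m t = norm (ddx f t / leg_w t ^ j)" for t
  define R where "R x = (\<integral>\<^sup>+t. ennreal (hardy_ker t x * m t) \<partial>leb_I)" for x
  have mm[measurable]: "m \<in> borel_measurable leb_I"
    unfolding m_def using L2_measurable[OF assms(3)] by measurable
  have pw: "ennreal (norm (f x / leg_w x ^ Suc j)) \<le> R x" if x: "x \<in> I1" for x
  proof -
    define c where "c = 1 / (1 - x\<^sup>2) ^ Suc j"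
    have px: "0 < 1 - x\<^sup>2" using weight_pos[of x] x by auto
    then have c: "c > 0" by (simp add: c_def)
    have nx: "norm (f x / leg_w x ^ Suc j) = c * norm (f x)"
      using norm_leg_w[OF x] by (simp add: norm_divide norm_mult norm_power c_def)
    have inc: "ennreal (c * norm (f y - f x)) \<le> R x" if y: "y \<in> I1" "0 \<le> x \<and> x \<le> y \<or> x \<le> 0 \<and> y \<le> x" for y
      unfolding R_def
    proof (rule AC_loc_scaled_increment_le[OF f])
      fix t assume t: "t \<in> I1" "min x y \<le> t" "t \<le> max x y"
      have tx: "\<bar>x\<bar> \<le> \<bar>t\<bar> \<and> 0 \<le> t * x"
        using t y(2) by (auto simp: min_def max_def mult_nonpos_nonpos split: if_splits)
      have p: "0 < 1 - t\<^sup>2" using weight_pos[OF t(1)] .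
      have "hardy_ker t x * m t = 1 / (1 - x\<^sup>2) * (norm (ddx f t) / (1 - t\<^sup>2) ^ j)"
        using tx x norm_leg_w[OF t(1)] by (auto simp: hardy_ker_def m_def norm_divide norm_power)
      moreover have "norm (ddx f t) / (1 - x\<^sup>2) ^ j \<le> norm (ddx f t) / (1 - t\<^sup>2) ^ j"
        using p px power_weight_mono[of x t j] tx t(1) by (intro divide_left_mono) auto
      then have "1 / (1 - x\<^sup>2) * (norm (ddx f t) / (1 - x\<^sup>2) ^ j) \<le> 1 / (1 - x\<^sup>2) * (norm (ddx f t) / (1 - t\<^sup>2) ^ j)"
        using px by (intro mult_left_mono) auto
      ultimately show "c * norm (ddx f t) \<le> hardy_ker t x * m t"
        by (simp add: c_def)
    qed (use x y c in auto)
    have "ennreal (c * norm (f x)) \<le> R x"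
    \<comment> \<open>The endpoint itself is avoided: it is replaced by a point y beyond x at which
      |f(y)| is small, at the cost of e.\<close>
    proof (rule ennreal_le_epsilon)
      fix e :: real assume "e > 0"
      then have ec: "e / c > 0" using c by simp
      have "\<exists>y. y \<in> I1 \<and> (0 \<le> x \<and> x \<le> y \<or> x \<le> 0 \<and> y \<le> x) \<and> norm (f y) < e / c"
      proof (cases "0 \<le> x")
        case True
        have "eventually (\<lambda>y. norm (f y) < e / c) (at_left 1)"
          using l tendstoD[of f 0 "at_left 1" "e / c"] ec unfolding lim0_at_ends_def dist_norm by simp
        moreover have "eventually (\<lambda>y. y \<in> {x<..<1}) (at_left 1)"
          using x by (intro eventually_at_left_real) auto
        ultimately have "eventually (\<lambda>y. norm (f y) < e / c \<and> y \<in> {x<..<1}) (at_left 1)"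
          by (rule eventually_conj)
        then obtain y where "norm (f y) < e / c" "y \<in> {x<..<1}"
          using eventually_happens'[OF trivial_limit_at_left_real] by blast
        then show ?thesis using True x by (intro exI[of _ y]) auto
      next
        case False
        have "eventually (\<lambda>y. norm (f y) < e / c) (at_right (-1))"
          using l tendstoD[of f 0 "at_right (-1)" "e / c"] ec unfolding lim0_at_ends_def dist_norm by simp
        moreover have "eventually (\<lambda>y. y \<in> {-1<..<x}) (at_right (-1))"
          using x by (intro eventually_at_right_real) auto
        ultimately have "eventually (\<lambda>y. norm (f y) < e / c \<and> y \<in> {-1<..<x}) (at_right (-1))"
          by (rule eventually_conj)
        then obtain y where "norm (f y) < e / c" "y \<in> {-1<..<x}"
          using eventually_happens'[OF trivial_limit_at_right_real] by blast
        then show ?thesis using False x by (intro exI[of _ y]) auto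
      qed
      then obtain y where y: "y \<in> I1" "0 \<le> x \<and> x \<le> y \<or> x \<le> 0 \<and> y \<le> x" "norm (f y) < e / c" by blast
      have "norm (f x) \<le> norm (f y - f x) + norm (f y)"
        using norm_triangle_ineq4[of "f y" "f y - f x"] by simp
      then have "c * norm (f x) \<le> c * (norm (f y - f x) + e / c)"
        using c y(3) by (intro mult_left_mono) auto
      also have "\<dots> = c * norm (f y - f x) + e" using c by (simp add: distrib_left)
      finally have "ennreal (c * norm (f x)) \<le> ennreal (c * norm (f y - f x)) + ennreal e"
        using c \<open>e > 0\<close> by (simp add: ennreal_leI flip: ennreal_plus)
      also have "\<dots> \<le> R x + ennreal e" by (intro add_right_mono inc y)
      finally show "ennreal (c * norm (f x)) \<le> R x + ennreal e" .
    qed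
    then show ?thesis unfolding nx .
  qed
  have "(\<integral>\<^sup>+x. (ennreal (norm (f x / leg_w x ^ Suc j)))\<^sup>2 \<partial>leb_I) \<le> (\<integral>\<^sup>+x. (R x)\<^sup>2 \<partial>leb_I)"
    by (intro nn_integral_mono power_mono pw) auto
  also have "\<dots> \<le> 4 * (\<integral>\<^sup>+t. (ennreal (m t))\<^sup>2 \<partial>leb_I)"
    unfolding R_def by (intro hardy_bounds(2) mm) (simp add: m_def)
  finally show le: "(\<integral>\<^sup>+x. (ennreal (norm (f x / leg_w x ^ Suc j)))\<^sup>2 \<partial>leb_I)
      \<le> 4 * (\<integral>\<^sup>+x. (ennreal (norm (ddx f x / leg_w x ^ j)))\<^sup>2 \<partial>leb_I)"
    unfolding m_def .
  show "(\<lambda>x. f x / leg_w x ^ Suc j) \<in> L2"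
    unfolding L2_iff
  proof
    show "(\<lambda>x. f x / leg_w x ^ Suc j) \<in> borel_measurable leb_I"
      using leg_w_measurable borel_measurable_AC_loc[OF f] by measurable
    have "4 * (\<integral>\<^sup>+x. (ennreal (norm (ddx f x / leg_w x ^ j)))\<^sup>2 \<partial>leb_I) < \<infinity>"
      using assms(3) unfolding L2_iff by (simp add: ennreal_mult_less_top)
    with le show "(\<integral>\<^sup>+x. (ennreal (norm (f x / leg_w x ^ Suc j)))\<^sup>2 \<partial>leb_I) < \<infinity>"
      by (rule le_less_trans)
  qed
qed

section \<open>Vanishing at the endpoints\<close>

lemma lim0_at_ends_iff:
  "lim0_at_ends h \<longleftrightarrow> (\<forall>e>0. \<exists>c. 0 < c \<and> c < 1 \<and> (\<forall>x\<in>I1. c < \<bar>x\<bar> \<longrightarrow> norm (h x) < e))"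
proof
  assume l: "lim0_at_ends h"
  show "\<forall>e>0. \<exists>c. 0 < c \<and> c < 1 \<and> (\<forall>x\<in>I1. c < \<bar>x\<bar> \<longrightarrow> norm (h x) < e)"
  proof (intro allI impI)
    fix e :: real assume "e > 0"
    then have "eventually (\<lambda>x. norm (h x) < e) (at_left 1)" "eventually (\<lambda>x. norm (h x) < e) (at_right (-1))"
      using l tendstoD[of h 0 "at_left 1" e] tendstoD[of h 0 "at_right (-1)" e]
      unfolding lim0_at_ends_def dist_norm by auto
    then obtain b1 b2 where b: "b1 < 1" "\<And>y. b1 < y \<Longrightarrow> y < 1 \<Longrightarrow> norm (h y) < e"
      "b2 > -1" "\<And>y. -1 < y \<Longrightarrow> y < b2 \<Longrightarrow> norm (h y) < e"
      unfolding eventually_at_left_field eventually_at_right_field by auto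
    \<comment> \<open>The 1/2 only ensures that c is positive.\<close>
    define c where "c = max (1/2) (max b1 (- b2))"
    have "0 < c" "c < 1" using b by (auto simp: c_def)
    moreover have "norm (h x) < e" if "x \<in> I1" "c < \<bar>x\<bar>" for x
      using that b(2)[of x] b(4)[of x] by (cases "0 \<le> x") (auto simp: c_def)
    ultimately show "\<exists>c. 0 < c \<and> c < 1 \<and> (\<forall>x\<in>I1. c < \<bar>x\<bar> \<longrightarrow> norm (h x) < e)" by blast
  qed
next
  assume R: "\<forall>e>0. \<exists>c. 0 < c \<and> c < 1 \<and> (\<forall>x\<in>I1. c < \<bar>x\<bar> \<longrightarrow> norm (h x) < e)"
  show "lim0_at_ends h"
    unfolding lim0_at_ends_def
  proof (intro conjI tendstoI)
    fix e :: real assume "e > 0"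
    then obtain c where c: "0 < c" "c < 1" "\<And>x. x \<in> I1 \<Longrightarrow> c < \<bar>x\<bar> \<Longrightarrow> norm (h x) < e"
      using R by blast
    show "eventually (\<lambda>x. dist (h x) 0 < e) (at_left 1)"
      unfolding eventually_at_left_field using c by (intro exI[of _ c]) auto
    show "eventually (\<lambda>x. dist (h x) 0 < e) (at_right (-1))"
      unfolding eventually_at_right_field using c by (intro exI[of _ "-c"]) auto
  qed
qed

lemma lim0_at_ends_cong: "\<lbrakk>lim0_at_ends f; \<And>x. x \<in> I1 \<Longrightarrow> g x = f x\<rbrakk> \<Longrightarrow> lim0_at_ends g"
  unfolding lim0_at_ends_iff by metis

lemma lim0_at_ends_add: "\<lbrakk>lim0_at_ends f; lim0_at_ends g\<rbrakk> \<Longrightarrow> lim0_at_ends (\<lambda>x. f x + g x)"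
  unfolding lim0_at_ends_def using tendsto_add[of f 0 _ g 0] by auto

lemma lim0_at_ends_cmult: "lim0_at_ends f \<Longrightarrow> lim0_at_ends (\<lambda>x. c * f x)"
  unfolding lim0_at_ends_def by (auto intro: tendsto_mult_right_zero)

lemma lim0_at_ends_uminus: "lim0_at_ends f \<Longrightarrow> lim0_at_ends (\<lambda>x. - f x)"
  using lim0_at_ends_cmult[of f "-1"] by simp

lemma lim0_at_ends_diff: "\<lbrakk>lim0_at_ends f; lim0_at_ends g\<rbrakk> \<Longrightarrow> lim0_at_ends (\<lambda>x. f x - g x)"
  using lim0_at_ends_add[OF _ lim0_at_ends_uminus, of f g] by simp

lemma lim0_at_ends_mult_cont:
  assumes "lim0_at_ends f" "continuous_on UNIV q"
  shows "lim0_at_ends (\<lambda>x. q x * f x)"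
proof -
  have c: "(q \<longlongrightarrow> q x) (at x within S)" for x S
    using assms(2) continuous_on_eq_continuous_at[of UNIV q]
    by (metis UNIV_I continuous_at_imp_continuous_within continuous_within open_UNIV)
  show ?thesis
    using assms(1) tendsto_mult[OF c] unfolding lim0_at_ends_def by (metis mult_zero_right)
qed

text \<open>Compare f(x) with f(s) at a fixed s near the same end. The weighted increment is bounded
  by a tail of the integral, and f(s) times the weight at x tends to 0 as x approaches the
  end.\<close>

lemma lim0_at_ends_weighted:
  assumes f: "f \<in> AC_loc" and k: "integrable leb_I (\<lambda>x. leg_w x ^ Suc j * ddx f x)"
  shows "lim0_at_ends (\<lambda>x. leg_w x ^ Suc j * f x)"
  unfolding lim0_at_ends_iff
proof (intro allI impI)
  fix e :: real assume "e > 0"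
  then have e2: "e / 2 > 0" by simp
  define k where "k t = leg_w t ^ Suc j * ddx f t" for t
  obtain c where c: "0 < c" "c < 1"
    and ck: "(\<integral>\<^sup>+t. ennreal (norm (k t)) * indicator {t. c < \<bar>t\<bar>} t \<partial>leb_I) < ennreal (e / 2)"
    using integrable_tail_small[OF k e2] unfolding k_def by blast
  \<comment> \<open>A base point strictly beyond c, so that the whole path from it towards the end
    lies in the tail region c < |t|.\<close>
  define c' where "c' = (c + 1) / 2"
  have c': "c < c'" "c' < 1" using c by (auto simp: c'_def)
  have bound: "norm (leg_w x ^ Suc j * f x) \<le> (1 - x\<^sup>2) ^ Suc j * norm (f s) + e / 2"
    if x: "x \<in> I1" "\<bar>s\<bar> = c'" "\<bar>s\<bar> \<le> \<bar>x\<bar>" "0 \<le> s * x" for x s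
  proof -
    have s: "s \<in> I1" using x c' by auto
    have px: "0 \<le> 1 - x\<^sup>2" using weight_pos[of x] x by auto
    have "ennreal ((1 - x\<^sup>2) ^ Suc j * norm (f x - f s))
        \<le> (\<integral>\<^sup>+t. ennreal (norm (k t) * indicator {t. c < \<bar>t\<bar>} t) \<partial>leb_I)"
    proof (rule AC_loc_scaled_increment_le[OF f s x(1)])
      fix t assume t: "t \<in> I1" "min s x \<le> t" "t \<le> max s x"
      have tx: "\<bar>t\<bar> \<le> \<bar>x\<bar>" "c < \<bar>t\<bar>"
        using t x c c' by (auto simp: zero_le_mult_iff min_def max_def split: if_splits)
      have "(1 - x\<^sup>2) ^ Suc j * norm (ddx f t) \<le> (1 - t\<^sup>2) ^ Suc j * norm (ddx f t)"
        by (intro mult_right_mono power_weight_mono tx x) simp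
      also have "\<dots> = norm (k t) * indicator {t. c < \<bar>t\<bar>} t"
        using tx norm_leg_w[OF t(1)] by (simp add: k_def norm_mult norm_power)
      finally show "(1 - x\<^sup>2) ^ Suc j * norm (ddx f t) \<le> norm (k t) * indicator {t. c < \<bar>t\<bar>} t" .
    qed (use px in simp)
    also have "\<dots> = (\<integral>\<^sup>+t. ennreal (norm (k t)) * indicator {t. c < \<bar>t\<bar>} t \<partial>leb_I)"
      by (intro nn_integral_cong) (auto simp: indicator_def)
    also have "\<dots> < ennreal (e / 2)" by (rule ck)
    finally have inc: "(1 - x\<^sup>2) ^ Suc j * norm (f x - f s) < e / 2"
      using px by (simp add: ennreal_less_iff)
    have "norm (leg_w x ^ Suc j * f x) = (1 - x\<^sup>2) ^ Suc j * norm (f x)"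
      using norm_leg_w[OF x(1)] by (simp add: norm_mult norm_power)
    also have "\<dots> \<le> (1 - x\<^sup>2) ^ Suc j * (norm (f s) + norm (f x - f s))"
      using px norm_triangle_ineq[of "f s" "f x - f s"] by (intro mult_left_mono) auto
    also have "\<dots> = (1 - x\<^sup>2) ^ Suc j * norm (f s) + (1 - x\<^sup>2) ^ Suc j * norm (f x - f s)"
      by (rule distrib_left)
    finally show ?thesis using inc by linarith
  qed
  define M where "M = norm (f c') + norm (f (- c')) + 1"
  have M: "M > 0" unfolding M_def using norm_ge_zero[of "f c'"] norm_ge_zero[of "f (- c')"] by linarith
  \<comment> \<open>Beyond d one has 1 - x^2 \<le> 2 (1 - |x|) < e / (2 M), which makes the term
    with f(s) smaller than e / 2.\<close>
  define d where "d = max c' (1 - e / (4 * M))"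
  have d: "0 < d" "d < 1" using c' c M \<open>e > 0\<close> by (auto simp: d_def)
  moreover have "norm (leg_w x ^ Suc j * f x) < e" if x: "x \<in> I1" "d < \<bar>x\<bar>" for x
  proof -
    have px: "0 \<le> 1 - x\<^sup>2" "1 - x\<^sup>2 \<le> 1" using weight_pos[of x] x by auto
    define s where "s = (if 0 \<le> x then c' else - c')"
    have "norm (leg_w x ^ Suc j * f x) \<le> (1 - x\<^sup>2) ^ Suc j * norm (f s) + e / 2"
      using x c c' by (intro bound) (auto simp: s_def d_def intro: mult_nonneg_nonpos)
    also have "(1 - x\<^sup>2) ^ Suc j * norm (f s) \<le> (1 - x\<^sup>2) ^ Suc j * M"
      using px by (intro mult_left_mono) (auto simp: s_def M_def)
    also have "(1 - x\<^sup>2) ^ Suc j * M \<le> (1 - x\<^sup>2) * M"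
      using px M power_le_one[OF px, of j] by (intro mult_right_mono) (auto simp: mult_left_le)
    also have "(1 - x\<^sup>2) * M < e / 2"
    proof -
      have "1 - x\<^sup>2 = (1 - \<bar>x\<bar>) * (1 + \<bar>x\<bar>)" by (simp add: algebra_simps power2_eq_square)
      also have "\<dots> \<le> (1 - \<bar>x\<bar>) * 2" using x by (intro mult_left_mono) auto
      also have "\<dots> < e / (4 * M) * 2" using x by (auto simp: d_def)
      finally have "(1 - x\<^sup>2) * M < e / (4 * M) * 2 * M" using M by (rule mult_strict_right_mono)
      then show ?thesis using M by simp
    qed
    finally show ?thesis by simp
  qed
  ultimately show "\<exists>c. 0 < c \<and> c < 1 \<and> (\<forall>x\<in>I1. c < \<bar>x\<bar> \<longrightarrow> norm (leg_w x ^ Suc j * f x) < e)" by blast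
qed

subsection \<open>Boundary conditions and the domain of the square\<close>

lemma funpow_ddx:
  "(ddx ^^ 2) f = ddx (ddx f)" "(ddx ^^ 3) f = ddx (ddx (ddx f))" "(ddx ^^ 4) f = ddx (ddx (ddx (ddx f)))"
  by (simp_all add: eval_nat_numeral)

lemma AC_loc_upto_1:
  "f \<in> AC_loc_upto 1 \<longleftrightarrow> f \<in> AC_loc \<and> ddx f \<in> AC_loc \<and> (\<forall>x\<in>I1. f differentiable (at x))"
proof -
  have "j \<le> 1 \<longleftrightarrow> j = 0 \<or> j = 1" "j < 1 \<longleftrightarrow> j = 0" for j :: nat by auto
  then show ?thesis unfolding AC_loc_upto_def by auto
qed

lemma AC_loc_upto_3:
  "f \<in> AC_loc_upto 3 \<longleftrightarrow> f \<in> AC_loc \<and> ddx f \<in> AC_loc \<and> ddx (ddx f) \<in> AC_loc \<and> ddx (ddx (ddx f)) \<in> AC_loc \<and>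
     (\<forall>x\<in>I1. f differentiable (at x) \<and> ddx f differentiable (at x) \<and> ddx (ddx f) differentiable (at x))"
proof -
  have 1: "j \<le> 3 \<longleftrightarrow> j = 0 \<or> j = 1 \<or> j = 2 \<or> j = 3" "j < 3 \<longleftrightarrow> j = 0 \<or> j = 1 \<or> j = 2" for j :: nat
    by auto
  show ?thesis unfolding AC_loc_upto_def mem_Collect_eq 1
    by (simp add: funpow_ddx all_conj_distrib ball_conj_distrib imp_conjR disj_imp) (auto simp: funpow_ddx)
qed

lemma hvd_leg_w_mult:
  assumes "(f has_vector_derivative D) (at x)"
  shows "((\<lambda>t. leg_w t * f t) has_vector_derivative leg_w x * D - 2 * of_real x * f x) (at x)"
  using has_vector_derivative_mult[OF leg_w_has_derivative assms] by simp

lemma hvd_of_real_mult: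
  fixes f :: "real \<Rightarrow> complex"
  assumes "(f has_vector_derivative D) (at x)"
  shows "((\<lambda>t. of_real t * f t) has_vector_derivative f x + of_real x * D) (at x)"
  using has_vector_derivative_mult[OF of_real_has_derivative assms] by (simp add: add.commute)

lemma hvd_cmult:
  fixes c :: complex
  assumes "(f has_vector_derivative D) (at x)"
  shows "((\<lambda>t. c * f t) has_vector_derivative c * D) (at x)"
  using has_vector_derivative_mult[OF has_vector_derivative_const[of c] assms] by simp

text \<open>The set where two continuous functions differ is open, and a nonempty open set is not
  negligible.\<close>

lemma continuous_AE_eq:
  fixes f g :: "real \<Rightarrow> complex"
  assumes f: "continuous_on I1 f" and g: "continuous_on I1 g" and ae: "AE x in leb_I. f x = g x" and x: "x \<in> I1"
  shows "f x = g x"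
proof (rule ccontr)
  assume ne: "f x \<noteq> g x"
  obtain N where N: "negligible N" "\<And>x. x \<in> I1 - N \<Longrightarrow> f x = g x" using ae unfolding AE_leb_I_iff by blast
  have "open (I1 \<inter> (\<lambda>x. f x - g x) -` (- {0}))"
    by (rule continuous_open_preimage) (auto intro!: continuous_on_diff f g)
  moreover have "I1 \<inter> (\<lambda>x. f x - g x) -` (- {0}) \<subseteq> N" using N(2) by auto
  ultimately have "I1 \<inter> (\<lambda>x. f x - g x) -` (- {0}) = {}"
    using open_not_negligible negligible_subset[OF N(1)] by blast
  then show False using x ne by auto
qed

text \<open>A gain of regularity: \<open>F\<close> is locally the integral of the continuous
  function \<open>h\<close>, so it is differentiable at every point and not just almost
  everywhere.\<close>

lemma has_derivative_of_continuous_ddx: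
  assumes F: "F \<in> AC_loc" and h: "continuous_on I1 h" and ae: "AE x in leb_I. ddx F x = h x" and x: "x \<in> I1"
  shows "(F has_vector_derivative h x) (at x)"
proof -
  obtain N where N: "negligible N" "\<And>x. x \<in> I1 - N \<Longrightarrow> ddx F x = h x" using ae unfolding AE_leb_I_iff by blast
  have x1: "-1 < x" "x < 1" using x by auto
  define a b where "a = (x - 1) / 2" and "b = (x + 1) / 2"
  have ab: "-1 < a" "a < x" "x < b" "b < 1" "a \<le> b" using x1 by (auto simp: a_def b_def)
  have hc: "continuous_on {a..b} h" by (rule continuous_on_subset[OF h]) (use ab in auto)
  have eq: "F t = F a + integral {a..t} h" if "t \<in> {a..b}" for t
  proof -
    have t: "a \<le> t" "t < 1" using that ab by auto
    have "(h has_integral (F t - F a)) {a..t}"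
      by (rule has_integral_spike[OF N(1) _ AC_loc_FTC(2)[OF F ab(1) t]]) (use N(2) ab t in auto)
    then show ?thesis by (simp add: integral_unique)
  qed
  have "((\<lambda>t. integral {a..t} h) has_vector_derivative h x) (at x within {a..b})"
    by (rule integral_has_vector_derivative[OF hc]) (use ab in auto)
  then have "((\<lambda>t. F a + integral {a..t} h) has_vector_derivative 0 + h x) (at x within {a..b})"
    by (intro has_vector_derivative_add has_vector_derivative_const)
  then have d: "((\<lambda>t. F a + integral {a..t} h) has_vector_derivative h x) (at x within {a..b})" by simp
  have xab: "x \<in> {a..b}" using ab by simp
  have "(F has_vector_derivative h x) (at x within {a..b})"
    by (rule has_vector_derivative_transform[OF xab _ d]) (rule eq)
  then show ?thesis unfolding at_within_Icc_at[OF ab(2,3)] .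
qed

lemma inverse_weight_has_derivative:
  assumes "x \<in> I1"
  shows "((\<lambda>x. inverse (leg_w x)) has_vector_derivative 2 * of_real x * inverse (leg_w x) * inverse (leg_w x)) (at x)"
proof -
  have d: "((\<lambda>x. inverse (1 - x\<^sup>2)) has_real_derivative 2 * x * inverse (1 - x\<^sup>2) * inverse (1 - x\<^sup>2)) (at x)"
    using weight_pos[OF assms] by (auto intro!: derivative_eq_intros)
  have "inverse (leg_w x) = complex_of_real (inverse (1 - x\<^sup>2))" for x by (simp add: leg_w_def)
  then show ?thesis using has_vector_derivative_of_real[OF d, where 'a=complex] by simp
qed

lemma AC_loc_inverse_weight: "(\<lambda>x. inverse (leg_w x)) \<in> AC_loc"
  by (rule C1_AC_loc[OF inverse_weight_has_derivative])
     (auto intro!: continuous_intros continuous_leg_w simp: leg_w_nonzero)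

text \<open>The expansion of - (p f')' by the product rule. It is a pointwise formula in the
  derivatives of f, so the rules of differentiation apply to it directly.\<close>

definition leg_expr3 :: "(real \<Rightarrow> complex) \<Rightarrow> real \<Rightarrow> complex" where
  "leg_expr3 f x = 2 * (of_real x * ddx f x) - leg_w x * ddx (ddx f) x"

text \<open>The second Hardy inequality with j = 0 for F = p h': here F' = - l[h] and F / p = h'.
  The first one then passes from h' to h.\<close>

lemma legendre_energy:
  assumes h: "ddx h \<in> AC_loc" and l: "lim0_at_ends (\<lambda>x. leg_w x * ddx h x)" and L: "legendre_expr h \<in> L2"
  shows "ddx h \<in> L2"
    and "(\<integral>\<^sup>+x. (ennreal (norm (ddx h x)))\<^sup>2 \<partial>leb_I) \<le> 4 * (\<integral>\<^sup>+x. (ennreal (norm (legendre_expr h x)))\<^sup>2 \<partial>leb_I)"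
    and "h \<in> AC_loc \<Longrightarrow> h \<in> L2"
proof -
  let ?F = "\<lambda>x. leg_w x * ddx h x"
  have F: "?F \<in> AC_loc" by (rule AC_loc_mult[OF AC_loc_leg_w h])
  have d: "ddx ?F = (\<lambda>x. - legendre_expr h x)" by (simp add: legendre_expr_def fun_eq_iff)
  have m: "(\<lambda>x. ddx ?F x / leg_w x ^ 0) \<in> L2" unfolding d using L2_uminus[OF L] by simp
  have eq: "?F x / leg_w x ^ Suc 0 = ddx h x" if "x \<in> I1" for x
    using leg_w_nonzero[OF that] by simp
  show 1: "ddx h \<in> L2"
    by (rule L2_cong[OF hardy_inequality(1)[OF F l m]]) (rule eq[symmetric])
  have "(\<integral>\<^sup>+x. (ennreal (norm (?F x / leg_w x ^ Suc 0)))\<^sup>2 \<partial>leb_I) = (\<integral>\<^sup>+x. (ennreal (norm (ddx h x)))\<^sup>2 \<partial>leb_I)"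
  proof (rule nn_integral_cong)
    fix x assume "x \<in> space leb_I"
    then have "x \<in> I1" by simp
    then show "(ennreal (norm (?F x / leg_w x ^ Suc 0)))\<^sup>2 = (ennreal (norm (ddx h x)))\<^sup>2" by (simp only: eq)
  qed
  then show "(\<integral>\<^sup>+x. (ennreal (norm (ddx h x)))\<^sup>2 \<partial>leb_I) \<le> 4 * (\<integral>\<^sup>+x. (ennreal (norm (legendre_expr h x)))\<^sup>2 \<partial>leb_I)"
    using hardy_inequality(2)[OF F l m] unfolding d by simp
  show "h \<in> L2" if "h \<in> AC_loc"
    using L2_antiderivative[OF that, of 0] L2_leg_w_mult[OF 1] by simp
qed

text \<open>A bootstrap: h is continuous, so p f' is differentiable with derivative - h everywhere.
  Dividing by p gives f'' in terms of h and p f', and since h itself has an absolutely continuous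
  derivative, one more differentiation gives f'''.\<close>

lemma dom_T_imp_AC_loc_upto_3:
  assumes "f \<in> dom_T"
  shows "f \<in> AC_loc_upto 3"
proof -
  obtain h where f: "f \<in> dom_A" and h: "h \<in> dom_A" and ae: "AE x in leb_I. legendre_expr f x = h x"
    using assms unfolding dom_T_def ae_eq_def by blast
  have f1: "f \<in> AC_loc" "ddx f \<in> AC_loc" "\<And>x. x \<in> I1 \<Longrightarrow> f differentiable (at x)"
    and h1: "h \<in> AC_loc" "ddx h \<in> AC_loc" "\<And>x. x \<in> I1 \<Longrightarrow> h differentiable (at x)"
    using f h unfolding dom_A_def AC_loc_upto_1 by auto
  let ?F = "\<lambda>x. leg_w x * ddx f x"
  let ?w = "\<lambda>x. inverse (leg_w x)"
  have F: "?F \<in> AC_loc" by (rule AC_loc_mult[OF AC_loc_leg_w f1(2)])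
  have "AE x in leb_I. ddx ?F x = - h x"
    using ae by eventually_elim (simp add: legendre_expr_def minus_equation_iff[of "ddx _ _"])
  then have dF: "(?F has_vector_derivative - h x) (at x)" if "x \<in> I1" for x
    using that by (intro has_derivative_of_continuous_ddx[OF F] continuous_on_minus AC_loc_continuous_on h1)
  have fF: "ddx f x = ?w x * ?F x" if "x \<in> I1" for x using leg_w_nonzero[OF that] by simp
  have tr: "(k has_vector_derivative D) (at x)"
    if "(k' has_vector_derivative D) (at x)" "\<And>y. y \<in> I1 \<Longrightarrow> k y = k' y" "x \<in> I1" for k k' :: "real \<Rightarrow> complex" and D x
    using has_vector_derivative_transform_within_open[OF that(1) _ that(3), of k] that(2) by simp
  define k2 where "k2 x = ?w x * (- h x) + 2 * of_real x * ?w x * ?w x * ?F x" for x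
  have d1: "(ddx f has_vector_derivative k2 x) (at x)" if x: "x \<in> I1" for x
    unfolding k2_def
    by (rule tr[OF has_vector_derivative_mult[OF inverse_weight_has_derivative[OF x] dF[OF x]] fF x])
  have d1': "ddx (ddx f) x = k2 x" if "x \<in> I1" for x by (rule ddx_eqI[OF d1[OF that]])
  have k2: "k2 \<in> AC_loc"
    unfolding k2_def by (intro AC_loc_add AC_loc_mult AC_loc_uminus AC_loc_inverse_weight AC_loc_of_real AC_loc_const h1 F AC_loc_leg_w f1)
  have hd: "(h has_vector_derivative ddx h x) (at x)" if "x \<in> I1" for x
    by (rule differentiable_has_ddx[OF h1(3)[OF that]])
  \<comment> \<open>Written exactly as the derivative rules produce it from
    \<open>k2\<close>.\<close>
  define k3 where "k3 x = ?w x * (- ddx h x) + 2 * of_real x * ?w x * ?w x * (- h x) +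
     (2 * of_real x * ?w x * ?w x * (- h x) +
      (2 * of_real x * ?w x * (2 * of_real x * ?w x * ?w x) +
       (2 * of_real x * (2 * of_real x * ?w x * ?w x) + 2 * 1 * ?w x) * ?w x) * ?F x)" for x
  have d2: "(k2 has_vector_derivative k3 x) (at x)" if x: "x \<in> I1" for x
    unfolding k2_def k3_def
    by (intro has_vector_derivative_add has_vector_derivative_mult has_vector_derivative_minus hvd_cmult
        inverse_weight_has_derivative[OF x] dF[OF x] hd[OF x] of_real_has_derivative)
  have k3: "k3 \<in> AC_loc"
    unfolding k3_def by (intro AC_loc_add AC_loc_mult AC_loc_uminus AC_loc_inverse_weight AC_loc_of_real AC_loc_const h1 F AC_loc_leg_w f1)
  have d2': "(ddx (ddx f) has_vector_derivative k3 x) (at x)" if x: "x \<in> I1" for x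
    by (rule tr[OF d2[OF x] d1' x])
  have d3: "ddx (ddx (ddx f)) x = k3 x" if "x \<in> I1" for x by (rule ddx_eqI[OF d2'[OF that]])
  have "\<forall>x\<in>I1. f differentiable (at x) \<and> ddx f differentiable (at x) \<and> ddx (ddx f) differentiable (at x)"
    by (intro ballI conjI f1(3) differentiableI_vector[OF d1] differentiableI_vector[OF d2'])
  then show ?thesis
    unfolding AC_loc_upto_3 using f1(1,2) AC_loc_cong[OF k2 d1'] AC_loc_cong[OF k3 d3] by blast
qed

lemma ddx_const: "ddx (\<lambda>x. c) = (\<lambda>x. 0)"
  by (rule ext, rule ddx_eqI) (rule has_vector_derivative_const)

lemma ddx_of_real: "ddx (\<lambda>x. complex_of_real x) = (\<lambda>x. 1)"
  by (rule ext, rule ddx_eqI) (rule of_real_has_derivative)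

lemma lim0_weighted_L2:
  assumes "h \<in> AC_loc" "(\<lambda>x. leg_w x ^ Suc j * ddx h x) \<in> L2"
  shows "lim0_at_ends (\<lambda>x. leg_w x ^ Suc j * h x)"
  by (rule lim0_at_ends_weighted[OF assms(1) L2_integrable[OF assms(2)]])

lemma lim0_of_real_mult: "lim0_at_ends h \<Longrightarrow> lim0_at_ends (\<lambda>x. of_real x * h x)"
  by (rule lim0_at_ends_mult_cont) (auto intro!: continuous_intros)

section \<open>Characterisations of the domain for functions with three derivatives\<close>

locale ac3 =
  fixes f :: "real \<Rightarrow> complex"
  assumes f3: "f \<in> AC_loc_upto 3"
begin

abbreviation "f1 \<equiv> ddx f"
abbreviation "f2 \<equiv> ddx f1"
abbreviation "f3 \<equiv> ddx f2"
abbreviation "f4 \<equiv> ddx f3"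
abbreviation "g \<equiv> leg_expr3 f"

lemma AC: "f \<in> AC_loc" "f1 \<in> AC_loc" "f2 \<in> AC_loc" "f3 \<in> AC_loc"
  using f3 unfolding AC_loc_upto_3 by auto

lemma hd: assumes "x \<in> I1"
  shows "(f has_vector_derivative f1 x) (at x)" "(f1 has_vector_derivative f2 x) (at x)"
    "(f2 has_vector_derivative f3 x) (at x)"
  using f3 assms unfolding AC_loc_upto_3 by (auto intro: differentiable_has_ddx)

lemma g_AC: "g \<in> AC_loc"
  unfolding leg_expr3_def[abs_def]
  by (intro AC_loc_diff AC_loc_mult AC_loc_of_real AC_loc_leg_w AC_loc_const AC)

lemma wf1: "x \<in> I1 \<Longrightarrow> ((\<lambda>t. leg_w t * f1 t) has_vector_derivative - g x) (at x)"
  using hvd_leg_w_mult[OF hd(2)] by (simp add: leg_expr3_def algebra_simps)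

lemma legendre_expr_eq: "x \<in> I1 \<Longrightarrow> legendre_expr f x = g x"
  unfolding legendre_expr_def using ddx_eqI[OF wf1] by simp

lemma g_derivative:
  assumes x: "x \<in> I1"
  shows "(g has_vector_derivative 2 * f1 x + 4 * of_real x * f2 x - leg_w x * f3 x) (at x)"
proof -
  have "(g has_vector_derivative 2 * (f1 x + of_real x * f2 x) - (leg_w x * f3 x - 2 * of_real x * f2 x)) (at x)"
    unfolding leg_expr3_def[abs_def]
    by (intro has_vector_derivative_diff hvd_cmult hvd_of_real_mult hvd_leg_w_mult hd x)
  then show ?thesis by (simp add: algebra_simps)
qed

lemma ddx_g: "x \<in> I1 \<Longrightarrow> ddx g x = 2 * f1 x + 4 * of_real x * f2 x - leg_w x * f3 x"
  by (rule ddx_eqI[OF g_derivative])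

lemma ddx_g_AC: "ddx g \<in> AC_loc"
  by (rule AC_loc_cong[OF _ ddx_g])
     (intro AC_loc_diff AC_loc_add AC_loc_mult AC_loc_of_real AC_loc_leg_w AC_loc_const AC)

lemma w2f2: assumes x: "x \<in> I1"
  shows "((\<lambda>t. (leg_w t)\<^sup>2 * f2 t) has_vector_derivative (leg_w x)\<^sup>2 * f3 x - 4 * of_real x * leg_w x * f2 x) (at x)"
proof -
  have "((\<lambda>t. leg_w t * (leg_w t * f2 t)) has_vector_derivative
      leg_w x * (leg_w x * f3 x - 2 * of_real x * f2 x) - 2 * of_real x * (leg_w x * f2 x)) (at x)"
    by (intro hvd_leg_w_mult hd x)
  then show ?thesis by (simp add: power2_eq_square algebra_simps)
qed

lemma ddx_w2f2: assumes x: "x \<in> I1"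
  shows "ddx (\<lambda>t. (leg_w t)\<^sup>2 * f2 t) x = 2 * (leg_w x * f1 x) - leg_w x * ddx g x"
  unfolding ddx_eqI[OF w2f2[OF x]] ddx_g[OF x] by (simp add: algebra_simps power2_eq_square)

lemma wdg_AC: "(\<lambda>x. leg_w x * ddx g x) \<in> AC_loc"
  by (rule AC_loc_mult[OF AC_loc_leg_w ddx_g_AC])

text \<open>Differentiate (p^2 f'')' = 2 p f' - p g' and subtract 2 (p f')'. This holds only almost
  everywhere, because p g' is merely absolutely continuous.\<close>

lemma legendre_sq_eq_AE: "AE x in leb_I. legendre_sq_expr f x = legendre_expr g x"
  using AC_loc_has_derivative[OF wdg_AC] AE_space[of leb_I]
proof eventually_elim
  case (elim x)
  then have x: "x \<in> I1" by simp
  have "((\<lambda>t. 2 * (leg_w t * f1 t) - leg_w t * ddx g t) has_vector_derivative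
      2 * (- g x) - ddx (\<lambda>t. leg_w t * ddx g t) x) (at x)"
    by (intro has_vector_derivative_diff hvd_cmult wf1[OF x] elim)
  then have "ddx (\<lambda>t. 2 * (leg_w t * f1 t) - leg_w t * ddx g t) x = 2 * (- g x) - ddx (\<lambda>t. leg_w t * ddx g t) x"
    by (rule ddx_eqI)
  moreover have "ddx (ddx (\<lambda>t. (leg_w t)\<^sup>2 * f2 t)) x = ddx (\<lambda>t. 2 * (leg_w t * f1 t) - leg_w t * ddx g t) x"
    by (rule ddx_cong[OF x ddx_w2f2])
  ultimately have "ddx (ddx (\<lambda>t. (leg_w t)\<^sup>2 * f2 t)) x = 2 * (- g x) - ddx (\<lambda>t. leg_w t * ddx g t) x"
    by simp
  then show ?case
    unfolding legendre_sq_expr_def legendre_expr_def funpow_ddx using ddx_eqI[OF wf1[OF x]] by simp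
qed

text \<open>Bounded coefficients times p^2 f'''', p f''', f'' and f', the functions that are
  estimated one by one for (ii). The coefficient of f'' is 8 x^2 - 6 p = 14 x^2 - 6.\<close>

lemma legendre_sq_expand_AE:
  "AE x in leb_I. legendre_sq_expr f x = (leg_w x)\<^sup>2 * f4 x - 8 * (of_real x * (leg_w x * f3 x)) +
     (14 * (of_real x * (of_real x * f2 x)) - 6 * f2 x) + 4 * (of_real x * f1 x)"
  using AC_loc_has_derivative[OF AC(4)] AE_space[of leb_I] legendre_sq_eq_AE
proof eventually_elim
  case (elim x)
  then have x: "x \<in> I1" by simp
  have "((\<lambda>t. leg_w t * (2 * f1 t + 4 * (of_real t * f2 t) - leg_w t * f3 t)) has_vector_derivative
      leg_w x * (2 * f2 x + 4 * (f2 x + of_real x * f3 x) - (leg_w x * f4 x - 2 * of_real x * f3 x))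
      - 2 * of_real x * (2 * f1 x + 4 * (of_real x * f2 x) - leg_w x * f3 x)) (at x)"
    by (intro hvd_leg_w_mult has_vector_derivative_add has_vector_derivative_diff hvd_cmult hvd_of_real_mult hd x elim)
  then have "ddx (\<lambda>t. leg_w t * (2 * f1 t + 4 * (of_real t * f2 t) - leg_w t * f3 t)) x =
      leg_w x * (2 * f2 x + 4 * (f2 x + of_real x * f3 x) - (leg_w x * f4 x - 2 * of_real x * f3 x))
      - 2 * of_real x * (2 * f1 x + 4 * (of_real x * f2 x) - leg_w x * f3 x)" by (rule ddx_eqI)
  moreover have "ddx (\<lambda>t. leg_w t * ddx g t) x = ddx (\<lambda>t. leg_w t * (2 * f1 t + 4 * (of_real t * f2 t) - leg_w t * f3 t)) x"
    by (rule ddx_cong[OF x]) (simp add: ddx_g mult.assoc)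
  ultimately have eq: "legendre_sq_expr f x = - (leg_w x * (2 * f2 x + 4 * (f2 x + of_real x * f3 x) - (leg_w x * f4 x - 2 * of_real x * f3 x))
      - 2 * of_real x * (2 * f1 x + 4 * (of_real x * f2 x) - leg_w x * f3 x))"
    using elim unfolding legendre_expr_def[of g] by simp
  have lw: "leg_w x = 1 - of_real x * of_real x" by (simp add: leg_w_def power2_eq_square)
  show ?case unfolding eq lw by (simp add: algebra_simps power2_eq_square)
qed

text \<open>The witness in \<open>dom_T\<close> equals l[f] only almost everywhere, but it and g are
  continuous, so they coincide on (-1,1) and the witness may be taken to be g. The other
  characterisations are derived from this one.\<close>

lemma dom_T_iff:
  "f \<in> dom_T \<longleftrightarrow> f \<in> L2 \<and> g \<in> L2 \<and> lim0_at_ends (\<lambda>x. leg_w x * f1 x) \<and>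
     legendre_sq_expr f \<in> L2 \<and> lim0_at_ends (\<lambda>x. leg_w x * ddx g x)"
proof
  assume "f \<in> dom_T"
  then obtain h where f: "f \<in> dom_A" and h: "h \<in> dom_A" and ae: "AE x in leb_I. legendre_expr f x = h x"
    unfolding dom_T_def ae_eq_def by blast
  have h1: "h \<in> AC_loc" "h \<in> L2" "legendre_expr h \<in> L2" "lim0_at_ends (\<lambda>x. leg_w x * ddx h x)"
    using h unfolding dom_A_def AC_loc_upto_1 by auto
  have gh: "g x = h x" if "x \<in> I1" for x
  proof (rule continuous_AE_eq[OF _ _ _ that])
    show "continuous_on I1 g" "continuous_on I1 h" by (intro AC_loc_continuous_on g_AC h1)+
    show "AE x in leb_I. g x = h x"
      using ae AE_space by eventually_elim (simp add: legendre_expr_eq)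
  qed
  have dgh: "ddx g x = ddx h x" if "x \<in> I1" for x by (rule ddx_cong[OF that gh])
  have "legendre_expr g x = legendre_expr h x" if "x \<in> I1" for x
    unfolding legendre_expr_def by (subst ddx_cong[OF that, of _ "\<lambda>t. leg_w t * ddx h t"]) (auto simp: dgh)
  then have "legendre_expr g \<in> L2" using L2_cong[OF h1(3)] by blast
  moreover have "AE x in leb_I. legendre_expr g x = legendre_sq_expr f x"
    using legendre_sq_eq_AE by eventually_elim simp
  ultimately have "legendre_sq_expr f \<in> L2" by (rule L2_cong_AE)
  moreover have "g \<in> L2" using L2_cong[OF h1(2)] gh by blast
  moreover have "lim0_at_ends (\<lambda>x. leg_w x * ddx g x)"
    by (rule lim0_at_ends_cong[OF h1(4)]) (simp add: dgh)
  ultimately show "f \<in> L2 \<and> g \<in> L2 \<and> lim0_at_ends (\<lambda>x. leg_w x * f1 x) \<and>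
     legendre_sq_expr f \<in> L2 \<and> lim0_at_ends (\<lambda>x. leg_w x * ddx g x)"
    using f unfolding dom_A_def by auto
next
  assume R: "f \<in> L2 \<and> g \<in> L2 \<and> lim0_at_ends (\<lambda>x. leg_w x * f1 x) \<and>
     legendre_sq_expr f \<in> L2 \<and> lim0_at_ends (\<lambda>x. leg_w x * ddx g x)"
  have fA: "f \<in> dom_A"
    using R f3 L2_cong[of g "legendre_expr f"] legendre_expr_eq
    unfolding dom_A_def AC_loc_upto_1 AC_loc_upto_3 by auto
  have "legendre_expr g \<in> L2" using R L2_cong_AE[OF _ legendre_sq_eq_AE] by blast
  moreover have "\<forall>x\<in>I1. g differentiable (at x)"
    by (intro ballI differentiableI_vector[OF g_derivative])
  ultimately have "g \<in> dom_A"
    using R g_AC ddx_g_AC unfolding dom_A_def AC_loc_upto_1 by blast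
  moreover have "ae_eq (legendre_expr f) g"
    unfolding ae_eq_def using legendre_expr_eq by (intro AE_I2) simp
  ultimately show "f \<in> dom_T" using fA unfolding dom_T_def by blast
qed

lemma legendre_expr_g_L2: "legendre_sq_expr f \<in> L2 \<Longrightarrow> legendre_expr g \<in> L2"
  by (rule L2_cong_AE[OF _ legendre_sq_eq_AE])

text \<open>By (p^2 f'')' = 2 p f' - p g' the two pairs of boundary conditions are equivalent. What
  (iv) does not contain is that g is square integrable; this follows from the vanishing of p g' and
  the integrability of l[g].\<close>

lemma dom_T_iff_iv:
  "f \<in> dom_T \<longleftrightarrow> f \<in> Delta2_max \<and> lim0_at_ends (\<lambda>x. leg_w x * f1 x) \<and>
     lim0_at_ends (ddx (\<lambda>t. (leg_w t)\<^sup>2 * f2 t))"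
proof
  assume "f \<in> dom_T"
  then have R: "f \<in> L2" "g \<in> L2" "lim0_at_ends (\<lambda>x. leg_w x * f1 x)"
     "legendre_sq_expr f \<in> L2" "lim0_at_ends (\<lambda>x. leg_w x * ddx g x)" unfolding dom_T_iff by auto
  have "lim0_at_ends (ddx (\<lambda>t. (leg_w t)\<^sup>2 * f2 t))"
    by (rule lim0_at_ends_cong[OF lim0_at_ends_diff[OF lim0_at_ends_cmult[OF R(3)] R(5)] ddx_w2f2])
  with R f3 show "f \<in> Delta2_max \<and> lim0_at_ends (\<lambda>x. leg_w x * f1 x) \<and>
     lim0_at_ends (ddx (\<lambda>t. (leg_w t)\<^sup>2 * f2 t))" unfolding Delta2_max_def by auto
next
  assume "f \<in> Delta2_max \<and> lim0_at_ends (\<lambda>x. leg_w x * f1 x) \<and>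
     lim0_at_ends (ddx (\<lambda>t. (leg_w t)\<^sup>2 * f2 t))"
  then have R: "f \<in> L2" "lim0_at_ends (\<lambda>x. leg_w x * f1 x)" "legendre_sq_expr f \<in> L2"
     "lim0_at_ends (ddx (\<lambda>t. (leg_w t)\<^sup>2 * f2 t))" unfolding Delta2_max_def by auto
  have l: "lim0_at_ends (\<lambda>x. leg_w x * ddx g x)"
    by (rule lim0_at_ends_cong[OF lim0_at_ends_diff[OF lim0_at_ends_cmult[OF R(2), of 2] R(4)]])
       (simp add: ddx_w2f2)
  have "g \<in> L2"
    by (rule legendre_energy(3)[OF ddx_g_AC l legendre_expr_g_L2[OF R(3)] g_AC])
  with R l show "f \<in> dom_T" unfolding dom_T_iff by auto
qed

lemma bracket_1:
  assumes "x \<in> I1"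
  shows "bracket2 f (\<lambda>x. 1) x = - (leg_w x * ddx g x)"
  unfolding bracket2_def funpow_ddx ddx_const using ddx_w2f2[OF assms] by (simp add: ddx_const)

text \<open>Eliminating f'' leaves, besides p g' and p f', only p g and p f, whose limits are
  settled by integrability.\<close>

lemma bracket_x:
  assumes "x \<in> I1"
  shows "bracket2 f (\<lambda>x. of_real x) x =
    - (of_real x * (leg_w x * ddx g x)) + leg_w x * g x - 2 * (of_real x * (leg_w x * f1 x)) + 2 * (leg_w x * f x)"
proof -
  have e: "(leg_w x)\<^sup>2 * f2 x = 2 * (of_real x * (leg_w x * f1 x)) - leg_w x * g x"
    by (simp add: leg_expr3_def algebra_simps power2_eq_square)
  have "bracket2 f (\<lambda>x. of_real x) x = (2 * (leg_w x * f1 x) - leg_w x * ddx g x) * of_real x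
      - (leg_w x)\<^sup>2 * f2 x - 2 * leg_w x * f1 x * of_real x + 2 * leg_w x * f x"
    unfolding bracket2_def funpow_ddx ddx_of_real ddx_const ddx_w2f2[OF assms] by (simp add: ddx_const)
  then show ?thesis unfolding e by (simp add: algebra_simps)
qed

text \<open>In the backward direction [f,1] gives the condition on p g', hence g and g' are square
  integrable. The condition on p f' has to be extracted from [f,x], for which p f must be known to
  vanish first.\<close>

lemma dom_T_iff_iii:
  "f \<in> dom_T \<longleftrightarrow> f \<in> Delta2_max \<and> lim0_at_ends (bracket2 f (\<lambda>x. 1)) \<and> lim0_at_ends (bracket2 f (\<lambda>x. of_real x))"
proof
  assume T: "f \<in> dom_T"
  then have R: "f \<in> L2" "g \<in> L2" "lim0_at_ends (\<lambda>x. leg_w x * f1 x)"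
     "legendre_sq_expr f \<in> L2" "lim0_at_ends (\<lambda>x. leg_w x * ddx g x)" unfolding dom_T_iff by auto
  have D: "f \<in> Delta2_max" using T unfolding dom_T_iff_iv by blast
  have 1: "lim0_at_ends (bracket2 f (\<lambda>x. 1))"
    by (rule lim0_at_ends_cong[OF lim0_at_ends_uminus[OF R(5)] bracket_1])
  have "legendre_expr f \<in> L2" by (rule L2_cong[OF R(2) legendre_expr_eq])
  then have "f1 \<in> L2" by (rule legendre_energy(1)[OF AC(2) R(3)])
  then have wf: "lim0_at_ends (\<lambda>x. leg_w x * f x)"
    using lim0_weighted_L2[OF AC(1), of 0] L2_leg_w_mult by simp
  have "ddx g \<in> L2" by (rule legendre_energy(1)[OF ddx_g_AC R(5) legendre_expr_g_L2[OF R(4)]])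
  then have wg: "lim0_at_ends (\<lambda>x. leg_w x * g x)"
    using lim0_weighted_L2[OF g_AC, of 0] L2_leg_w_mult by simp
  have "lim0_at_ends (bracket2 f (\<lambda>x. of_real x))"
    by (rule lim0_at_ends_cong[OF _ bracket_x])
       (intro lim0_at_ends_add lim0_at_ends_diff lim0_at_ends_uminus lim0_at_ends_cmult lim0_of_real_mult wf wg R)
  with 1 D show "f \<in> Delta2_max \<and> lim0_at_ends (bracket2 f (\<lambda>x. 1)) \<and> lim0_at_ends (bracket2 f (\<lambda>x. of_real x))"
    by blast
next
  assume A: "f \<in> Delta2_max \<and> lim0_at_ends (bracket2 f (\<lambda>x. 1)) \<and> lim0_at_ends (bracket2 f (\<lambda>x. of_real x))"
  then have R: "f \<in> L2" "legendre_sq_expr f \<in> L2" "lim0_at_ends (bracket2 f (\<lambda>x. 1))"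
    "lim0_at_ends (bracket2 f (\<lambda>x. of_real x))" unfolding Delta2_max_def by auto
  have l: "lim0_at_ends (\<lambda>x. leg_w x * ddx g x)"
    by (rule lim0_at_ends_cong[OF lim0_at_ends_uminus[OF R(3)]]) (simp add: bracket_1)
  have L: "legendre_expr g \<in> L2" by (rule legendre_expr_g_L2[OF R(2)])
  have g2: "g \<in> L2" by (rule legendre_energy(3)[OF ddx_g_AC l L g_AC])
  have wg: "lim0_at_ends (\<lambda>x. leg_w x * g x)"
    using lim0_weighted_L2[OF g_AC, of 0] L2_leg_w_mult[OF legendre_energy(1)[OF ddx_g_AC l L]] by simp
  have wf1_AC: "(\<lambda>x. leg_w x * f1 x) \<in> AC_loc" by (rule AC_loc_mult[OF AC_loc_leg_w AC(2)])
  \<comment> \<open>At this point p f' is not yet known to vanish at the ends, so the Hardy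
    inequality without boundary condition is used: (p f')' = - g makes p f' square integrable, which
    suffices for p f to vanish.\<close>
  have "(\<lambda>x. leg_w x * f1 x) \<in> L2"
  proof -
    have "(\<lambda>x. leg_w x * ddx (\<lambda>t. leg_w t * f1 t) x) \<in> L2"
      by (rule L2_cong[OF L2_leg_w_mult[OF L2_uminus[OF g2]]]) (simp add: ddx_eqI[OF wf1])
    then show ?thesis using L2_antiderivative[OF wf1_AC, of 0] by simp
  qed
  then have wf: "lim0_at_ends (\<lambda>x. leg_w x * f x)"
    using lim0_weighted_L2[OF AC(1), of 0] by simp
  have xl: "lim0_at_ends (\<lambda>x. of_real x * (leg_w x * f1 x))"
  proof (rule lim0_at_ends_cong)
    show "lim0_at_ends (\<lambda>x. (-1/2) * (bracket2 f (\<lambda>x. of_real x) x + of_real x * (leg_w x * ddx g x)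
        - leg_w x * g x - 2 * (leg_w x * f x)))"
      by (intro lim0_at_ends_cmult lim0_at_ends_add lim0_at_ends_diff lim0_of_real_mult R l wg wf)
  qed (simp add: bracket_x)
  \<comment> \<open>Near the ends |x| > 1/2, so the factor x can be removed.\<close>
  have "lim0_at_ends (\<lambda>x. leg_w x * f1 x)"
    unfolding lim0_at_ends_iff
  proof (intro allI impI)
    fix e :: real assume "e > 0"
    then obtain c where c: "0 < c" "c < 1" "\<And>x. x \<in> I1 \<Longrightarrow> c < \<bar>x\<bar> \<Longrightarrow> norm (of_real x * (leg_w x * f1 x)) < e / 2"
      using xl[unfolded lim0_at_ends_iff, rule_format, of "e / 2"] by auto
    have "norm (leg_w x * f1 x) < e" if x: "x \<in> I1" "max (1/2) c < \<bar>x\<bar>" for x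
    proof -
      have "1/2 * norm (leg_w x * f1 x) \<le> \<bar>x\<bar> * norm (leg_w x * f1 x)"
        using x by (intro mult_right_mono) auto
      also have "\<dots> < e / 2" using c(3)[of x] x by (simp add: norm_mult)
      finally show ?thesis by simp
    qed
    then show "\<exists>c. 0 < c \<and> c < 1 \<and> (\<forall>x\<in>I1. c < \<bar>x\<bar> \<longrightarrow> norm (leg_w x * f1 x) < e)"
      using c by (intro exI[of _ "max (1/2) c"]) auto
  qed
  with R g2 l show "f \<in> dom_T" unfolding dom_T_iff by auto
qed

lemma dom_T_iff_ii: "f \<in> dom_T \<longleftrightarrow> (\<lambda>x. (leg_w x)\<^sup>2 * f4 x) \<in> L2"
proof
  assume "f \<in> dom_T"
  then have R: "f \<in> L2" "g \<in> L2" "lim0_at_ends (\<lambda>x. leg_w x * f1 x)"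
     "legendre_sq_expr f \<in> L2" "lim0_at_ends (\<lambda>x. leg_w x * ddx g x)" unfolding dom_T_iff by auto
  have "legendre_expr f \<in> L2" by (rule L2_cong[OF R(2) legendre_expr_eq])
  then have f1: "f1 \<in> L2" by (rule legendre_energy(1)[OF AC(2) R(3)])
  have g1: "ddx g \<in> L2" by (rule legendre_energy(1)[OF ddx_g_AC R(5) legendre_expr_g_L2[OF R(4)]])
  then have wg: "lim0_at_ends (\<lambda>x. leg_w x * g x)"
    using lim0_weighted_L2[OF g_AC, of 0] L2_leg_w_mult by simp
  \<comment> \<open>This function equals 2 x p f' - p g and so vanishes at the ends; its derivative
    divided by p is 2 f' - g'. Hardy's inequality with j = 1 divides it by p^2 and yields
    f''.\<close>
  let ?H = "\<lambda>t. (leg_w t)\<^sup>2 * f2 t"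
  have H_AC: "?H \<in> AC_loc"
    unfolding power2_eq_square by (intro AC_loc_mult AC_loc_leg_w AC)
  have H0: "lim0_at_ends ?H"
    by (rule lim0_at_ends_cong[OF lim0_at_ends_diff[OF lim0_at_ends_cmult[OF lim0_of_real_mult[OF R(3)], of 2] wg]])
       (simp add: leg_expr3_def algebra_simps power2_eq_square)
  have "(\<lambda>x. ddx ?H x / leg_w x ^ 1) \<in> L2"
  proof (rule L2_cong[OF L2_diff[OF L2_cmult[OF f1, of 2] g1]])
    fix x assume x: "x \<in> I1"
    show "ddx ?H x / leg_w x ^ 1 = 2 * f1 x - ddx g x"
      unfolding ddx_w2f2[OF x] using leg_w_nonzero[OF x] by (simp add: field_simps)
  qed
  then have "(\<lambda>x. ?H x / leg_w x ^ Suc 1) \<in> L2"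
    by (rule hardy_inequality(1)[OF H_AC H0])
  then have f2: "f2 \<in> L2"
    by (rule L2_cong) (simp add: leg_w_nonzero power2_eq_square)
  have wf3: "(\<lambda>x. leg_w x * f3 x) \<in> L2"
    by (rule L2_cong[OF L2_add[OF L2_diff[OF L2_cmult[OF f1, of 2] g1] L2_cmult[OF L2_of_real_mult[OF f2], of 4]]])
       (simp add: ddx_g)
  show "(\<lambda>x. (leg_w x)\<^sup>2 * f4 x) \<in> L2"
  proof (rule L2_cong_AE)
    show "(\<lambda>x. legendre_sq_expr f x + 8 * (of_real x * (leg_w x * f3 x)) -
     (14 * (of_real x * (of_real x * f2 x)) - 6 * f2 x) - 4 * (of_real x * f1 x)) \<in> L2"
      by (intro L2_add L2_diff L2_cmult L2_of_real_mult R wf3 f1 f2)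
    show "AE x in leb_I. legendre_sq_expr f x + 8 * (of_real x * (leg_w x * f3 x)) -
     (14 * (of_real x * (of_real x * f2 x)) - 6 * f2 x) - 4 * (of_real x * f1 x) = (leg_w x)\<^sup>2 * f4 x"
      using legendre_sq_expand_AE by eventually_elim simp
  qed
next
  assume A: "(\<lambda>x. (leg_w x)\<^sup>2 * f4 x) \<in> L2"
  \<comment> \<open>The first Hardy inequality descends one derivative and one power of p at a time:
    p^2 f'''', p f''', f''. From there on a factor p is inserted, which is harmless since p is
    bounded, to reach f' and f.\<close>
  then have A': "(\<lambda>x. leg_w x ^ Suc (Suc 0) * f4 x) \<in> L2" by (simp add: power2_eq_square mult.assoc)
  have wf3: "(\<lambda>x. leg_w x * f3 x) \<in> L2" using L2_antiderivative[OF AC(4) A'] by simp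
  have f2: "f2 \<in> L2" using L2_antiderivative[OF AC(3), of 0] wf3 by simp
  have f1: "f1 \<in> L2" using L2_antiderivative[OF AC(2), of 0] L2_leg_w_mult[OF f2] by simp
  have f0: "f \<in> L2" using L2_antiderivative[OF AC(1), of 0] L2_leg_w_mult[OF f1] by simp
  have l3: "lim0_at_ends (\<lambda>x. leg_w x * (leg_w x * f3 x))"
    using lim0_weighted_L2[OF AC(4) A'] by (simp add: mult.assoc)
  have l2: "lim0_at_ends (\<lambda>x. leg_w x * f2 x)" using lim0_weighted_L2[OF AC(3), of 0] wf3 by simp
  have l1: "lim0_at_ends (\<lambda>x. leg_w x * f1 x)" using lim0_weighted_L2[OF AC(2), of 0] L2_leg_w_mult[OF f2] by simp
  have "legendre_sq_expr f \<in> L2"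
  proof (rule L2_cong_AE)
    show "(\<lambda>x. (leg_w x)\<^sup>2 * f4 x - 8 * (of_real x * (leg_w x * f3 x)) +
     (14 * (of_real x * (of_real x * f2 x)) - 6 * f2 x) + 4 * (of_real x * f1 x)) \<in> L2"
      by (intro L2_add L2_diff L2_cmult L2_of_real_mult A wf3 f1 f2)
    show "AE x in leb_I. (leg_w x)\<^sup>2 * f4 x - 8 * (of_real x * (leg_w x * f3 x)) +
     (14 * (of_real x * (of_real x * f2 x)) - 6 * f2 x) + 4 * (of_real x * f1 x) = legendre_sq_expr f x"
      using legendre_sq_expand_AE by eventually_elim simp
  qed
  moreover have "lim0_at_ends (ddx (\<lambda>t. (leg_w t)\<^sup>2 * f2 t))"
  proof (rule lim0_at_ends_cong[OF lim0_at_ends_diff[OF l3 lim0_at_ends_cmult[OF lim0_of_real_mult[OF l2], of 4]]])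
    fix x assume x: "x \<in> I1"
    show "ddx (\<lambda>t. (leg_w t)\<^sup>2 * f2 t) x = leg_w x * (leg_w x * f3 x) - 4 * (of_real x * (leg_w x * f2 x))"
      unfolding ddx_eqI[OF w2f2[OF x]] by (simp add: power2_eq_square)
  qed
  ultimately show "f \<in> dom_T"
    unfolding dom_T_iff_iv Delta2_max_def using f0 f3 l1 by auto
qed

end

section \<open>Polynomials and Green's formula\<close>

abbreviation poly_fun :: "real poly \<Rightarrow> real \<Rightarrow> complex" where
  "poly_fun p \<equiv> \<lambda>x. of_real (poly p x)"

lemma hvd_poly_fun: "(poly_fun p has_vector_derivative poly_fun (pderiv p) x) (at x)"
  by (rule has_vector_derivative_of_real[OF poly_DERIV])

lemma ddx_poly_fun: "ddx (poly_fun p) = poly_fun (pderiv p)"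
  by (rule ext, rule ddx_eqI, rule hvd_poly_fun)

lemma continuous_poly_fun: "continuous_on S (poly_fun p)"
  by (intro continuous_intros)

lemma AC_loc_poly_fun: "poly_fun p \<in> AC_loc"
  by (rule C1_AC_loc[OF hvd_poly_fun]) (rule continuous_poly_fun)

lemma L2_continuous:
  assumes "continuous_on {-1..1} f"
  shows "f \<in> L2"
proof -
  have "bounded (f ` {-1..1})" by (intro compact_imp_bounded compact_continuous_image assms) auto
  then obtain B where "\<forall>y\<in>f ` {-1..1}. norm y \<le> B" unfolding bounded_iff by blast
  then have B: "norm (f x) \<le> B" if "x \<in> {-1..1}" for x using that by blast
  show ?thesis
  proof (rule L2_bounded)
    show "f \<in> borel_measurable leb_I"
      by (rule continuous_imp_measurable_on_sets_lebesgue[OF continuous_on_subset[OF assms]]) auto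
    show "norm (f x) \<le> B" if "x \<in> I1" for x using that by (intro B) auto
  qed
qed

lemma L2_poly_fun: "poly_fun p \<in> L2"
  by (rule L2_continuous[OF continuous_poly_fun])

lemma lim0_leg_w: "lim0_at_ends leg_w"
proof -
  have c: "continuous_on UNIV leg_w" by (rule continuous_leg_w)
  have "(leg_w \<longlongrightarrow> leg_w x) (at x within S)" for x S
    using c by (metis UNIV_I continuous_on_def tendsto_within_subset subset_UNIV)
  from this[of 1] this[of "-1"] show ?thesis unfolding lim0_at_ends_def by (simp add: leg_w_def)
qed

lemma lim0_mult_poly_fun: "lim0_at_ends h \<Longrightarrow> lim0_at_ends (\<lambda>x. poly_fun p x * h x)"
  by (rule lim0_at_ends_mult_cont[OF _ continuous_poly_fun])

definition leg_poly :: "real poly \<Rightarrow> real poly" where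
  "leg_poly p = - pderiv ([:1, 0, -1:] * pderiv p)"

lemma leg_w_poly_fun: "leg_w x = poly_fun [:1, 0, -1:] x"
  by (simp add: leg_w_def power2_eq_square)

lemma legendre_expr_poly_fun: "legendre_expr (poly_fun p) = poly_fun (leg_poly p)"
proof
  fix x
  have "(\<lambda>t. leg_w t * poly_fun (pderiv p) t) = poly_fun ([:1, 0, -1:] * pderiv p)"
    unfolding leg_w_poly_fun by (simp only: poly_mult of_real_mult)
  then show "legendre_expr (poly_fun p) x = poly_fun (leg_poly p) x"
    unfolding legendre_expr_def ddx_poly_fun by (simp only: ddx_poly_fun leg_poly_def poly_minus of_real_minus)
qed

lemma poly_fun_dom_A: "poly_fun p \<in> dom_A"
  unfolding dom_A_def mem_Collect_eq AC_loc_upto_1 legendre_expr_poly_fun ddx_poly_fun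
  using lim0_mult_poly_fun[OF lim0_leg_w, of "pderiv p"]
  by (auto intro: AC_loc_poly_fun L2_poly_fun differentiableI_vector hvd_poly_fun simp: mult.commute)

text \<open>Lagrange's identity: W = p f' q - f p q' satisfies W' = f l[q] - l[f] q and vanishes at
  both ends, its second term because f' is square integrable. The polynomial is real, so conjugation
  does not affect it.\<close>

lemma green_poly_fun:
  assumes f: "f \<in> dom_A"
  shows "l2_inner (legendre_expr f) (poly_fun p) = l2_inner f (poly_fun (leg_poly p))"
proof -
  have fA: "f \<in> AC_loc" "ddx f \<in> AC_loc" "f \<in> L2" "legendre_expr f \<in> L2" "lim0_at_ends (\<lambda>x. leg_w x * ddx f x)"
    using f unfolding dom_A_def AC_loc_upto_1 by auto
  have f1: "ddx f \<in> L2" by (rule legendre_energy(1)[OF fA(2,5,4)])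
  have wf: "lim0_at_ends (\<lambda>x. leg_w x * f x)"
    using lim0_weighted_L2[OF fA(1), of 0] L2_leg_w_mult[OF f1] by simp
  let ?q = "poly_fun p" and ?q1 = "poly_fun (pderiv p)" and ?q2 = "poly_fun (leg_poly p)"
  let ?W = "\<lambda>x. (leg_w x * ddx f x) * ?q x - f x * (leg_w x * ?q1 x)"
  have W: "?W \<in> AC_loc"
    by (intro AC_loc_diff AC_loc_mult AC_loc_leg_w AC_loc_poly_fun fA)
  have W0: "lim0_at_ends ?W"
    by (rule lim0_at_ends_cong[OF lim0_at_ends_diff[OF lim0_mult_poly_fun[OF fA(5), of p] lim0_mult_poly_fun[OF wf, of "pderiv p"]]])
       (simp add: mult_ac)
  have d: "AE x in leb_I. ddx ?W x = f x * ?q2 x - legendre_expr f x * ?q x"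
    using AC_loc_has_derivative[OF fA(1)] AC_loc_has_derivative[OF AC_loc_mult[OF AC_loc_leg_w fA(2)]]
  proof eventually_elim
    case (elim x)
    have q: "((\<lambda>t. leg_w t * ?q1 t) has_vector_derivative - ?q2 x) (at x)"
    proof -
      have "(\<lambda>t. leg_w t * ?q1 t) = poly_fun ([:1, 0, -1:] * pderiv p)"
        unfolding leg_w_poly_fun by (simp only: poly_mult of_real_mult)
      then show ?thesis using hvd_poly_fun[of "[:1, 0, -1:] * pderiv p" x] by (simp add: leg_poly_def)
    qed
    have "(?W has_vector_derivative (leg_w x * ddx f x) * ?q1 x + ddx (\<lambda>t. leg_w t * ddx f t) x * ?q x
        - (f x * (- ?q2 x) + ddx f x * (leg_w x * ?q1 x))) (at x)"
      by (intro has_vector_derivative_diff has_vector_derivative_mult elim hvd_poly_fun q)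
    then show ?case by (rule ddx_eqI[THEN trans]) (simp add: legendre_expr_def algebra_simps)
  qed
  have i1: "integrable leb_I (\<lambda>x. f x * ?q2 x)" "integrable leb_I (\<lambda>x. legendre_expr f x * ?q x)"
    by (intro L2_mult_integrable fA L2_poly_fun)+
  then have i2: "integrable leb_I (\<lambda>x. f x * ?q2 x - legendre_expr f x * ?q x)" by simp
  have m: "ddx ?W \<in> borel_measurable leb_I" by (rule borel_measurable_ddx[OF W])
  have "integrable leb_I (ddx ?W)"
    using d i2 m by (subst integrable_cong_AE[OF _ _ d]) auto
  then have "(LINT x|leb_I. ddx ?W x) = 0" by (rule AC_loc_integral_eq_0[OF W _ W0])
  moreover have "(LINT x|leb_I. ddx ?W x) = (LINT x|leb_I. f x * ?q2 x - legendre_expr f x * ?q x)"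
    using i2 m d by (intro integral_cong_AE) auto
  ultimately show ?thesis
    unfolding l2_inner_def using i1 by simp
qed

subsection \<open>Legendre polynomials\<close>

text \<open>The first order equation of u = (x^2 - 1)^n, from which Legendre's equation arises by
  differentiation.\<close>

lemma rodrigues_base:
  "[:-1, 0, 1:] * pderiv ([:-1, 0, 1::real:] ^ n) = smult (2 * real n) ([:0, 1:] * [:-1, 0, 1:] ^ n)"
proof (cases n)
  case (Suc m)
  define Q where "Q = [:-1, 0, 1::real:]"
  have Q: "poly Q x = x * x - 1" "pderiv Q = [:0, 2:]" for x
    by (simp_all add: Q_def pderiv_pCons)
  have "poly (Q * pderiv (Q ^ n)) x = poly (smult (2 * real n) ([:0, 1:] * Q ^ n)) x" for x
    unfolding Suc pderiv_power_Suc by (simp add: Q algebra_simps)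
  then show ?thesis unfolding Q_def by (rule poly_ext)
qed (simp add: pderiv_1)

text \<open>Differentiate (x^2 - 1) u' = 2 n x u, k + 1 times in all. For k = n the coefficients
  become 2 and - n (n + 1), which is Legendre's equation for the n-th derivative of u.\<close>

lemma rodrigues_step:
  fixes u :: "real poly"
  assumes u_def: "u = [:-1, 0, 1:] ^ n"
  shows "[:-1, 0, 1:] * (pderiv ^^ (k + 2)) u + smult (2 * (real k + 1) - 2 * real n) ([:0, 1:] * (pderiv ^^ (k + 1)) u)
    + smult ((real k + 1) * real k - 2 * real n * (real k + 1)) ((pderiv ^^ k) u) = 0"
proof (induction k)
  case 0
  define Q X where "Q = [:-1, 0, 1::real:]" and "X = [:0, 1::real:]"
  have d: "pderiv Q = [:0, 2:]" "pderiv X = 1" by (simp_all add: Q_def X_def pderiv_pCons)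
  have e: "poly Q x = x * x - 1" "poly X x = x" for x by (simp_all add: Q_def X_def)
  have "pderiv (Q * pderiv u) = pderiv (smult (2 * real n) (X * u))"
    unfolding u_def Q_def X_def rodrigues_base ..
  then have "poly (pderiv (Q * pderiv u)) x = poly (pderiv (smult (2 * real n) (X * u))) x" for x by simp
  then have "poly (Q * pderiv (pderiv u) + smult (2 - 2 * real n) (X * pderiv u) + smult (- 2 * real n) u) x = poly 0 x" for x
    unfolding pderiv_mult pderiv_smult d by (simp add: e algebra_simps)
  then have "Q * pderiv (pderiv u) + smult (2 - 2 * real n) (X * pderiv u) + smult (- 2 * real n) u = 0"
    by (rule poly_ext)
  then show ?case unfolding Q_def X_def by (simp add: numeral_2_eq_2)
next
  case (Suc k)
  let ?y = "\<lambda>j. (pderiv ^^ j) u"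
  have y: "pderiv (?y j) = ?y (Suc j)" for j by simp
  from Suc have "pderiv ([:-1, 0, 1:] * ?y (k + 2) + smult (2 * (real k + 1) - 2 * real n) ([:0, 1:] * ?y (k + 1))
    + smult ((real k + 1) * real k - 2 * real n * (real k + 1)) (?y k)) = pderiv 0" by (rule arg_cong)
  then have "[:-1, 0, 1:] * ?y (k + 3) + [:0, 2:] * ?y (k + 2)
     + smult (2 * (real k + 1) - 2 * real n) ([:0, 1:] * ?y (k + 2) + ?y (k + 1))
     + smult ((real k + 1) * real k - 2 * real n * (real k + 1)) (?y (k + 1)) = 0"
    unfolding pderiv_add pderiv_mult pderiv_smult y by (simp add: pderiv_pCons mult.commute numeral_3_eq_3 add_ac)
  then have "poly ([:-1, 0, 1:] * ?y (k + 3) + [:0, 2:] * ?y (k + 2)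
     + smult (2 * (real k + 1) - 2 * real n) ([:0, 1:] * ?y (k + 2) + ?y (k + 1))
     + smult ((real k + 1) * real k - 2 * real n * (real k + 1)) (?y (k + 1))) x = poly 0 x" for x
    by (simp only:)
  then have "poly ([:-1, 0, 1:] * ?y (Suc k + 2) + smult (2 * (real (Suc k) + 1) - 2 * real n) ([:0, 1:] * ?y (Suc k + 1))
    + smult ((real (Suc k) + 1) * real (Suc k) - 2 * real n * (real (Suc k) + 1)) (?y (Suc k))) x = poly 0 x" for x
    by (simp add: algebra_simps numeral_3_eq_3 numeral_2_eq_2)
  then show ?case by (intro poly_ext)
qed

lemma leg_poly_legendre: "leg_poly (legendre_poly n) = smult (real n * (real n + 1)) (legendre_poly n)"
proof -
  let ?y = "\<lambda>j. (pderiv ^^ j) ([:-1, 0, 1::real:] ^ n)"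
  have "poly ([:-1, 0, 1:] * ?y (n + 2) + smult (2 * (real n + 1) - 2 * real n) ([:0, 1:] * ?y (n + 1))
    + smult ((real n + 1) * real n - 2 * real n * (real n + 1)) (?y n)) x = 0" for x
    unfolding rodrigues_step[OF refl, of n n] by simp
  then have "poly (leg_poly (?y n)) x = poly (smult (real n * (real n + 1)) (?y n)) x" for x
    unfolding leg_poly_def pderiv_mult
    by (simp add: pderiv_pCons algebra_simps numeral_2_eq_2)
  then have "leg_poly (?y n) = smult (real n * (real n + 1)) (?y n)" by (rule poly_ext)
  then have "leg_poly (smult c (?y n)) = smult (real n * (real n + 1)) (smult c (?y n))" for c
    by (metis leg_poly_def mult.commute mult_smult_right pderiv_smult smult_minus_right smult_smult)
  then show ?thesis unfolding legendre_poly_def .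
qed

lemma degree_legendre_poly: "degree (legendre_poly n) = n"
proof -
  have q: "[:-1, 0, 1::real:] \<noteq> 0" by simp
  have "degree ((pderiv ^^ k) p) = degree p - k" for k and p :: "real poly"
    by (induction k) (auto simp: degree_pderiv)
  then show ?thesis unfolding legendre_poly_def using degree_power_eq[OF q, of n] by simp
qed

lemma legendre_poly_nonzero: "legendre_poly n \<noteq> 0"
proof (cases n)
  case 0
  then show ?thesis by (simp add: legendre_poly_def)
next
  case (Suc m)
  then show ?thesis using degree_legendre_poly[of n] by auto
qed

text \<open>The N-th polynomial has degree exactly N, so a multiple of it removes the coefficient of
  degree N. The separate case p = 0 starts the induction at N = 0, where no degree lies below the
  bound.\<close>

lemma legendre_poly_span:
  assumes "p = 0 \<or> degree p < N"
  shows "\<exists>c. p = (\<Sum>n<N. smult (c n) (legendre_poly n))"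
  using assms
proof (induction N arbitrary: p)
  case (Suc N)
  define l where "l = coeff p N / coeff (legendre_poly N) N"
  define r where "r = p - smult l (legendre_poly N)"
  have "coeff (legendre_poly N) N \<noteq> 0"
    using legendre_poly_nonzero[of N] leading_coeff_0_iff[of "legendre_poly N"] by (simp add: degree_legendre_poly)
  then have "coeff r N = 0" by (simp add: r_def l_def)
  moreover have "degree r \<le> N"
    unfolding r_def using Suc.prems degree_legendre_poly[of N]
    by (intro degree_diff_le) (auto intro: order_trans[OF degree_smult_le])
  ultimately obtain c where c: "r = (\<Sum>n<N. smult (c n) (legendre_poly n))"
    using Suc.IH eq_zero_or_degree_less by blast
  have "p = (\<Sum>n<Suc N. smult ((c(N := l)) n) (legendre_poly n))"
    using c by (simp add: r_def algebra_simps)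
  then show ?case by blast
qed simp

abbreviation leg_eig :: "nat \<Rightarrow> complex" where
  "leg_eig n \<equiv> of_nat (n * (n + 1))"

lemma legendre_P_poly_fun: "legendre_P n = poly_fun (legendre_poly n)"
  by (rule ext) (simp add: legendre_P_def)

lemma L2_legendre_P: "legendre_P n \<in> L2"
  unfolding legendre_P_poly_fun by (rule L2_poly_fun)

lemma legendre_P_dom_A: "legendre_P n \<in> dom_A"
  unfolding legendre_P_poly_fun by (rule poly_fun_dom_A)

lemma legendre_expr_legendre_P: "legendre_expr (legendre_P n) = (\<lambda>x. leg_eig n * legendre_P n x)"
  unfolding legendre_P_poly_fun legendre_expr_poly_fun leg_poly_legendre
  by (auto simp: algebra_simps)

lemma cnj_legendre_P [simp]: "cnj (legendre_P n x) = legendre_P n x"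
  by (simp add: legendre_P_def)

text \<open>The Legendre polynomials are not normalised, so \<open>sqn (legendre_P n)\<close>
  appears as a divisor in the expansions.\<close>

definition coef :: "(real \<Rightarrow> complex) \<Rightarrow> nat \<Rightarrow> complex" where
  "coef f n = l2_inner f (legendre_P n)"

text \<open>Green's formula moves the expression onto the eigenfunction.\<close>

lemma coef_legendre_expr:
  assumes "f \<in> dom_A"
  shows "coef (legendre_expr f) n = leg_eig n * coef f n"
proof -
  have "coef (legendre_expr f) n = l2_inner f (poly_fun (leg_poly (legendre_poly n)))"
    unfolding coef_def legendre_P_poly_fun by (rule green_poly_fun[OF assms])
  also have "poly_fun (leg_poly (legendre_poly n)) = legendre_expr (legendre_P n)"
    unfolding legendre_P_poly_fun legendre_expr_poly_fun ..
  also have "l2_inner f (legendre_expr (legendre_P n)) = leg_eig n * coef f n"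
    unfolding l2_inner_def coef_def legendre_expr_legendre_P
    by (simp add: mult.left_commute flip: Bochner_Integration.integral_mult_right_zero)
  finally show ?thesis .
qed

lemma l2_inner_add: "\<lbrakk>f \<in> L2; g \<in> L2; h \<in> L2\<rbrakk> \<Longrightarrow> l2_inner (\<lambda>x. f x + g x) h = l2_inner f h + l2_inner g h"
  unfolding l2_inner_def by (simp add: distrib_right L2_inner_integrable)

lemma l2_inner_diff: "\<lbrakk>f \<in> L2; g \<in> L2; h \<in> L2\<rbrakk> \<Longrightarrow> l2_inner (\<lambda>x. f x - g x) h = l2_inner f h - l2_inner g h"
  unfolding l2_inner_def by (simp add: left_diff_distrib L2_inner_integrable)

lemma l2_inner_cmult: "l2_inner (\<lambda>x. c * f x) h = c * l2_inner f h"
  unfolding l2_inner_def by (simp add: mult.assoc)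

lemma l2_inner_commute: "l2_inner g f = cnj (l2_inner f g)"
proof -
  have "(LINT x|leb_I. g x * cnj (f x)) = (LINT x|leb_I. cnj (f x * cnj (g x)))"
    by (simp add: mult.commute)
  then show ?thesis unfolding l2_inner_def by (simp only: Bochner_Integration.integral_cnj)
qed

lemma l2_inner_cong_AE:
  assumes "f \<in> L2" "h \<in> L2" "AE x in leb_I. f x = g x"
  shows "l2_inner f h = l2_inner g h"
proof -
  have "g \<in> L2" by (rule L2_cong_AE[OF assms(1,3)])
  then show ?thesis
    unfolding l2_inner_def using L2_inner_integrable[OF assms(1,2)] L2_inner_integrable[OF \<open>g \<in> L2\<close> assms(2)] assms(3)
    by (intro integral_cong_AE) (auto elim!: eventually_mono)
qed

lemma coef_add: "\<lbrakk>f \<in> L2; g \<in> L2\<rbrakk> \<Longrightarrow> coef (\<lambda>x. f x + g x) n = coef f n + coef g n"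
  unfolding coef_def by (rule l2_inner_add[OF _ _ L2_legendre_P])

lemma coef_diff: "\<lbrakk>f \<in> L2; g \<in> L2\<rbrakk> \<Longrightarrow> coef (\<lambda>x. f x - g x) n = coef f n - coef g n"
  unfolding coef_def by (rule l2_inner_diff[OF _ _ L2_legendre_P])

lemma coef_cmult: "coef (\<lambda>x. c * f x) n = c * coef f n"
  unfolding coef_def by (rule l2_inner_cmult)

lemma coef_cong_AE: "\<lbrakk>f \<in> L2; AE x in leb_I. f x = g x\<rbrakk> \<Longrightarrow> coef f n = coef g n"
  unfolding coef_def by (rule l2_inner_cong_AE[OF _ L2_legendre_P])

lemma leg_eig_eq_iff: "leg_eig m = leg_eig n \<longleftrightarrow> m = n"
proof -
  have "m * (m + 1) < n * (n + 1)" if "m < n" for m n :: nat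
    using that by (intro mult_strict_mono) auto
  then have "m * (m + 1) = n * (n + 1) \<longleftrightarrow> m = n" by (metis less_irrefl linorder_neqE_nat)
  then show ?thesis by (simp only: of_nat_eq_iff)
qed

text \<open>Symmetry makes eigenfunctions for distinct eigenvalues orthogonal.\<close>

lemma coef_legendre_P_orthogonal:
  assumes "m \<noteq> n"
  shows "coef (legendre_P m) n = 0"
proof -
  have "leg_eig m * coef (legendre_P m) n = leg_eig n * coef (legendre_P m) n"
    using coef_legendre_expr[OF legendre_P_dom_A, of m n]
    unfolding legendre_expr_legendre_P coef_cmult .
  then show ?thesis using leg_eig_eq_iff[of m n] assms by (simp only: mult_cancel_right) blast
qed

definition sqn :: "(real \<Rightarrow> complex) \<Rightarrow> real" where
  "sqn f = (LINT x|leb_I. (norm (f x))\<^sup>2)"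

lemma l2_norm_sqn: "l2_norm f = sqrt (sqn f)"
  by (simp add: l2_norm_def sqn_def)

lemma sqn_nonneg: "0 \<le> sqn f"
  by (simp add: sqn_def)

lemma l2_inner_self: "l2_inner f f = of_real (sqn f)"
proof -
  have "l2_inner f f = (LINT x|leb_I. complex_of_real ((norm (f x))\<^sup>2))"
    unfolding l2_inner_def by (simp only: complex_norm_square)
  then show ?thesis unfolding sqn_def by (simp only: integral_complex_of_real)
qed

lemma sqn_eq_0_iff:
  assumes "f \<in> L2"
  shows "sqn f = 0 \<longleftrightarrow> ae_eq f (\<lambda>x. 0)"
  unfolding sqn_def ae_eq_def using L2_sq[OF assms] by (subst integral_nonneg_eq_0_iff_AE) auto

lemma sqn_add_le:
  assumes "f \<in> L2" "g \<in> L2"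
  shows "sqn (\<lambda>x. f x + g x) \<le> 2 * sqn f + 2 * sqn g"
proof -
  have "sqn (\<lambda>x. f x + g x) \<le> (LINT x|leb_I. 2 * (norm (f x))\<^sup>2 + 2 * (norm (g x))\<^sup>2)"
    unfolding sqn_def using assms[THEN L2_sq] L2_sq[OF L2_add[OF assms]]
    by (intro integral_mono norm_add_sq_le) auto
  also have "\<dots> = 2 * sqn f + 2 * sqn g"
    unfolding sqn_def using assms[THEN L2_sq] by simp
  finally show ?thesis .
qed

text \<open>Norm 0 would make a nonzero polynomial vanish on all of (-1,1).\<close>

lemma sqn_legendre_P_pos: "0 < sqn (legendre_P n)"
proof (rule ccontr)
  assume "\<not> 0 < sqn (legendre_P n)"
  then have "sqn (legendre_P n) = 0" using sqn_nonneg[of "legendre_P n"] by simp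
  then have ae: "AE x in leb_I. legendre_P n x = 0"
    using sqn_eq_0_iff[OF L2_legendre_P] unfolding ae_eq_def by simp
  have "legendre_P n x = 0" if "x \<in> I1" for x
    by (rule continuous_AE_eq[OF _ continuous_on_const ae that])
       (unfold legendre_P_poly_fun, rule continuous_poly_fun)
  then have "I1 \<subseteq> {x. poly (legendre_poly n) x = 0}" by (auto simp: legendre_P_def)
  then have "finite I1" by (rule finite_subset[OF _ poly_roots_finite[OF legendre_poly_nonzero]])
  then show False using infinite_Ioo[of "-1" "1::real"] by simp
qed

lemma coef_legendre_P_same: "coef (legendre_P n) n = of_real (sqn (legendre_P n))"
  unfolding coef_def by (rule l2_inner_self)

lemma sqn_le_const:
  assumes f: "f \<in> L2" and "\<And>x. x \<in> I1 \<Longrightarrow> norm (f x) \<le> B"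
  shows "sqn f \<le> 2 * B\<^sup>2"
proof -
  have "sqn f \<le> (LINT x|leb_I. B\<^sup>2)"
    unfolding sqn_def
  proof (rule integral_mono[OF L2_sq[OF f]])
    show "(norm (f x))\<^sup>2 \<le> B\<^sup>2" if "x \<in> space leb_I" for x
      using assms(2)[of x] that by (intro power_mono) auto
  qed simp
  also have "\<dots> = 2 * B\<^sup>2" using measure_leb_I(1) by simp
  finally show ?thesis .
qed

section \<open>Density of the Legendre polynomials\<close>

lemma sqn_tendsto_0:
  assumes g: "\<And>k. g k \<in> borel_measurable leb_I" and w: "integrable leb_I w"
    and le: "\<And>k x. x \<in> I1 \<Longrightarrow> (norm (g k x))\<^sup>2 \<le> w x"
    and lim: "AE x in leb_I. (\<lambda>k. g k x) \<longlonglongrightarrow> 0"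
  shows "(\<lambda>k. sqn (g k)) \<longlonglongrightarrow> 0"
proof -
  have "(\<lambda>k. LINT x|leb_I. (norm (g k x))\<^sup>2) \<longlonglongrightarrow> (LINT x|leb_I. 0)"
  proof (rule integral_dominated_convergence[OF _ _ w])
    show "AE x in leb_I. (\<lambda>k. (norm (g k x))\<^sup>2) \<longlonglongrightarrow> 0"
      using lim
    proof eventually_elim
      case (elim x)
      show ?case using tendsto_power[OF tendsto_norm[OF elim], of 2] by simp
    qed
    show "AE x in leb_I. norm ((norm (g k x))\<^sup>2) \<le> w x" for k using le by (intro AE_I2) auto
  qed (use g in measurable)
  then show ?thesis unfolding sqn_def by simp
qed

text \<open>Replace the values of norm above k by 0 and let k grow.\<close>

lemma L2_approx_bounded:
  assumes f: "f \<in> L2" and "e > 0"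
  shows "\<exists>g k. g \<in> L2 \<and> 0 \<le> k \<and> (\<forall>x. norm (g x) \<le> k) \<and> sqn (\<lambda>x. f x - g x) < e"
proof -
  define g where "g k x = (if norm (f x) \<le> real k then f x else 0)" for k :: nat and x
  note [measurable] = L2_measurable[OF f]
  have gm: "g k \<in> borel_measurable leb_I" for k unfolding g_def by measurable
  have gb: "norm (g k x) \<le> real k" for k x by (simp add: g_def)
  have "(\<lambda>k. sqn (\<lambda>x. f x - g k x)) \<longlonglongrightarrow> 0"
  proof (rule sqn_tendsto_0[OF _ L2_sq[OF f]])
    show "(\<lambda>x. f x - g k x) \<in> borel_measurable leb_I" for k using gm by measurable
    show "(norm (f x - g k x))\<^sup>2 \<le> (norm (f x))\<^sup>2" for k x by (simp add: g_def)
    show "AE x in leb_I. (\<lambda>k. f x - g k x) \<longlonglongrightarrow> 0"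
    proof (rule AE_I2)
      fix x
      obtain n :: nat where "norm (f x) \<le> real n" using real_arch_simple by blast
      then have "eventually (\<lambda>k. f x - g k x = 0) sequentially"
        by (intro eventually_sequentiallyI[of n]) (auto simp: g_def)
      then show "(\<lambda>k. f x - g k x) \<longlonglongrightarrow> 0" by (rule tendsto_eventually)
    qed
  qed
  then have "eventually (\<lambda>k. sqn (\<lambda>x. f x - g k x) < e) sequentially"
    using \<open>e > 0\<close> by (rule order_tendstoD(2))
  then obtain k where "sqn (\<lambda>x. f x - g k x) < e"
    using eventually_happens'[OF sequentially_bot] by blast
  moreover have "g k \<in> L2" by (rule L2_bounded[OF gm gb])
  ultimately show ?thesis using gb[of k] by (intro exI[of _ "g k"] exI[of _ "real k"]) auto
qed

text \<open>Measurability provides continuous functions that converge to g almost everywhere, but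
  without a common bound. Composition with the nearest-point projection onto the disc of radius k
  supplies the bound and does not disturb the limit, because g has its values in that disc.\<close>

lemma bounded_approx_continuous:
  fixes g :: "real \<Rightarrow> complex"
  assumes g: "g \<in> borel_measurable leb_I" and k: "0 \<le> k" "\<And>x. norm (g x) \<le> k" and "e > 0"
  shows "\<exists>h. continuous_on UNIV h \<and> sqn (\<lambda>x. g x - h x) < e"
proof -
  have "g measurable_on I1" using g by (simp only: measurable_on_iff_borel_measurable[OF I1_sets(1)])
  then obtain N h where N: "negligible N" and h: "\<And>n. continuous_on UNIV (h n)"
    and lim: "\<And>x. x \<notin> N \<Longrightarrow> (\<lambda>n. h n x) \<longlonglongrightarrow> (if x \<in> I1 then g x else 0)"
    unfolding measurable_on_def by blast
  define C where "C = closest_point (cball (0::complex) k)"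
  have cc: "continuous_on UNIV C" unfolding C_def using k by (intro continuous_on_closest_point) auto
  have Cb: "norm (C z) \<le> k" for z
    using closest_point_in_set[of "cball (0::complex) k" z] k by (simp add: C_def)
  have Ci: "C z = z" if "norm z \<le> k" for z
    unfolding C_def by (rule closest_point_self) (use that in simp)
  have hc: "continuous_on UNIV (\<lambda>x. C (h n x))" for n
    by (rule continuous_on_compose2[OF cc h]) simp
  have "(\<lambda>n. sqn (\<lambda>x. g x - C (h n x))) \<longlonglongrightarrow> 0"
  proof (rule sqn_tendsto_0[where w="\<lambda>x. (2 * k)\<^sup>2"])
    show "(\<lambda>x. g x - C (h n x)) \<in> borel_measurable leb_I" for n
      by (intro borel_measurable_diff[OF g] continuous_imp_measurable_on_sets_lebesgue
        continuous_on_subset[OF hc]) auto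
    show "(norm (g x - C (h n x)))\<^sup>2 \<le> (2 * k)\<^sup>2" for n x
    proof (rule power_mono)
      show "norm (g x - C (h n x)) \<le> 2 * k"
        using norm_triangle_ineq4[of "g x" "C (h n x)"] k(2)[of x] Cb[of "h n x"] by linarith
    qed simp
    show "AE x in leb_I. (\<lambda>n. g x - C (h n x)) \<longlonglongrightarrow> 0"
      unfolding AE_leb_I_iff
    proof (intro exI[of _ N] conjI ballI N)
      fix x assume x: "x \<in> I1 - N"
      then have "(\<lambda>n. h n x) \<longlonglongrightarrow> g x" using lim[of x] by auto
      then have "(\<lambda>n. C (h n x)) \<longlonglongrightarrow> C (g x)"
        using cc by (intro isCont_tendsto_compose[of _ C]) (simp_all add: continuous_on_eq_continuous_at)
      then have "(\<lambda>n. g x - C (h n x)) \<longlonglongrightarrow> g x - g x"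
        unfolding Ci[OF k(2)] by (intro tendsto_diff tendsto_const)
      then show "(\<lambda>n. g x - C (h n x)) \<longlonglongrightarrow> 0" by simp
    qed
  qed simp
  then have "eventually (\<lambda>n. sqn (\<lambda>x. g x - C (h n x)) < e) sequentially"
    using \<open>e > 0\<close> by (rule order_tendstoD(2))
  then obtain n where "sqn (\<lambda>x. g x - C (h n x)) < e"
    using eventually_happens'[OF sequentially_bot] by blast
  then show ?thesis using hc by (intro exI[of _ "\<lambda>x. C (h n x)"]) auto
qed

lemma Weierstrass_poly:
  fixes f :: "real \<Rightarrow> real"
  assumes "continuous_on {-1..1} f" "e > 0"
  shows "\<exists>p. \<forall>x\<in>{-1..1}. \<bar>f x - poly p x\<bar> < e"
proof (rule Stone_Weierstrass_real_polynomial_function[OF _ assms])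
  fix g :: "real \<Rightarrow> real"
  assume g: "real_polynomial_function g" and a: "\<And>x. x \<in> {-1..1} \<Longrightarrow> \<bar>f x - g x\<bar> < e"
  from g obtain a n where "g = (\<lambda>x. \<Sum>i\<le>n. a i * x ^ i)" unfolding real_polynomial_function_iff_sum by blast
  then have "poly (\<Sum>i\<le>n. monom (a i) i) x = g x" for x by (simp add: poly_sum poly_monom)
  then show ?thesis using a by (intro exI[of _ "\<Sum>i\<le>n. monom (a i) i"]) simp
qed simp

lemma poly_fun_legendre_sum: "\<exists>N c. \<forall>x. poly_fun p x = (\<Sum>n<N. of_real (c n) * legendre_P n x)"
proof -
  obtain c where "p = (\<Sum>n<Suc (degree p). smult (c n) (legendre_poly n))"
    using legendre_poly_span[of p "Suc (degree p)"] by blast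
  then have "poly p x = (\<Sum>n<Suc (degree p). c n * poly (legendre_poly n) x)" for x
    by (metis (no_types, lifting) poly_smult poly_sum sum.cong)
  then have "poly_fun p x = (\<Sum>n<Suc (degree p). of_real (c n) * legendre_P n x)" for x
    by (simp add: legendre_P_def del: sum.lessThan_Suc)
  then show ?thesis by blast
qed

lemma legendre_sum_extend:
  "\<lbrakk>\<forall>x. F x = (\<Sum>n<N. c n * legendre_P n x); N \<le> M\<rbrakk>
    \<Longrightarrow> \<exists>d. \<forall>x. F x = (\<Sum>n<M. d n * legendre_P n x)"
proof (intro exI[of _ "\<lambda>n. if n < N then c n else 0"] allI)
  fix x assume "\<forall>x. F x = (\<Sum>n<N. c n * legendre_P n x)" "N \<le> M"
  moreover have "(\<Sum>n<M. (if n < N then c n else 0) * legendre_P n x) = (\<Sum>n<N. c n * legendre_P n x)"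
    using \<open>N \<le> M\<close> by (intro sum.mono_neutral_cong_right) auto
  ultimately show "F x = (\<Sum>n<M. (if n < N then c n else 0) * legendre_P n x)" by simp
qed

lemma L2_legendre_sum: "(\<lambda>x. \<Sum>n<N. c n * legendre_P n x) \<in> L2" for N :: nat
  by (intro L2_sum L2_cmult L2_legendre_P)

text \<open>Truncation, approximation by a continuous function, and Weierstrass for its real and
  imaginary parts; the two expansions are padded to a common length.\<close>

lemma legendre_dense:
  assumes f: "f \<in> L2" and "e > 0"
  shows "\<exists>(N::nat) c. sqn (\<lambda>x. f x - (\<Sum>n<N. c n * legendre_P n x)) < e"
proof -
  have e: "e / 10 > 0" using \<open>e > 0\<close> by simp
  obtain g k where g: "g \<in> L2" "0 \<le> k" "\<forall>x. norm (g x) \<le> k" "sqn (\<lambda>x. f x - g x) < e / 10"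
    using L2_approx_bounded[OF f e] by blast
  obtain h where h: "continuous_on UNIV h" "sqn (\<lambda>x. g x - h x) < e / 10"
    using bounded_approx_continuous[OF L2_measurable[OF g(1)] g(2) _ e] g(3) by blast
  have h2: "h \<in> L2" by (rule L2_continuous[OF continuous_on_subset[OF h(1)]]) simp
  \<comment> \<open>A uniform error 2 \<eta> on an interval of length 2 costs 8 \<eta>^2 = 8 e /
    100. With the factors 2, 4 and 4 from the two uses of \<open>sqn_add_le\<close>, the total stays
    below 0.92 e.\<close>
  define \<eta> where "\<eta> = sqrt (e / 100)"
  have \<eta>: "\<eta> > 0" "\<eta>\<^sup>2 = e / 100" using \<open>e > 0\<close> by (auto simp: \<eta>_def)
  have cRI: "continuous_on {-1..1} (\<lambda>x. Re (h x))" "continuous_on {-1..1} (\<lambda>x. Im (h x))"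
    by (intro continuous_intros continuous_on_subset[OF h(1)]; simp)+
  obtain p1 where p1: "\<forall>x\<in>{-1..1}. \<bar>Re (h x) - poly p1 x\<bar> < \<eta>" using Weierstrass_poly[OF cRI(1) \<eta>(1)] by blast
  obtain p2 where p2: "\<forall>x\<in>{-1..1}. \<bar>Im (h x) - poly p2 x\<bar> < \<eta>" using Weierstrass_poly[OF cRI(2) \<eta>(1)] by blast
  define s where "s x = poly_fun p1 x + \<i> * poly_fun p2 x" for x
  obtain N1 c1 where c1: "\<forall>x. poly_fun p1 x = (\<Sum>n<N1. of_real (c1 n) * legendre_P n x)"
    using poly_fun_legendre_sum[of p1] by blast
  obtain N2 c2 where c2: "\<forall>x. poly_fun p2 x = (\<Sum>n<N2. of_real (c2 n) * legendre_P n x)"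
    using poly_fun_legendre_sum[of p2] by blast
  define M where "M = max N1 N2"
  obtain d1 where d1: "\<forall>x. poly_fun p1 x = (\<Sum>n<M. d1 n * legendre_P n x)"
    using legendre_sum_extend[OF c1, of M] by (auto simp: M_def)
  obtain d2 where d2: "\<forall>x. poly_fun p2 x = (\<Sum>n<M. d2 n * legendre_P n x)"
    using legendre_sum_extend[OF c2, of M] by (auto simp: M_def)
  have s: "s x = (\<Sum>n<M. (d1 n + \<i> * d2 n) * legendre_P n x)" for x
    unfolding s_def d1[rule_format] d2[rule_format]
    by (simp add: distrib_right sum.distrib sum_distrib_left mult.assoc)
  have s2: "s \<in> L2" unfolding s_def by (intro L2_add L2_cmult L2_poly_fun)
  have "norm (h x - s x) \<le> 2 * \<eta>" if x: "x \<in> I1" for x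
  proof -
    have "norm (h x - s x) \<le> \<bar>Re (h x - s x)\<bar> + \<bar>Im (h x - s x)\<bar>" by (rule cmod_le)
    also have "\<dots> = \<bar>Re (h x) - poly p1 x\<bar> + \<bar>Im (h x) - poly p2 x\<bar>" by (simp add: s_def)
    also have "\<dots> \<le> \<eta> + \<eta>" using p1 p2 x by (intro add_mono less_imp_le) auto
    finally show ?thesis by simp
  qed
  then have "sqn (\<lambda>x. h x - s x) \<le> 2 * (2 * \<eta>)\<^sup>2" by (rule sqn_le_const[OF L2_diff[OF h2 s2]])
  also have "\<dots> = 8 * (e / 100)" using \<eta>(2) by (simp add: power_mult_distrib)
  finally have hs: "sqn (\<lambda>x. h x - s x) \<le> 8 * (e / 100)" .
  have "sqn (\<lambda>x. (f x - g x) + ((g x - h x) + (h x - s x)))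
      \<le> 2 * sqn (\<lambda>x. f x - g x) + 2 * sqn (\<lambda>x. (g x - h x) + (h x - s x))"
    by (intro sqn_add_le L2_add L2_diff f g h2 s2)
  also have "\<dots> \<le> 2 * sqn (\<lambda>x. f x - g x) + 2 * (2 * sqn (\<lambda>x. g x - h x) + 2 * sqn (\<lambda>x. h x - s x))"
    by (intro add_left_mono mult_left_mono sqn_add_le L2_diff g h2 s2) simp
  also have "\<dots> < e"
  proof -
    have "2 * A + 2 * (2 * B + 2 * C) < e" if "A < e / 10" "B < e / 10" "C \<le> 8 * (e / 100)" for A B C
      using that \<open>e > 0\<close> by (simp add: field_simps)
    from this[OF g(4) h(2) hs] show ?thesis .
  qed
  finally have "sqn (\<lambda>x. f x - s x) < e" by simp
  then show ?thesis unfolding s by (intro exI[of _ M] exI[of _ "\<lambda>n. d1 n + \<i> * d2 n"])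
qed

lemma legendre_complete: "l2_complete legendre_P"
  unfolding l2_complete_def
proof (intro conjI ballI allI impI)
  show "range legendre_P \<subseteq> L2" using L2_legendre_P by auto
  fix f and e :: real assume f: "f \<in> L2" and "e > 0"
  obtain N :: nat and c where "sqn (\<lambda>x. f x - (\<Sum>n<N. c n * legendre_P n x)) < e\<^sup>2"
    using legendre_dense[OF f, of "e\<^sup>2"] \<open>e > 0\<close> by auto
  then have "l2_norm (\<lambda>x. f x - (\<Sum>n<N. c n * legendre_P n x)) < e"
    unfolding l2_norm_sqn using \<open>e > 0\<close> by (metis real_sqrt_less_iff real_sqrt_unique less_imp_le)
  then show "\<exists>(N::nat) c. l2_norm (\<lambda>x. f x - (\<Sum>n<N. c n * legendre_P n x)) < e" by blast
qed

section \<open>Bessel's inequality and Parseval's identity\<close>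

lemma l2_inner_cmult_right: "l2_inner f (\<lambda>x. c * h x) = cnj c * l2_inner f h"
  using l2_inner_commute[of f "\<lambda>x. c * h x"] l2_inner_commute[of h f] by (simp add: l2_inner_cmult)

lemma l2_inner_diff_right: "\<lbrakk>f \<in> L2; g \<in> L2; h \<in> L2\<rbrakk> \<Longrightarrow> l2_inner h (\<lambda>x. f x - g x) = l2_inner h f - l2_inner h g"
  unfolding l2_inner_def by (simp add: right_diff_distrib L2_inner_integrable)

text \<open>Completing the square in c; the minimum is attained at the Fourier coefficient.\<close>

lemma sqn_diff_projection:
  assumes r: "r \<in> L2" and P: "P \<in> L2" "0 < sqn P"
  shows "sqn (\<lambda>x. r x - c * P x) =
    sqn r - (norm (l2_inner r P))\<^sup>2 / sqn P + sqn P * (norm (c - l2_inner r P / of_real (sqn P)))\<^sup>2"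
proof -
  define z where "z = l2_inner r P"
  define N where "N = sqn P"
  have N: "complex_of_real N \<noteq> 0" using P by (simp add: N_def)
  have cP: "(\<lambda>x. c * P x) \<in> L2" by (rule L2_cmult[OF P(1)])
  have Pr: "l2_inner P r = cnj z" unfolding z_def by (rule l2_inner_commute)
  have "complex_of_real (sqn (\<lambda>x. r x - c * P x)) = l2_inner (\<lambda>x. r x - c * P x) (\<lambda>x. r x - c * P x)"
    by (rule l2_inner_self[symmetric])
  also have "\<dots> = l2_inner r r - l2_inner r (\<lambda>x. c * P x) - (l2_inner (\<lambda>x. c * P x) r - l2_inner (\<lambda>x. c * P x) (\<lambda>x. c * P x))"
    by (simp only: l2_inner_diff[OF r cP L2_diff[OF r cP]] l2_inner_diff_right[OF r cP r] l2_inner_diff_right[OF r cP cP])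
  also have "\<dots> = of_real (sqn r) - cnj c * z - (c * cnj z - c * (cnj c * of_real N))"
    unfolding l2_inner_cmult l2_inner_cmult_right l2_inner_self Pr z_def[symmetric] N_def[symmetric] ..
  also have "\<dots> = of_real (sqn r) - z * cnj z / of_real N + of_real N * ((c - z / of_real N) * cnj (c - z / of_real N))"
    using N by (simp add: field_simps)
  also have "\<dots> = complex_of_real (sqn r - (norm z)\<^sup>2 / N + N * (norm (c - z / of_real N))\<^sup>2)"
    by (simp only: complex_norm_square of_real_add of_real_diff of_real_divide of_real_mult)
  finally show ?thesis unfolding z_def N_def of_real_eq_iff .
qed

lemma coef_legendre_sum:
  fixes N :: nat
  shows "coef (\<lambda>x. \<Sum>n<N. c n * legendre_P n x) k = (if k < N then c k * of_real (sqn (legendre_P k)) else 0)"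
proof (induction N)
  case 0
  then show ?case by (simp add: coef_def l2_inner_def)
next
  case (Suc N)
  have "coef (\<lambda>x. \<Sum>n<Suc N. c n * legendre_P n x) k
      = coef (\<lambda>x. \<Sum>n<N. c n * legendre_P n x) k + c N * coef (legendre_P N) k"
    using coef_add[OF L2_legendre_sum L2_cmult[OF L2_legendre_P]] by (simp add: coef_cmult)
  then show ?case unfolding Suc
    using coef_legendre_P_orthogonal[of N k] coef_legendre_P_same[of N] by (cases k N rule: linorder_cases) auto
qed

text \<open>The coefficients c are arbitrary: the Fourier coefficients cancel the last sum and give
  Bessel's inequality, while dropping that sum shows that no other combination approximates
  better.\<close>

lemma bessel_identity:
  fixes N :: nat
  assumes f: "f \<in> L2"
  shows "sqn (\<lambda>x. f x - (\<Sum>n<N. c n * legendre_P n x)) =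
    sqn f - (\<Sum>n<N. (norm (coef f n))\<^sup>2 / sqn (legendre_P n)) +
    (\<Sum>n<N. sqn (legendre_P n) * (norm (c n - coef f n / of_real (sqn (legendre_P n))))\<^sup>2)"
proof (induction N)
  case (Suc N)
  let ?r = "\<lambda>x. f x - (\<Sum>n<N. c n * legendre_P n x)"
  have r: "?r \<in> L2" by (rule L2_diff[OF f L2_legendre_sum])
  have i: "l2_inner ?r (legendre_P N) = coef f N"
    unfolding coef_def[symmetric] coef_diff[OF f L2_legendre_sum] coef_legendre_sum by simp
  have "sqn (\<lambda>x. f x - (\<Sum>n<Suc N. c n * legendre_P n x)) = sqn (\<lambda>x. ?r x - c N * legendre_P N x)"
    by (simp add: algebra_simps)
  also have "\<dots> = sqn ?r - (norm (coef f N))\<^sup>2 / sqn (legendre_P N)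
     + sqn (legendre_P N) * (norm (c N - coef f N / of_real (sqn (legendre_P N))))\<^sup>2"
    unfolding sqn_diff_projection[OF r L2_legendre_P sqn_legendre_P_pos] i ..
  finally show ?case unfolding Suc by simp
qed simp

lemma bessel_inequality:
  fixes N :: nat
  assumes "f \<in> L2"
  shows "(\<Sum>n<N. (norm (coef f n))\<^sup>2 / sqn (legendre_P n)) \<le> sqn f"
  using bessel_identity[OF assms, where N=N and c="\<lambda>n. coef f n / of_real (sqn (legendre_P n))"]
    sqn_nonneg[of "\<lambda>x. f x - (\<Sum>n<N. coef f n / of_real (sqn (legendre_P n)) * legendre_P n x)"] by simp

text \<open>A good approximation exists by density, and the Fourier sum of the same length is at
  least as good.\<close>

lemma parseval_approx:
  assumes f: "f \<in> L2" and "e > 0"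
  shows "\<exists>N::nat. sqn f < (\<Sum>n<N. (norm (coef f n))\<^sup>2 / sqn (legendre_P n)) + e"
proof -
  obtain N :: nat and c where "sqn (\<lambda>x. f x - (\<Sum>n<N. c n * legendre_P n x)) < e"
    using legendre_dense[OF assms] by blast
  moreover have "0 \<le> (\<Sum>n<N. sqn (legendre_P n) * (norm (c n - coef f n / of_real (sqn (legendre_P n))))\<^sup>2)"
    by (intro sum_nonneg mult_nonneg_nonneg sqn_nonneg) simp
  ultimately have "sqn f < (\<Sum>n<N. (norm (coef f n))\<^sup>2 / sqn (legendre_P n)) + e"
    unfolding bessel_identity[OF f] by linarith
  then show ?thesis by blast
qed

text \<open>In this form completeness enters the spectral theory: a function is determined almost
  everywhere by its coefficients.\<close>

lemma coef_eq_0_imp: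
  assumes f: "f \<in> L2" and z: "\<And>n. coef f n = 0"
  shows "ae_eq f (\<lambda>x. 0)"
proof -
  have "sqn f < e" if "e > 0" for e using parseval_approx[OF f that] z by simp
  then have "sqn f = 0" using sqn_nonneg[of f] by (metis less_irrefl order_le_less)
  then show ?thesis using sqn_eq_0_iff[OF f] by simp
qed

lemma coef_eq_imp_ae_eq:
  assumes "f \<in> L2" "g \<in> L2" "\<And>n. coef f n = coef g n"
  shows "ae_eq f g"
  using coef_eq_0_imp[OF L2_diff[OF assms(1,2)]] coef_diff[OF assms(1,2)] assms(3)
  unfolding ae_eq_def by simp

text \<open>The inequality between arithmetic and geometric means with a weight, integrated;
  choosing the parameter later takes the place of Cauchy-Schwarz.\<close>

lemma l2_inner_bound:
  assumes a: "a \<in> L2" and b: "b \<in> L2" and t: "t > 0"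
  shows "norm (l2_inner a b) \<le> t * sqn a + sqn b / t"
proof -
  have *: "norm (x * cnj y) \<le> t * (norm x)\<^sup>2 + (norm y)\<^sup>2 / t" for x y :: complex
  proof -
    have "0 \<le> (sqrt t * norm x - norm y / sqrt t)\<^sup>2" by simp
    also have "\<dots> = t * (norm x)\<^sup>2 - 2 * (norm x * norm y) + (norm y)\<^sup>2 / t"
      using t by (simp add: power2_diff power_mult_distrib power_divide)
    finally have "2 * (norm x * norm y) \<le> t * (norm x)\<^sup>2 + (norm y)\<^sup>2 / t" by linarith
    moreover have "0 \<le> norm x * norm y" by simp
    ultimately have "norm x * norm y \<le> t * (norm x)\<^sup>2 + (norm y)\<^sup>2 / t" by linarith
    then show ?thesis by (simp add: norm_mult)
  qed
  have "norm (l2_inner a b) \<le> (LINT x|leb_I. norm (a x * cnj (b x)))"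
    unfolding l2_inner_def by (rule integral_norm_bound)
  also have "\<dots> \<le> (LINT x|leb_I. t * (norm (a x))\<^sup>2 + (norm (b x))\<^sup>2 / t)"
    using L2_inner_integrable[OF a b] L2_sq[OF a] L2_sq[OF b] * by (intro integral_mono) auto
  also have "\<dots> = t * sqn a + sqn b / t"
    unfolding sqn_def using L2_sq[OF a] L2_sq[OF b] by simp
  finally show ?thesis .
qed

text \<open>The Fourier sums of v converge to v in norm, and the inner product with u is
  continuous.\<close>

lemma parseval_sums:
  assumes u: "u \<in> L2" and v: "v \<in> L2"
  shows "(\<lambda>n. coef u n * cnj (coef v n) / of_real (sqn (legendre_P n))) sums l2_inner u v"
proof -
  define S where "S N x = (\<Sum>n<N. coef v n / of_real (sqn (legendre_P n)) * legendre_P n x)" for N :: nat and x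
  have S2: "S N \<in> L2" for N unfolding S_def by (rule L2_legendre_sum)
  have uS: "l2_inner u (S N) = (\<Sum>n<N. coef u n * cnj (coef v n) / of_real (sqn (legendre_P n)))" for N
  proof (induction N)
    case 0
    then show ?case by (simp add: S_def l2_inner_def)
  next
    case (Suc N)
    define d where "d = - coef v N / of_real (sqn (legendre_P N))"
    have "S (Suc N) = (\<lambda>x. S N x - d * legendre_P N x)"
      by (simp add: S_def d_def fun_eq_iff)
    moreover have "l2_inner u (\<lambda>x. S N x - d * legendre_P N x) = l2_inner u (S N) - cnj d * coef u N"
      by (simp only: l2_inner_diff_right[OF S2 L2_cmult[OF L2_legendre_P] u] l2_inner_cmult_right coef_def)
    ultimately show ?case unfolding Suc by (simp add: d_def mult.commute)
  qed
  have sq: "sqn (\<lambda>x. v x - S N x) = sqn v - (\<Sum>n<N. (norm (coef v n))\<^sup>2 / sqn (legendre_P n))" for N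
    unfolding S_def bessel_identity[OF v] by simp
  have "(\<lambda>N. l2_inner u (S N)) \<longlonglongrightarrow> l2_inner u v"
    unfolding tendsto_iff eventually_sequentially dist_norm
  proof (intro allI impI)
    fix e :: real assume "e > 0"
    \<comment> \<open>This makes \<open>t * sqn u\<close> smaller than e / 2; the other term is
      smaller than e / 2 once the squared norm of the remainder is below t e / 2. The summand 1
      keeps the denominator positive.\<close>
    define t where "t = e / (2 * (sqn u + 1))"
    have t: "t > 0" using \<open>e > 0\<close> sqn_nonneg[of u] by (simp add: t_def)
    have tu: "t * sqn u < e / 2"
      using \<open>e > 0\<close> sqn_nonneg[of u] by (simp add: t_def field_simps)
    have te: "t * (e / 2) > 0" using t \<open>e > 0\<close> by simp
    obtain N0 :: nat where N0: "sqn v < (\<Sum>n<N0. (norm (coef v n))\<^sup>2 / sqn (legendre_P n)) + t * (e / 2)"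
      using parseval_approx[OF v te] by blast
    have "norm (l2_inner u (S N) - l2_inner u v) < e" if "N \<ge> N0" for N
    proof -
      have "(\<Sum>n<N0. (norm (coef v n))\<^sup>2 / sqn (legendre_P n)) \<le> (\<Sum>n<N. (norm (coef v n))\<^sup>2 / sqn (legendre_P n))"
        using that by (intro sum_mono2 divide_nonneg_nonneg sqn_nonneg) auto
      with N0 have "sqn (\<lambda>x. v x - S N x) < t * (e / 2)" unfolding sq by linarith
      then have s: "sqn (\<lambda>x. v x - S N x) / t < e / 2" using t by (simp add: field_simps)
      have "norm (l2_inner u (S N) - l2_inner u v) = norm (l2_inner u (\<lambda>x. v x - S N x))"
        unfolding l2_inner_diff_right[OF v S2 u] by (rule norm_minus_commute)
      also have "\<dots> \<le> t * sqn u + sqn (\<lambda>x. v x - S N x) / t"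
        by (rule l2_inner_bound[OF u L2_diff[OF v S2] t])
      also have "\<dots> < e" using tu s by linarith
      finally show ?thesis .
    qed
    then show "\<exists>N0. \<forall>N\<ge>N0. norm (l2_inner u (S N) - l2_inner u v) < e" by blast
  qed
  then show ?thesis unfolding sums_def uS .
qed

subsection \<open>The operators in Legendre coefficients\<close>

lemma ae_eq_refl: "ae_eq f f"
  and ae_eq_sym: "ae_eq f g \<Longrightarrow> ae_eq g f"
  and ae_eq_trans: "\<lbrakk>ae_eq f g; ae_eq g h\<rbrakk> \<Longrightarrow> ae_eq f h"
  unfolding ae_eq_def by (auto elim: eventually_mono eventually_elim2)

lemma dom_A_add_const:
  assumes "w \<in> dom_A"
  shows "(\<lambda>x. w x + c) \<in> dom_A" and "x \<in> I1 \<Longrightarrow> legendre_expr (\<lambda>x. w x + c) x = legendre_expr w x"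
proof -
  have w: "w \<in> AC_loc" "ddx w \<in> AC_loc" "\<And>x. x \<in> I1 \<Longrightarrow> w differentiable (at x)" "w \<in> L2"
    "legendre_expr w \<in> L2" "lim0_at_ends (\<lambda>x. leg_w x * ddx w x)"
    using assms unfolding dom_A_def AC_loc_upto_1 by auto
  have h: "((\<lambda>x. w x + c) has_vector_derivative ddx w x) (at x)" if "x \<in> I1" for x
    using has_vector_derivative_add[OF differentiable_has_ddx[OF w(3)[OF that]] has_vector_derivative_const[of c]] by simp
  then have d: "ddx (\<lambda>x. w x + c) x = ddx w x" if "x \<in> I1" for x using that by (intro ddx_eqI)
  have L: "legendre_expr (\<lambda>x. w x + c) x = legendre_expr w x" if x: "x \<in> I1" for x
    unfolding legendre_expr_def by (subst ddx_cong[OF x, of _ "\<lambda>t. leg_w t * ddx w t"]) (simp_all add: d)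
  then show "x \<in> I1 \<Longrightarrow> legendre_expr (\<lambda>x. w x + c) x = legendre_expr w x" .
  have "\<forall>x\<in>I1. (\<lambda>x. w x + c) differentiable (at x)" using differentiableI_vector[OF h] by blast
  moreover have "lim0_at_ends (\<lambda>x. leg_w x * ddx (\<lambda>x. w x + c) x)"
    by (rule lim0_at_ends_cong[OF w(6)]) (simp add: d)
  ultimately show "(\<lambda>x. w x + c) \<in> dom_A"
    unfolding dom_A_def mem_Collect_eq AC_loc_upto_1
    using AC_loc_add[OF w(1) AC_loc_const] AC_loc_cong[OF w(2) d] L2_add[OF w(4) L2_const] L2_cong[OF w(5) L] by blast
qed

text \<open>Let H(x) be the integral of h from -1 to x and solve p w' = - H. Mean 0 makes H vanish
  at both ends, which is the boundary condition of A; that w is square integrable follows from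
  Hardy's inequalities.\<close>

lemma legendre_solve_0:
  assumes h: "h \<in> L2" and h0: "(LINT x|leb_I. h x) = 0"
  shows "\<exists>w\<in>dom_A. ae_eq (legendre_expr w) h"
proof -
  have "integrable lebesgue (\<lambda>x. indicator I1 x *\<^sub>R h x)"
    using L2_integrable[OF h] by (subst (asm) integrable_restrict_space) auto
  then have aI: "h absolutely_integrable_on I1" unfolding set_integrable_def .
  have sub: "(\<lambda>x. if x \<in> I1 then h x else 0) absolutely_integrable_on {-1..1}"
    using aI by (intro set_integrable_subset[OF absolutely_integrable_restrict_UNIV[THEN iffD2, of I1 h]]) auto
  define k where "k x = (if x \<in> I1 then h x else 0)" for x
  have ka: "k absolutely_integrable_on {-1..1}" using sub unfolding k_def .
  then have ki: "k integrable_on {-1..1}" using absolutely_integrable_on_def by blast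
  define H where "H x = integral {-1..x} k" for x
  have Hc: "continuous_on {-1..1} H"
    unfolding H_def by (rule indefinite_integral_continuous_1[OF ki])
  have Hab: "k absolutely_integrable_on {a..b}" "(k has_integral (H b - H a)) {a..b}" if "-1 < a" "a \<le> b" "b < 1" for a b
  proof -
    show "k absolutely_integrable_on {a..b}" by (rule set_integrable_subset[OF ka]) (use that in auto)
    have kb: "k integrable_on {-1..b}" "k integrable_on {a..b}"
      using that by (auto intro: integrable_subinterval_real[OF ki])
    have "H a + integral {a..b} k = H b"
      unfolding H_def by (rule Henstock_Kurzweil_Integration.integral_combine[OF _ that(2) kb(1)]) (use that in simp)
    then have "integral {a..b} k = H b - H a" by (simp add: algebra_simps)
    then show "(k has_integral (H b - H a)) {a..b}" using integrable_integral[OF kb(2)] by simp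
  qed
  have H_AC: "H \<in> AC_loc" and H_d: "AE x in leb_I. (H has_vector_derivative k x) (at x)"
    by (rule AC_locI[OF Hab]; assumption)+
  have H0: "H (-1) = 0" by (simp add: H_def)
  have "H 1 = integral {-1<..<1} k" unfolding H_def by (simp only: integral_open_interval_real)
  also have "\<dots> = integral I1 h" by (rule integral_cong) (simp add: k_def)
  also have "\<dots> = (LINT x:I1|lebesgue. h x)" using set_lebesgue_integral_eq_integral(2)[OF aI] by simp
  also have "\<dots> = (LINT x|leb_I. h x)"
    unfolding set_lebesgue_integral_def by (rule integral_restrict_space[symmetric]) simp
  finally have H1: "H 1 = 0" using h0 by simp
  have "(H \<longlongrightarrow> H 1) (at 1 within {-1..1})" "(H \<longlongrightarrow> H (-1)) (at (-1) within {-1..1})"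
    using Hc unfolding continuous_on_def by auto
  then have lH: "lim0_at_ends H"
    unfolding lim0_at_ends_def H0 H1 by (simp add: at_within_Icc_at_left at_within_Icc_at_right)
  define q where "q x = - H x * inverse (leg_w x)" for x
  have qA: "q \<in> AC_loc" unfolding q_def by (intro AC_loc_mult AC_loc_uminus H_AC AC_loc_inverse_weight)
  have "isCont q x" if "-1 < x" "x < 1" for x
    using AC_loc_continuous_on[OF qA] continuous_on_eq_continuous_at[of I1 q] that by auto
  \<comment> \<open>Near the ends q may be unbounded, so w is obtained as an antiderivative on the
    open interval.\<close>
  then have "\<exists>F. \<forall>x::real. ereal (-1) < ereal x \<longrightarrow> ereal x < ereal 1 \<longrightarrow> (F has_vector_derivative q x) (at x)"
    by (intro einterval_antiderivative) auto
  then obtain w where wd: "\<And>x. x \<in> I1 \<Longrightarrow> (w has_vector_derivative q x) (at x)" by auto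
  have wA: "w \<in> AC_loc" by (rule C1_AC_loc[OF wd AC_loc_continuous_on[OF qA]])
  have dw: "ddx w x = q x" if "x \<in> I1" for x by (rule ddx_eqI[OF wd[OF that]])
  have dwA: "ddx w \<in> AC_loc" by (rule AC_loc_cong[OF qA dw])
  have pw: "leg_w x * ddx w x = - H x" if "x \<in> I1" for x
    unfolding dw[OF that] q_def using leg_w_nonzero[OF that] by simp
  have lw: "lim0_at_ends (\<lambda>x. leg_w x * ddx w x)"
    by (rule lim0_at_ends_cong[OF lim0_at_ends_uminus[OF lH] pw])
  have ae: "AE x in leb_I. h x = legendre_expr w x"
    using H_d AE_space
  proof eventually_elim
    case (elim x)
    then have x: "x \<in> I1" by simp
    have "ddx (\<lambda>t. leg_w t * ddx w t) x = ddx (\<lambda>t. - H t) x" by (rule ddx_cong[OF x pw])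
    also have "\<dots> = - k x" by (rule ddx_eqI[OF has_vector_derivative_minus[OF elim(1)]])
    finally show ?case using x by (simp add: legendre_expr_def k_def)
  qed
  have Lw: "legendre_expr w \<in> L2" by (rule L2_cong_AE[OF h ae])
  have w2: "w \<in> L2" by (rule legendre_energy(3)[OF dwA lw Lw wA])
  have "\<forall>x\<in>I1. w differentiable (at x)" using differentiableI_vector[OF wd] by blast
  then have "w \<in> dom_A" unfolding dom_A_def mem_Collect_eq AC_loc_upto_1 using wA dwA w2 Lw lw by blast
  moreover have "ae_eq (legendre_expr w) h" unfolding ae_eq_def using ae by eventually_elim simp
  ultimately show ?thesis by blast
qed

lemma legendre_P_0: "legendre_P 0 x = 1"
  by (simp add: legendre_P_def legendre_poly_def)

lemma coef_0: "coef h 0 = (LINT x|leb_I. h x)"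
  by (simp add: coef_def l2_inner_def legendre_P_0)

text \<open>Adding a constant does not change l[w], so the coefficient at 0, which l[w] does not
  determine, can be prescribed.\<close>

lemma legendre_solve:
  assumes h: "h \<in> L2" and h0: "coef h 0 = 0"
  shows "\<exists>w\<in>dom_A. ae_eq (legendre_expr w) h \<and> coef w 0 = c"
proof -
  obtain w where w: "w \<in> dom_A" "ae_eq (legendre_expr w) h"
    using legendre_solve_0[OF h] h0 unfolding coef_0 by blast
  have w2: "w \<in> L2" using w(1) unfolding dom_A_def by auto
  \<comment> \<open>A constant d has coefficient 2 d at 0, the interval having length 2.\<close>
  define d where "d = (c - coef w 0) / 2"
  show ?thesis
  proof (intro bexI[of _ "\<lambda>x. w x + d"] conjI)
    show "(\<lambda>x. w x + d) \<in> dom_A" by (rule dom_A_add_const(1)[OF w(1)])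
    show "ae_eq (legendre_expr (\<lambda>x. w x + d)) h"
      using w(2) AE_space unfolding ae_eq_def by eventually_elim (simp add: dom_A_add_const(2)[OF w(1)])
    have "coef (\<lambda>x. d) 0 = 2 * d" unfolding coef_0 using measure_leb_I(1) by (simp add: scaleR_conv_of_real)
    also have "\<dots> = c - coef w 0" by (simp add: d_def)
    finally show "coef (\<lambda>x. w x + d) 0 = c" unfolding coef_add[OF w2 L2_const] by simp
  qed
qed

lemma op_A_coef:
  assumes "(g, h) \<in> op_A"
  shows "g \<in> L2" "h \<in> L2" "coef h n = leg_eig n * coef g n"
proof -
  obtain f where f: "f \<in> dom_A" "ae_eq g f" "ae_eq h (legendre_expr f)"
    using assms unfolding op_A_def op_graph_def by auto
  have f2: "f \<in> L2" "legendre_expr f \<in> L2" using f(1) unfolding dom_A_def by auto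
  have a: "AE x in leb_I. f x = g x" "AE x in leb_I. legendre_expr f x = h x"
    using f(2,3)[THEN ae_eq_sym] unfolding ae_eq_def by auto
  show "g \<in> L2" "h \<in> L2" using L2_cong_AE[OF f2(1) a(1)] L2_cong_AE[OF f2(2) a(2)] .
  show "coef h n = leg_eig n * coef g n"
    using coef_legendre_expr[OF f(1), of n] coef_cong_AE[OF f2(1) a(1)] coef_cong_AE[OF f2(2) a(2)] by simp
qed

lemma op_A_solve:
  assumes h: "h \<in> L2" and h0: "coef h 0 = 0"
  obtains w where "(w, h) \<in> op_A" "coef w 0 = c"
proof -
  obtain w where w: "w \<in> dom_A" "ae_eq (legendre_expr w) h" "coef w 0 = c"
    using legendre_solve[OF h h0] by blast
  then have "(w, h) \<in> op_A"
    unfolding op_A_def op_graph_def using ae_eq_refl[of w] ae_eq_sym[OF w(2)] by blast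
  then show thesis using w(3) by (rule that)
qed

text \<open>Equality almost everywhere does not by itself carry over to \<open>ddx\<close>. Here h
  and g are continuous, hence equal throughout (-1,1), and so are their derivatives.\<close>

lemma dom_T_square:
  assumes f: "f \<in> dom_T" and h: "h \<in> dom_A" and fh: "ae_eq (legendre_expr f) h"
  shows "ae_eq (legendre_sq_expr f) (legendre_expr h)"
proof -
  interpret ac3 f by unfold_locales (rule dom_T_imp_AC_loc_upto_3[OF f])
  have h1: "h \<in> AC_loc" using h unfolding dom_A_def AC_loc_upto_1 by auto
  have gh: "g x = h x" if "x \<in> I1" for x
  proof (rule continuous_AE_eq[OF _ _ _ that])
    show "continuous_on I1 g" "continuous_on I1 h" by (intro AC_loc_continuous_on g_AC h1)+
    show "AE x in leb_I. g x = h x"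
      using fh AE_space unfolding ae_eq_def by eventually_elim (simp add: legendre_expr_eq)
  qed
  have dg: "ddx g y = ddx h y" if "y \<in> I1" for y by (rule ddx_cong[OF that gh])
  have "legendre_expr g x = legendre_expr h x" if x: "x \<in> I1" for x
    unfolding legendre_expr_def
    by (subst ddx_cong[OF x, of _ "\<lambda>t. leg_w t * ddx h t"]) (simp_all add: dg)
  note ge = this
  show ?thesis
    unfolding ae_eq_def using legendre_sq_eq_AE AE_space[of leb_I] by eventually_elim (simp add: ge)
qed

abbreviation sq_eig :: "nat \<Rightarrow> complex" where
  "sq_eig n \<equiv> of_nat (n\<^sup>2 * (n + 1)\<^sup>2)"

lemma sq_eig_eq: "sq_eig n = leg_eig n * leg_eig n"
  by (simp only: of_nat_mult[symmetric] power2_eq_square mult_ac)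

lemma op_A_comp: "op_T = op_A O op_A"
proof (intro set_eqI iffI)
  fix p assume "p \<in> op_T"
  then obtain u v f where p: "p = (u, v)" and f: "f \<in> dom_T" "ae_eq u f" "ae_eq v (legendre_sq_expr f)"
    unfolding op_T_def op_graph_def by auto
  obtain h where h: "f \<in> dom_A" "h \<in> dom_A" "ae_eq (legendre_expr f) h" using f(1) unfolding dom_T_def by blast
  have "(u, h) \<in> op_A" unfolding op_A_def op_graph_def using f(2) h ae_eq_sym by auto
  moreover have "ae_eq v (legendre_expr h)" by (rule ae_eq_trans[OF f(3) dom_T_square[OF f(1) h(2,3)]])
  then have "(h, v) \<in> op_A" unfolding op_A_def op_graph_def using h(2) ae_eq_refl by auto
  ultimately show "p \<in> op_A O op_A" unfolding p by blast
next
  fix p assume "p \<in> op_A O op_A"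
  then obtain u m v where p: "p = (u, v)" and 1: "(u, m) \<in> op_A" and 2: "(m, v) \<in> op_A" by auto
  obtain f where f: "f \<in> dom_A" "ae_eq u f" "ae_eq m (legendre_expr f)"
    using 1 unfolding op_A_def op_graph_def by auto
  obtain h where h: "h \<in> dom_A" "ae_eq m h" "ae_eq v (legendre_expr h)"
    using 2 unfolding op_A_def op_graph_def by auto
  have fh: "ae_eq (legendre_expr f) h" using f(3) h(2) ae_eq_sym ae_eq_trans by blast
  then have fT: "f \<in> dom_T" unfolding dom_T_def using f(1) h(1) by blast
  have "ae_eq v (legendre_sq_expr f)"
    using h(3) ae_eq_sym[OF dom_T_square[OF fT h(1) fh]] by (rule ae_eq_trans)
  then show "p \<in> op_T" unfolding p op_T_def op_graph_def using fT f(2) by auto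
qed

text \<open>For the converse, the equation at n = 0 says that h has mean 0, so l[w] = h is solvable
  with the coefficient of w at 0 taken from g. The other eigenvalues are nonzero, so w and g have
  equal coefficients and agree almost everywhere.\<close>

lemma op_A_iff:
  "(g, h) \<in> op_A \<longleftrightarrow> g \<in> L2 \<and> h \<in> L2 \<and> (\<forall>n. coef h n = leg_eig n * coef g n)"
proof
  assume "(g, h) \<in> op_A"
  then show "g \<in> L2 \<and> h \<in> L2 \<and> (\<forall>n. coef h n = leg_eig n * coef g n)" using op_A_coef by blast
next
  assume A: "g \<in> L2 \<and> h \<in> L2 \<and> (\<forall>n. coef h n = leg_eig n * coef g n)"
  then have "coef h 0 = 0" by simp
  then obtain w where w: "(w, h) \<in> op_A" "coef w 0 = coef g 0" using op_A_solve A by blast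
  have "coef w n = coef g n" for n
  proof (cases "n = 0")
    case False
    then have "leg_eig n \<noteq> 0" using leg_eig_eq_iff[of n 0] by simp
    moreover have "leg_eig n * coef w n = leg_eig n * coef g n" using op_A_coef(3)[OF w(1), of n] A by metis
    ultimately show ?thesis using mult_left_cancel by blast
  qed (simp add: w(2))
  then have "ae_eq g w" using A op_A_coef(1)[OF w(1)] by (intro coef_eq_imp_ae_eq) auto
  then show "(g, h) \<in> op_A"
    using w(1) unfolding op_A_def op_graph_def by (auto intro: ae_eq_trans)
qed

text \<open>For the converse, the intermediate function with coefficients n (n + 1) g_n is not
  summed as a series: it is the solution of l[w] = h with mean 0.\<close>

lemma op_T_iff:
  "(g, h) \<in> op_T \<longleftrightarrow> g \<in> L2 \<and> h \<in> L2 \<and> (\<forall>n. coef h n = sq_eig n * coef g n)"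
proof
  assume "(g, h) \<in> op_T"
  then obtain m where "(g, m) \<in> op_A" "(m, h) \<in> op_A" unfolding op_A_comp by blast
  then show "g \<in> L2 \<and> h \<in> L2 \<and> (\<forall>n. coef h n = sq_eig n * coef g n)"
    unfolding op_A_iff sq_eig_eq by (simp add: mult.assoc)
next
  assume A: "g \<in> L2 \<and> h \<in> L2 \<and> (\<forall>n. coef h n = sq_eig n * coef g n)"
  then have "coef h 0 = 0" by simp
  then obtain w where wh: "(w, h) \<in> op_A" and w0: "coef w 0 = 0" using op_A_solve A by blast
  note w = op_A_coef(1)[OF wh] w0 op_A_coef(3)[OF wh]
  have "coef w n = leg_eig n * coef g n" for n
  proof (cases "n = 0")
    case True
    then show ?thesis using w(2) by simp
  next
    case False
    have "leg_eig n * coef w n = leg_eig n * (leg_eig n * coef g n)"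
      using A w(3)[of n] unfolding sq_eig_eq by (simp only: mult.assoc)
    moreover have "leg_eig n \<noteq> 0" using leg_eig_eq_iff[of n 0] False by simp
    ultimately show ?thesis using mult_left_cancel[of "leg_eig n" "coef w n" "leg_eig n * coef g n"] by blast
  qed
  then have "(g, w) \<in> op_A" unfolding op_A_iff using A w(1) by blast
  then show "(g, h) \<in> op_T" using wh unfolding op_A_comp by blast
qed

lemma op_T_L2: "(u, v) \<in> op_T \<Longrightarrow> u \<in> L2 \<and> v \<in> L2"
  unfolding op_T_iff by blast

lemma legendre_eigenfunction: "eigenfunction op_T (sq_eig n) (legendre_P n)"
  unfolding eigenfunction_def
proof
  show "\<not> ae_eq (legendre_P n) (\<lambda>x. 0)"
    using sqn_legendre_P_pos[of n] sqn_eq_0_iff[OF L2_legendre_P, of n] by simp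
  show "(legendre_P n, \<lambda>x. sq_eig n * legendre_P n x) \<in> op_T"
    unfolding op_T_iff coef_cmult using L2_legendre_P L2_cmult coef_legendre_P_orthogonal[of n] by fastforce
qed

text \<open>All clauses are read off the description of the graph by coefficients.\<close>

lemma op_T_l2_operator: "l2_operator op_T"
  unfolding l2_operator_def
proof (intro conjI allI impI)
  show "op_T \<subseteq> L2 \<times> L2" using op_T_L2 by auto
  show "(u', v') \<in> op_T" if T: "(u, v) \<in> op_T" and "ae_eq u u'" "ae_eq v v'" for u v u' v'
  proof -
    have "u \<in> L2" "v \<in> L2" using op_T_L2[OF T] by auto
    then show ?thesis
      using T that(2,3) L2_cong_AE[of u u'] L2_cong_AE[of v v'] coef_cong_AE[of u u'] coef_cong_AE[of v v']
      unfolding op_T_iff ae_eq_def by simp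
  qed
  show "ae_eq v v'" if T: "(u, v) \<in> op_T" "(u, v') \<in> op_T" for u v v'
    using T by (intro coef_eq_imp_ae_eq) (auto simp: op_T_iff)
  have "coef (\<lambda>x. 0) n = 0" for n by (simp add: coef_def l2_inner_def)
  then show "(\<lambda>x. 0, \<lambda>x. 0) \<in> op_T" unfolding op_T_iff by simp
  show "(\<lambda>x. u x + u' x, \<lambda>x. v x + v' x) \<in> op_T" if "(u, v) \<in> op_T" "(u', v') \<in> op_T" for u v u' v'
    using that unfolding op_T_iff by (simp add: L2_add coef_add distrib_left del: of_nat_mult of_nat_power)
  show "(\<lambda>x. c * u x, \<lambda>x. c * v x) \<in> op_T" if "(u, v) \<in> op_T" for c u v
    using that unfolding op_T_iff by (simp add: L2_cmult coef_cmult mult.left_commute del: of_nat_mult of_nat_power)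
qed

lemma legendre_sum_Domain: "(\<lambda>x. \<Sum>n<N. c n * legendre_P n x) \<in> Domain op_T" for N :: nat
proof (rule DomainI)
  show "(\<lambda>x. \<Sum>n<N. c n * legendre_P n x, \<lambda>x. \<Sum>n<N. (sq_eig n * c n) * legendre_P n x) \<in> op_T"
    unfolding op_T_iff coef_legendre_sum using L2_legendre_sum by simp
qed

lemma op_T_densely_defined: "densely_defined op_T"
  unfolding densely_defined_def
proof (intro ballI allI impI)
  fix f and \<epsilon> :: real assume "f \<in> L2" "\<epsilon> > 0"
  then obtain N :: nat and c where "l2_norm (\<lambda>x. f x - (\<Sum>n<N. c n * legendre_P n x)) < \<epsilon>"
    using legendre_complete unfolding l2_complete_def by blast
  then show "\<exists>u\<in>Domain op_T. l2_norm (\<lambda>x. f x - u x) < \<epsilon>"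
    using legendre_sum_Domain[where N=N and c=c] by (intro bexI[of _ "\<lambda>x. \<Sum>n<N. c n * legendre_P n x"])
qed

text \<open>Parseval's identity, the eigenvalues being real.\<close>

lemma op_T_symmetric:
  assumes "(u, v) \<in> op_T" "(g, h) \<in> op_T"
  shows "l2_inner v g = l2_inner u h"
proof -
  have 1: "u \<in> L2" "v \<in> L2" "g \<in> L2" "h \<in> L2" "\<And>n. coef v n = sq_eig n * coef u n" "\<And>n. coef h n = sq_eig n * coef g n"
    using assms unfolding op_T_iff by auto
  have "coef v n * cnj (coef g n) = coef u n * cnj (coef h n)" for n
    unfolding 1(5,6) complex_cnj_mult complex_cnj_of_nat by (simp only: mult_ac)
  then show ?thesis
    using parseval_sums[OF 1(2,3)] parseval_sums[OF 1(1,4)] sums_unique2 by simp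
qed

lemma op_T_self_adjoint: "self_adjoint op_T"
  unfolding self_adjoint_def
proof (intro conjI op_T_l2_operator op_T_densely_defined)
  show "adjoint_rel op_T = op_T"
  proof (intro set_eqI iffI)
    fix p assume "p \<in> op_T"
    then show "p \<in> adjoint_rel op_T"
      unfolding adjoint_rel_def using op_T_symmetric op_T_L2 by (cases p) auto
  next
    fix p assume "p \<in> adjoint_rel op_T"
    then obtain g h where p: "p = (g, h)" and gh: "g \<in> L2" "h \<in> L2"
      and A: "\<forall>(u, v)\<in>op_T. l2_inner v g = l2_inner u h" unfolding adjoint_rel_def by auto
    \<comment> \<open>Testing the adjoint relation on the eigenfunctions alone already gives the
      description of the graph by coefficients, so the adjoint is contained in the operator.\<close>
    have "coef h n = sq_eig n * coef g n" for n
    proof -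
      have "l2_inner (\<lambda>x. sq_eig n * legendre_P n x) g = l2_inner (legendre_P n) h"
        using A legendre_eigenfunction[of n] unfolding eigenfunction_def by auto
      then have "sq_eig n * cnj (coef g n) = cnj (coef h n)"
        unfolding l2_inner_cmult coef_def l2_inner_commute[of "legendre_P n" g] l2_inner_commute[of "legendre_P n" h] .
      then have "cnj (sq_eig n * cnj (coef g n)) = cnj (cnj (coef h n))" by (rule arg_cong)
      then show ?thesis by (simp only: complex_cnj_mult complex_cnj_of_nat complex_cnj_cnj)
    qed
    then show "p \<in> op_T" unfolding p op_T_iff using gh by blast
  qed
qed

subsection \<open>Resolvent and spectrum\<close>

text \<open>Distinct integers differ by at least 1; this isolates the spectral points.\<close>

lemma sq_eig_dist: "sq_eig m \<noteq> sq_eig n \<Longrightarrow> 1 \<le> norm (sq_eig m - sq_eig n)"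
proof -
  have "1 \<le> norm (of_nat a - of_nat b :: complex)" if "a \<noteq> b" for a b
  proof -
    have "of_nat a - of_nat b = complex_of_real (real_of_int (int a - int b))" by simp
    then have "norm (of_nat a - of_nat b :: complex) = \<bar>real_of_int (int a - int b)\<bar>" by (simp only: norm_of_real)
    moreover have "1 \<le> \<bar>int a - int b\<bar>" using that by linarith
    ultimately show ?thesis by linarith
  qed
  then show "sq_eig m \<noteq> sq_eig n \<Longrightarrow> 1 \<le> norm (sq_eig m - sq_eig n)" by (metis)
qed

lemma sq_eig_eq_iff: "sq_eig m = sq_eig n \<longleftrightarrow> m = n"
proof -
  have "m\<^sup>2 * (m + 1)\<^sup>2 < n\<^sup>2 * (n + 1)\<^sup>2" if "m < n" for m n :: nat
    using that by (intro mult_strict_mono power_strict_mono) auto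
  then have "m\<^sup>2 * (m + 1)\<^sup>2 = n\<^sup>2 * (n + 1)\<^sup>2 \<longleftrightarrow> m = n" by (metis less_irrefl linorder_neqE_nat)
  then show ?thesis by (simp only: of_nat_eq_iff)
qed

lemma norm_sq_eig: "norm (sq_eig n) = (real (n * (n + 1)))\<^sup>2"
  by (subst sq_eig_eq) (simp only: norm_mult norm_of_nat power2_eq_square)

lemma eig_ge: "real n ^ 2 \<le> real (n * (n + 1))" "real n \<le> real (n * (n + 1))" "n \<noteq> 0 \<Longrightarrow> 1 \<le> real (n * (n + 1))"
proof -
  have a: "n ^ 2 \<le> n * (n + 1)" "n \<le> n * (n + 1)" by (auto simp: power2_eq_square)
  then show "real n ^ 2 \<le> real (n * (n + 1))" "real n \<le> real (n * (n + 1))"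
    unfolding of_nat_power[symmetric] of_nat_le_iff by blast+
  show "n \<noteq> 0 \<Longrightarrow> 1 \<le> real (n * (n + 1))" using a(2) by (metis Suc_leI le_trans not_gr_zero of_nat_1_eq_iff of_nat_mono One_nat_def of_nat_1)
qed

text \<open>The condition on n forces |z| to be at most half of the eigenvalue (n (n +
  1))^2.\<close>

lemma norm_sq_eig_diff_ge:
  assumes "2 * norm z \<le> real n" "n \<noteq> 0"
  shows "(real (n * (n + 1)))\<^sup>2 / 2 \<le> norm (sq_eig n - z)"
proof -
  have "real n \<le> real (n * (n + 1)) * 1" using eig_ge(2) by simp
  also have "\<dots> \<le> real (n * (n + 1)) * real (n * (n + 1))" by (intro mult_left_mono eig_ge(3) assms) simp
  finally have "2 * norm z \<le> (real (n * (n + 1)))\<^sup>2" using assms(1) unfolding power2_eq_square by linarith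
  moreover have "norm (sq_eig n) - norm z \<le> norm (sq_eig n - z)" by (rule norm_triangle_ineq2)
  ultimately show ?thesis unfolding norm_sq_eig by linarith
qed

lemma sq_eig_gap:
  assumes "\<And>n. z \<noteq> sq_eig n"
  shows "\<exists>d>0. \<forall>n. d \<le> norm (sq_eig n - z)"
proof -
  obtain M :: nat where M: "2 * norm z + 1 < real M" using reals_Archimedean2 by blast
  \<comment> \<open>The value 1/2 serves for n \<ge> M, where half of the eigenvalue bounds the
    distance and the eigenvalue is at least 1. The finitely many other distances are positive by
    assumption.\<close>
  define d where "d = Min (insert (1/2) ((\<lambda>n. norm (sq_eig n - z)) ` {..<M}))"
  have "d > 0" unfolding d_def using assms by (subst Min_gr_iff) (auto simp del: of_nat_mult of_nat_power)
  moreover have "d \<le> norm (sq_eig n - z)" for n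
  proof (cases "n < M")
    case True
    then show ?thesis unfolding d_def by (intro Min_le) auto
  next
    case False
    then have "real M \<le> real n" by simp
    then have "2 * norm z \<le> real n" "0 < real n" using M norm_ge_zero[of z] by linarith+
    then have n: "2 * norm z \<le> real n" "n \<noteq> 0" by auto
    have "d \<le> 1 / 2" unfolding d_def by (intro Min_le) auto
    also have "\<dots> \<le> (real (n * (n + 1)))\<^sup>2 / 2"
      using eig_ge(3)[OF n(2)] by (intro divide_right_mono one_le_power) auto
    also have "\<dots> \<le> norm (sq_eig n - z)" by (rule norm_sq_eig_diff_ge[OF n])
    finally show ?thesis .
  qed
  ultimately show ?thesis by blast
qed

text \<open>Majorant for the resolvent series: the numerator comes from the supremum bound on P_n,
  and eventually the terms are at most 4 / n^2. If z is an eigenvalue, the term with denominator 0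
  has the value 0.\<close>

lemma summable_eig_ratio: "summable (\<lambda>n. (1 + real (n * (n + 1))) / norm (sq_eig n - z))"
proof -
  obtain M :: nat where M: "2 * norm z + 1 < real M" using reals_Archimedean2 by blast
  have "summable (\<lambda>n. 4 * inverse (real n ^ 2))"
    by (intro summable_mult inverse_power_summable) simp
  moreover have "norm ((1 + real (n * (n + 1))) / norm (sq_eig n - z)) \<le> 4 * inverse (real n ^ 2)" if "n \<ge> M" for n
  proof -
    have "real M \<le> real n" using that by simp
    then have "2 * norm z \<le> real n" "0 < real n" using M norm_ge_zero[of z] by linarith+
    then have n: "2 * norm z \<le> real n" "n \<noteq> 0" by auto
    define l where "l = real (n * (n + 1))"
    have l: "1 \<le> l" "real n ^ 2 \<le> l" using eig_ge n(2) by (auto simp: l_def simp del: of_nat_mult)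
    have g: "l\<^sup>2 / 2 \<le> norm (sq_eig n - z)" unfolding l_def by (rule norm_sq_eig_diff_ge[OF n])
    have "norm ((1 + l) / norm (sq_eig n - z)) = (1 + l) / norm (sq_eig n - z)" using l by simp
    also have "\<dots> \<le> (1 + l) / (l\<^sup>2 / 2)" using g l by (intro divide_left_mono mult_pos_pos) (auto intro: less_le_trans[of 0 "l\<^sup>2 / 2"])
    also have "\<dots> \<le> (2 * l) / (l\<^sup>2 / 2)" using l by (intro divide_right_mono) auto
    also have "\<dots> = 4 * inverse l" using l by (simp add: power2_eq_square field_simps)
    also have "\<dots> \<le> 4 * inverse (real n ^ 2)"
      using l n(2) by (intro mult_left_mono le_imp_inverse_le) auto
    finally show ?thesis unfolding l_def .
  qed
  ultimately show ?thesis by (rule summable_comparison_test'[of _ M])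
qed

lemma nn_integral_sqn: "f \<in> L2 \<Longrightarrow> (\<integral>\<^sup>+x. (ennreal (norm (f x)))\<^sup>2 \<partial>leb_I) = ennreal (sqn f)"
  unfolding sqn_def using nn_integral_eq_integral[OF L2_sq] by (simp add: ennreal_power)

text \<open>Write l = n (n + 1). Cauchy-Schwarz on an interval of length 2 and the Hardy constant 4
  bound |P(x) - P(y)|^2 by K = 8 l^2 \<open>sqn P\<close>. Averaging |P(x)|^2 \<le> 2 |P(y)|^2 + 2 K
  over y yields (1 + 16 l^2) \<open>sqn P\<close>, and 1 + 16 l^2 is at most (4 (1 + l))^2.\<close>

lemma legendre_P_sup:
  assumes x: "x \<in> I1"
  shows "norm (legendre_P n x) \<le> 4 * (1 + real (n * (n + 1))) * sqrt (sqn (legendre_P n))"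
proof -
  define l where "l = real (n * (n + 1))"
  define P where "P = legendre_P n"
  have P: "P \<in> AC_loc" "ddx P \<in> AC_loc" "P \<in> L2" "lim0_at_ends (\<lambda>x. leg_w x * ddx P x)" "legendre_expr P \<in> L2"
    using legendre_P_dom_A[of n] unfolding P_def dom_A_def AC_loc_upto_1 by auto
  have dP: "ddx P \<in> L2" by (rule legendre_energy(1)[OF P(2,4,5)])
  have lam: "sqn (legendre_expr P) = l\<^sup>2 * sqn P"
  proof -
    have "norm (leg_eig n) = l" unfolding l_def by (rule norm_of_nat)
    then show ?thesis unfolding P_def legendre_expr_legendre_P sqn_def norm_mult power_mult_distrib by simp
  qed
  define K where "K = 8 * (l\<^sup>2 * sqn P)"
  have K0: "0 \<le> K" unfolding K_def using sqn_nonneg[of P] by simp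
  have osc: "(norm (P x - P y))\<^sup>2 \<le> K" if y: "y \<in> I1" for y
  proof -
    have [measurable]: "(\<lambda>t. ennreal (norm (ddx P t))) \<in> borel_measurable leb_I"
      using L2_measurable[OF dP] by measurable
    have "ennreal (1 * norm (P x - P y)) \<le> (\<integral>\<^sup>+t. ennreal (norm (ddx P t)) \<partial>leb_I)"
      by (rule AC_loc_scaled_increment_le[OF P(1) y x]) auto
    then have "(ennreal (norm (P x - P y)))\<^sup>2 \<le> (\<integral>\<^sup>+t. ennreal (norm (ddx P t)) * 1 \<partial>leb_I)\<^sup>2"
      by (intro power_mono) auto
    also have "\<dots> \<le> (\<integral>\<^sup>+t. (ennreal (norm (ddx P t)))\<^sup>2 \<partial>leb_I) * (\<integral>\<^sup>+t. 1\<^sup>2 \<partial>leb_I)"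
      by (rule Cauchy_Schwarz_nn_integral) measurable
    also have "\<dots> \<le> (4 * (\<integral>\<^sup>+t. (ennreal (norm (legendre_expr P t)))\<^sup>2 \<partial>leb_I)) * 2"
      using legendre_energy(2)[OF P(2,4,5)] measure_leb_I(2) by (intro mult_mono) auto
    also have "\<dots> = ennreal K"
      unfolding nn_integral_sqn[OF P(5)] lam K_def using sqn_nonneg[of P]
      by (simp add: ennreal_mult' mult_ac)
    finally show ?thesis using K0 by (simp add: ennreal_power)
  qed
  have pt: "(norm (P x))\<^sup>2 \<le> 2 * (norm (P y))\<^sup>2 + 2 * K" if y: "y \<in> I1" for y
  proof -
    have "(norm (P x))\<^sup>2 \<le> 2 * (norm (P y))\<^sup>2 + 2 * (norm (P x - P y))\<^sup>2"
      using norm_add_sq_le[of "P y" "P x - P y"] by simp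
    then show ?thesis using osc[OF y] by linarith
  qed
  have "2 * (norm (P x))\<^sup>2 = (LINT y|leb_I. (norm (P x))\<^sup>2)" using measure_leb_I(1) by simp
  also have "\<dots> \<le> (LINT y|leb_I. 2 * (norm (P y))\<^sup>2 + 2 * K)"
    using L2_sq[OF P(3)] pt by (intro integral_mono) auto
  also have "\<dots> = 2 * sqn P + 4 * K" unfolding sqn_def using L2_sq[OF P(3)] measure_leb_I(1) by simp
  finally have "(norm (P x))\<^sup>2 \<le> sqn P + 2 * K" by linarith
  also have "\<dots> = (1 + 16 * l\<^sup>2) * sqn P" by (simp add: K_def algebra_simps)
  also have "\<dots> \<le> (4 * (1 + l))\<^sup>2 * sqn P"
    using sqn_nonneg[of P] by (intro mult_right_mono) (auto simp: power2_eq_square algebra_simps l_def)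
  also have "\<dots> = (4 * (1 + l) * sqrt (sqn P))\<^sup>2"
    using sqn_nonneg[of P] by (simp add: power_mult_distrib)
  finally show ?thesis
    unfolding P_def l_def by (rule power2_le_imp_le) (auto intro!: mult_nonneg_nonneg simp: sqn_nonneg)
qed

lemma norm_coef_le:
  assumes "h \<in> L2"
  shows "norm (coef h n) \<le> sqrt (sqn h) * sqrt (sqn (legendre_P n))"
proof -
  have "(norm (coef h n))\<^sup>2 / sqn (legendre_P n) \<le> (\<Sum>k<Suc n. (norm (coef h k))\<^sup>2 / sqn (legendre_P k))"
    by (rule member_le_sum) (auto intro: divide_nonneg_nonneg sqn_nonneg)
  also have "\<dots> \<le> sqn h" by (rule bessel_inequality[OF assms])
  finally have "(norm (coef h n))\<^sup>2 \<le> sqn h * sqn (legendre_P n)"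
    using sqn_legendre_P_pos[of n] by (simp add: field_simps)
  then have "sqrt ((norm (coef h n))\<^sup>2) \<le> sqrt (sqn h * sqn (legendre_P n))" by (rule real_sqrt_le_mono)
  then show ?thesis by (simp add: real_sqrt_mult)
qed

text \<open>The coefficients must satisfy (\<open>sq_eig n\<close> - z) u_n = h_n, which dictates
  \<open>a\<close>. In the bound for the n-th term one factor sqrt (N n) comes from the coefficient
  of h and one from the supremum of P_n; they cancel the divisor N n and leave the summable
  \<open>b\<close>.\<close>

lemma resolvent_surj:
  assumes h: "h \<in> L2" and z: "\<And>n. z \<noteq> sq_eig n"
  shows "\<exists>u. (u, \<lambda>x. h x + z * u x) \<in> op_T"
proof -
  define N where "N n = sqn (legendre_P n)" for n
  have N: "N n > 0" for n unfolding N_def by (rule sqn_legendre_P_pos)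
  define a where "a n = coef h n / (of_real (N n) * (sq_eig n - z))" for n
  define b where "b n = 4 * sqrt (sqn h) * ((1 + real (n * (n + 1))) / norm (sq_eig n - z))" for n
  define S where "S m x = (\<Sum>n<m. a n * legendre_P n x)" for m x
  define u where "u x = (\<Sum>n. a n * legendre_P n x)" for x
  have zn: "norm (sq_eig n - z) > 0" for n using z[of n] by simp
  have bs: "summable b" unfolding b_def by (rule summable_mult[OF summable_eig_ratio])
  have b0: "0 \<le> b n" for n unfolding b_def using sqn_nonneg[of h] by (intro mult_nonneg_nonneg divide_nonneg_nonneg) auto
  have ab: "norm (a n * legendre_P n x) \<le> b n" if x: "x \<in> I1" for n x
  proof -
    have "norm (a n * legendre_P n x) = norm (coef h n) / (N n * norm (sq_eig n - z)) * norm (legendre_P n x)"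
      unfolding a_def norm_mult norm_divide norm_of_real using N[of n] by simp
    also have "\<dots> \<le> (sqrt (sqn h) * sqrt (N n)) / (N n * norm (sq_eig n - z)) * (4 * (1 + real (n * (n + 1))) * sqrt (N n))"
      using norm_coef_le[OF h, of n] legendre_P_sup[OF x, of n] N[of n] zn[of n] sqn_nonneg[of h]
      unfolding N_def[symmetric] by (intro mult_mono divide_right_mono divide_nonneg_nonneg mult_nonneg_nonneg) auto
    also have "\<dots> = 4 * sqrt (sqn h) * (1 + real (n * (n + 1))) / norm (sq_eig n - z) * (sqrt (N n) * sqrt (N n) / N n)"
      by (simp only: times_divide_eq_right times_divide_eq_left divide_divide_eq_left mult_ac)
    also have "\<dots> = b n" unfolding b_def using N[of n] by simp
    finally show ?thesis .
  qed
  have su: "summable (\<lambda>n. a n * legendre_P n x)" if "x \<in> I1" for x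
    by (rule summable_comparison_test'[OF bs]) (rule ab[OF that])
  have lim: "(\<lambda>m. S m x) \<longlonglongrightarrow> u x" if "x \<in> I1" for x
    unfolding S_def u_def by (rule summable_LIMSEQ[OF su[OF that]])
  have Sb: "norm (S m x) \<le> suminf b" if "x \<in> I1" for m x
  proof -
    have "norm (S m x) \<le> (\<Sum>n<m. b n)" unfolding S_def by (rule sum_norm_le) (rule ab[OF that])
    also have "\<dots> \<le> suminf b" by (rule sum_le_suminf[OF bs]) (auto intro: b0)
    finally show ?thesis .
  qed
  have ub: "norm (u x) \<le> suminf b" if "x \<in> I1" for x
    by (rule tendsto_upperbound[OF tendsto_norm[OF lim[OF that]]]) (auto intro!: always_eventually Sb[OF that])
  have S2: "S m \<in> L2" for m unfolding S_def by (rule L2_legendre_sum)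
  have um: "u \<in> borel_measurable leb_I"
    by (rule borel_measurable_LIMSEQ_metric[OF L2_measurable[OF S2] lim]) simp
  have u2: "u \<in> L2" by (rule L2_bounded[OF um ub])
  \<comment> \<open>The partial sums are uniformly bounded, so the limit may be taken under the
    integral.\<close>
  have cu: "coef u k = a k * of_real (N k)" for k
  proof -
    have "(\<lambda>m. LINT x|leb_I. S m x * cnj (legendre_P k x)) \<longlonglongrightarrow> (LINT x|leb_I. u x * cnj (legendre_P k x))"
    proof (rule integral_dominated_convergence[where w="\<lambda>x. suminf b * norm (legendre_P k x)"])
      show "integrable leb_I (\<lambda>x. suminf b * norm (legendre_P k x))"
        using L2_integrable[OF L2_legendre_P] by simp
      show "AE x in leb_I. (\<lambda>m. S m x * cnj (legendre_P k x)) \<longlonglongrightarrow> u x * cnj (legendre_P k x)"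
        by (intro AE_I2 tendsto_mult_right lim) simp
      show "AE x in leb_I. norm (S m x * cnj (legendre_P k x)) \<le> suminf b * norm (legendre_P k x)" for m
        unfolding norm_mult complex_mod_cnj by (intro AE_I2 mult_right_mono Sb) auto
    qed (use L2_measurable[OF S2] um L2_measurable[OF L2_legendre_P] in \<open>simp_all\<close>)
    then have "(\<lambda>m. coef (S m) k) \<longlonglongrightarrow> coef u k" unfolding coef_def l2_inner_def .
    moreover have "eventually (\<lambda>m. coef (S m) k = a k * of_real (N k)) sequentially"
      unfolding S_def coef_legendre_sum N_def by (intro eventually_sequentiallyI[of "Suc k"]) simp
    then have "(\<lambda>m. coef (S m) k) \<longlonglongrightarrow> a k * of_real (N k)" by (rule tendsto_eventually)
    ultimately show ?thesis by (rule LIMSEQ_unique)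
  qed
  have "coef h k = (sq_eig k - z) * coef u k" for k
    unfolding cu a_def using N[of k] z[of k] by simp
  then have "coef (\<lambda>x. h x + z * u x) k = sq_eig k * coef u k" for k
    unfolding coef_add[OF h L2_cmult[OF u2]] coef_cmult by (simp only: left_diff_distrib diff_add_cancel)
  then have "(u, \<lambda>x. h x + z * u x) \<in> op_T"
    unfolding op_T_iff using u2 L2_add[OF h L2_cmult[OF u2]] by blast
  then show ?thesis by blast
qed

text \<open>The coefficients of v - z u are (\<open>sq_eig n\<close> - z) u_n. Bessel's inequality
  bounds their sum of squares, and the approximate Parseval identity recovers
  \<open>sqn u\<close>.\<close>

lemma resolvent_bounded:
  assumes uv: "(u, v) \<in> op_T" and d: "d > 0" "\<And>n. d \<le> norm (sq_eig n - z)"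
  shows "l2_norm u \<le> 1 / d * l2_norm (\<lambda>x. v x - z * u x)"
proof -
  let ?w = "\<lambda>x. v x - z * u x"
  have u: "u \<in> L2" "v \<in> L2" using op_T_L2[OF uv] by auto
  have w: "?w \<in> L2" by (intro L2_diff L2_cmult u)
  have cw: "coef ?w n = (sq_eig n - z) * coef u n" for n
    unfolding coef_diff[OF u(2) L2_cmult[OF u(1)]] coef_cmult using uv unfolding op_T_iff by (simp only: left_diff_distrib)
  have "sqn u \<le> sqn ?w / d\<^sup>2 + e" if e: "e > 0" for e
  proof -
    obtain N :: nat where N: "sqn u < (\<Sum>n<N. (norm (coef u n))\<^sup>2 / sqn (legendre_P n)) + e"
      using parseval_approx[OF u(1) e] by blast
    have "(\<Sum>n<N. (norm (coef u n))\<^sup>2 / sqn (legendre_P n)) \<le> (\<Sum>n<N. (norm (coef ?w n))\<^sup>2 / sqn (legendre_P n) / d\<^sup>2)"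
    proof (rule sum_mono)
      fix n
      have "d\<^sup>2 * (norm (coef u n))\<^sup>2 \<le> (norm (coef ?w n))\<^sup>2"
        unfolding cw norm_mult power_mult_distrib using d by (intro mult_right_mono power_mono) auto
      then have "(norm (coef u n))\<^sup>2 \<le> (norm (coef ?w n))\<^sup>2 / d\<^sup>2" using d by (simp add: field_simps)
      then have "(norm (coef u n))\<^sup>2 / sqn (legendre_P n) \<le> (norm (coef ?w n))\<^sup>2 / d\<^sup>2 / sqn (legendre_P n)"
        by (rule divide_right_mono[OF _ sqn_nonneg])
      then show "(norm (coef u n))\<^sup>2 / sqn (legendre_P n) \<le> (norm (coef ?w n))\<^sup>2 / sqn (legendre_P n) / d\<^sup>2"
        by (simp only: divide_divide_eq_left mult.commute)
    qed
    also have "\<dots> = (\<Sum>n<N. (norm (coef ?w n))\<^sup>2 / sqn (legendre_P n)) / d\<^sup>2" by (rule sum_divide_distrib[symmetric])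
    also have "\<dots> \<le> sqn ?w / d\<^sup>2" by (intro divide_right_mono bessel_inequality[OF w]) simp
    finally show ?thesis using N by linarith
  qed
  then have "sqn u \<le> sqn ?w / d\<^sup>2" by (rule field_le_epsilon)
  then have "sqrt (sqn u) \<le> sqrt (sqn ?w / d\<^sup>2)" by (rule real_sqrt_le_mono)
  then show ?thesis unfolding l2_norm_sqn using d(1) by (simp add: real_sqrt_divide)
qed

text \<open>At an eigenvalue injectivity fails. Elsewhere the gap to the eigenvalues bounds the
  inverse, and the series gives surjectivity.\<close>

lemma resolvent_set_op_T: "resolvent_set op_T = - range sq_eig"
proof (intro set_eqI iffI)
  fix z assume R: "z \<in> resolvent_set op_T"
  have "z \<noteq> sq_eig n" for n
  proof
    assume z: "z = sq_eig n"
    have E: "\<not> ae_eq (legendre_P n) (\<lambda>x. 0)" "(legendre_P n, \<lambda>x. z * legendre_P n x) \<in> op_T"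
      using legendre_eigenfunction[of n] unfolding eigenfunction_def z by auto
    from R have A: "\<forall>(u, v)\<in>op_T. ae_eq (\<lambda>x. v x - z * u x) (\<lambda>x. 0) \<longrightarrow> ae_eq u (\<lambda>x. 0)"
      unfolding resolvent_set_def by blast
    show False using bspec[OF A E(2)] E(1) by (simp add: ae_eq_refl)
  qed
  then show "z \<in> - range sq_eig" by blast
next
  fix z assume "z \<in> - range sq_eig"
  then have z: "z \<noteq> sq_eig n" for n by blast
  show "z \<in> resolvent_set op_T"
    unfolding resolvent_set_def mem_Collect_eq
  proof (intro conjI ballI)
    obtain d where d: "d > 0" "\<And>n. d \<le> norm (sq_eig n - z)" using sq_eig_gap[OF z] by blast
    show "\<exists>C. \<forall>(u, v)\<in>op_T. l2_norm u \<le> C * l2_norm (\<lambda>x. v x - z * u x)"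
      using resolvent_bounded[OF _ d] by (intro exI[of _ "1 / d"]) blast
  next
    fix p assume "p \<in> op_T"
    then obtain u v where p: "p = (u, v)" and uv: "(u, v) \<in> op_T" by (cases p) auto
    have u: "u \<in> L2" "v \<in> L2" using op_T_L2[OF uv] by auto
    have "ae_eq u (\<lambda>x. 0)" if e: "ae_eq (\<lambda>x. v x - z * u x) (\<lambda>x. 0)"
    proof (rule coef_eq_0_imp[OF u(1)])
      fix n
      have "coef (\<lambda>x. v x - z * u x) n = coef (\<lambda>x. 0) n"
        using e unfolding ae_eq_def by (intro coef_cong_AE L2_diff L2_cmult u)
      also have "\<dots> = 0" by (simp add: coef_def l2_inner_def)
      finally have "coef v n - z * coef u n = 0" unfolding coef_diff[OF u(2) L2_cmult[OF u(1)]] coef_cmult .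
      then have "(sq_eig n - z) * coef u n = 0" using uv unfolding op_T_iff by (simp only: left_diff_distrib)
      then show "coef u n = 0" using z[of n] by simp
    qed
    then show "case p of (u, v) \<Rightarrow> ae_eq (\<lambda>x. v x - z * u x) (\<lambda>x. 0) \<longrightarrow> ae_eq u (\<lambda>x. 0)"
      unfolding p by simp
  next
    fix h assume "h \<in> L2"
    then obtain u where u: "(u, \<lambda>x. h x + z * u x) \<in> op_T" using resolvent_surj[of h z] z by blast
    have "ae_eq (\<lambda>x. (h x + z * u x) - z * u x) h" by (simp add: ae_eq_refl)
    with u show "\<exists>(u, v)\<in>op_T. ae_eq (\<lambda>x. v x - z * u x) h"
      by (intro bexI[of _ "(u, \<lambda>x. h x + z * u x)"]) simp_all
  qed
qed

lemma spectrum_op_T: "spectrum op_T = range sq_eig"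
  unfolding spectrum_def resolvent_set_op_T by simp

text \<open>The eigenvalues are simple: \<open>sq_eig\<close> is injective, so an eigenfunction for
  \<open>sq_eig n\<close> has no nonzero coefficient other than the n-th.\<close>

lemma op_T_discrete_spectrum: "has_discrete_spectrum op_T"
  unfolding has_discrete_spectrum_def spectrum_op_T
proof (intro ballI conjI)
  fix z assume "z \<in> range sq_eig"
  then obtain n where z: "z = sq_eig n" by blast
  have "ball z 1 \<inter> range sq_eig = {z}"
  proof (intro set_eqI iffI)
    fix y assume "y \<in> ball z 1 \<inter> range sq_eig"
    then obtain m where "y = sq_eig m" "norm (sq_eig n - sq_eig m) < 1" by (auto simp: z dist_norm)
    then show "y \<in> {z}" using sq_eig_dist[of n m] unfolding z by force
  qed (auto simp: z)
  then show "z isolated_in range sq_eig"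
    unfolding isolated_in_def z by (intro conjI exI[of _ "ball (sq_eig n) 1"]) auto
  show "\<exists>u. eigenfunction op_T z u" unfolding z using legendre_eigenfunction by blast
  show "\<exists>(m::nat) b. \<forall>u. eigenfunction op_T z u \<longrightarrow> (\<exists>c. ae_eq u (\<lambda>x. \<Sum>i<m. c i * b i x))"
  proof (intro exI[of _ "1::nat"] exI[of _ "\<lambda>_. legendre_P n"] allI impI)
    fix u assume "eigenfunction op_T z u"
    then have T: "(u, \<lambda>x. z * u x) \<in> op_T" unfolding eigenfunction_def by blast
    have u: "u \<in> L2" using op_T_L2[OF T] by blast
    define c where "c = coef u n / of_real (sqn (legendre_P n))"
    have "coef u k = coef (\<lambda>x. c * legendre_P n x) k" for k
    proof (cases "k = n")
      case True
      then show ?thesis unfolding coef_cmult True coef_legendre_P_same c_def using sqn_legendre_P_pos[of n] by simp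
    next
      case False
      have "z * coef u k = sq_eig k * coef u k" using T unfolding op_T_iff coef_cmult by blast
      moreover have "z \<noteq> sq_eig k" using sq_eig_eq_iff[of n k] False unfolding z by blast
      ultimately have "coef u k = 0" by (metis mult_cancel_right)
      then show ?thesis using coef_legendre_P_orthogonal[of n k] False by (simp add: coef_cmult)
    qed
    then have "ae_eq u (\<lambda>x. c * legendre_P n x)"
      by (intro coef_eq_imp_ae_eq u L2_cmult L2_legendre_P)
    note ae = this
    have one: "{..<1::nat} = {0}" by auto
    from ae show "\<exists>c. ae_eq u (\<lambda>x. \<Sum>i<(1::nat). c i * legendre_P n x)"
      unfolding one by (intro exI[of _ "\<lambda>_. c"]) simp
  qed
qed

theorem theorem6:
  shows "(\<forall>f :: real \<Rightarrow> complex.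
      (f \<in> dom_T \<longleftrightarrow>
         f \<in> AC_loc_upto 3 \<and> (\<lambda>x. (leg_w x)\<^sup>2 * (ddx ^^ 4) f x) \<in> L2) \<and>
      (f \<in> dom_T \<longleftrightarrow>
         f \<in> Delta2_max \<and>
         lim0_at_ends (bracket2 f (\<lambda>x. 1)) \<and>
         lim0_at_ends (bracket2 f (\<lambda>x. of_real x))) \<and>
      (f \<in> dom_T \<longleftrightarrow>
         f \<in> Delta2_max \<and>
         lim0_at_ends (\<lambda>x. leg_w x * ddx f x) \<and>
         lim0_at_ends (ddx (\<lambda>t. (leg_w t)\<^sup>2 * (ddx ^^ 2) f t)))) \<and>
    op_T = op_A O op_A \<and>
    self_adjoint op_T \<and>
    (\<forall>n. eigenfunction op_T (of_nat (n\<^sup>2 * (n + 1)\<^sup>2)) (legendre_P n)) \<and>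
    l2_complete legendre_P \<and>
    has_discrete_spectrum op_T \<and>
    spectrum op_T = {of_nat (n\<^sup>2 * (n + 1)\<^sup>2) | n :: nat. True}"
proof (intro conjI allI)
  fix f
  \<comment> \<open>The locale presupposes three derivatives; each side of every equivalence
    provides them.\<close>
  have ac: "ac3 f" if "f \<in> AC_loc_upto 3" using that by unfold_locales
  have D: "f \<in> Delta2_max \<Longrightarrow> f \<in> AC_loc_upto 3" by (simp add: Delta2_max_def)
  show "f \<in> dom_T \<longleftrightarrow> f \<in> AC_loc_upto 3 \<and> (\<lambda>x. (leg_w x)\<^sup>2 * (ddx ^^ 4) f x) \<in> L2"
    unfolding funpow_ddx using ac3.dom_T_iff_ii[OF ac] dom_T_imp_AC_loc_upto_3 by blast
  show "f \<in> dom_T \<longleftrightarrow> f \<in> Delta2_max \<and> lim0_at_ends (bracket2 f (\<lambda>x. 1)) \<and>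
      lim0_at_ends (bracket2 f (\<lambda>x. of_real x))"
    using ac3.dom_T_iff_iii[OF ac] dom_T_imp_AC_loc_upto_3 D by blast
  show "f \<in> dom_T \<longleftrightarrow> f \<in> Delta2_max \<and> lim0_at_ends (\<lambda>x. leg_w x * ddx f x) \<and>
      lim0_at_ends (ddx (\<lambda>t. (leg_w t)\<^sup>2 * (ddx ^^ 2) f t))"
    unfolding funpow_ddx using ac3.dom_T_iff_iv[OF ac] dom_T_imp_AC_loc_upto_3 D by blast
next
  show "spectrum op_T = {of_nat (n\<^sup>2 * (n + 1)\<^sup>2) | n :: nat. True}"
    unfolding spectrum_op_T by blast
qed (rule op_A_comp op_T_self_adjoint legendre_eigenfunction legendre_complete op_T_discrete_spectrum)+

end
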